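(* Let $R$ be a Hecke symmetry on a finite dimensional vector space $V$ satisfying the $1$-dimensional source condition. Then the $R$-symmetric algebra $\mathbb S(V,R)$ and the $R$-skewsymmetric algebra $\Lambda(V,R)$ are Koszul, and their Hilbert series satisfy $h_{\mathbb S(V,R)}(t)\,h_{\Lambda(V,R)}(-t)=1$.
   Context: $\Bbbk$ is a field. A Hecke symmetry with parameter $0\neq q\in\Bbbk$ on $V$ is a linear operator $R$ on $V\otimes V$ with $(R+\mathrm{id})(R-q\,\mathrm{id})=0$ and $R_1R_2R_1=R_2R_1R_2$ on $V^{\otimes3}$, where $R_1=R\otimes\mathrm{id}_V$, $R_2=\mathrm{id}_V\otimes R$. It gives a representation of the Hecke algebra $\mathcal H_n(q)$ (generators $T_1,\dots,T_{n-1}$, braid relations, $(T_i-q)(T_i+1)=0$) on $V^{\otimes n}$ with $T_i$ acting by $\mathrm{id}^{\otimes(i-1)}\otimes R\otimes\mathrm{id}^{\otimes(n-i-1)}$. An indecomposable $\mathcal H_n$-module has a $1$-dimensional source if it is a direct summand of a module induced from a $1$-dimensional representation of a parabolic subalgebra $\mathcal H_\lambda$ (generated by $T_j$, $j\notin\{\lambda_1,\lambda_1+\lambda_2,\dots\}$, $\lambda$ a composition of $n$). $R$ satisfies the $1$-dimensional source condition if for every $n>0$ all indecomposable direct summands of the $\mathcal H_n$-module $V^{\otimes n}$ have $1$-dimensional sources. $\mathbb S(V,R)$ and $\Lambda(V,R)$ are the quotients of the tensor algebra $\mathbb T(V)$ by the ideals generated by $\operatorname{Im}(R-q\,\mathrm{id})$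 and $\operatorname{Ker}(R-q\,\mathrm{id})$ respectively. A quadratic graded algebra $A$ is Koszul if its right Koszul complex is a resolution of the trivial module $\Bbbk$ (equivalently, $\Bbbk$ has a linear graded free resolution). The Hilbert series is $h_A(t)=\sum_n(\dim A_n)t^n$. *)

theory Defs
  imports Main
    "HOL-Library.Function_Algebras"
    "HOL-Combinatorics.Permutations"
    "HOL-Combinatorics.Transposition"
    "HOL-Computational_Algebra.Formal_Power_Series"
begin

definition sc :: "'k::field \<Rightarrow> ('a \<Rightarrow> 'k) \<Rightarrow> ('a \<Rightarrow> 'k)" where
  "sc c f = (\<lambda>w. c * f w)"

definition words :: "nat \<Rightarrow> nat \<Rightarrow> nat list set" where
  "words d n = {w. length w = n \<and> set w \<subseteq> {..<d}}"

text \<open>The tensor power V^{\<otimes>n}, V = k^d, in coordinates: coefficient functions on basis words.\<close>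
definition tens :: "nat \<Rightarrow> nat \<Rightarrow> (nat list \<Rightarrow> 'k::field) set" where
  "tens d n = {f. \<forall>w. w \<notin> words d n \<longrightarrow> f w = 0}"

text \<open>Elementary tensor u \<otimes> v of u in V^{\<otimes>a} and v in V^{\<otimes>b}.\<close>
definition etens :: "nat \<Rightarrow> (nat list \<Rightarrow> 'k::field) \<Rightarrow> (nat list \<Rightarrow> 'k) \<Rightarrow> (nat list \<Rightarrow> 'k)" where
  "etens a u v = (\<lambda>w. u (take a w) * v (drop a w))"

definition tensor_sp :: "nat \<Rightarrow> (nat list \<Rightarrow> 'k::field) set \<Rightarrow> (nat list \<Rightarrow> 'k) set \<Rightarrow> (nat list \<Rightarrow> 'k) set" where
  "tensor_sp a U U' = module.span sc {etens a u v | u v. u \<in> U \<and> v \<in> U'}"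

text \<open>The operator R_{i+1} = id^{\<otimes>i} \<otimes> R \<otimes> id on V^{\<otimes>n} (positions i, i+1, 0-indexed),
  where R is given by its matrix: R(e_c \<otimes> e_e) = \<Sum>_{a,b} R a b c e \<cdot> e_a \<otimes> e_b.\<close>
definition Rop :: "nat \<Rightarrow> (nat \<Rightarrow> nat \<Rightarrow> nat \<Rightarrow> nat \<Rightarrow> 'k::field) \<Rightarrow> nat \<Rightarrow> (nat list \<Rightarrow> 'k) \<Rightarrow> (nat list \<Rightarrow> 'k)" where
  "Rop d R i f = (\<lambda>w. if set w \<subseteq> {..<d} \<and> Suc i < length w
       then (\<Sum>c<d. \<Sum>e<d. R (w ! i) (w ! Suc i) c e * f (w[i := c, Suc i := e]))
       else 0)"

definition hecke_symmetry :: "nat \<Rightarrow> 'k::field \<Rightarrow> (nat \<Rightarrow> nat \<Rightarrow> nat \<Rightarrow> nat \<Rightarrow> 'k) \<Rightarrow> bool" where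
  "hecke_symmetry d q R \<longleftrightarrow> q \<noteq> 0
     \<and> (\<forall>f \<in> tens d 2. Rop d R 0 (Rop d R 0 f) = (\<lambda>w. (q - 1) * Rop d R 0 f w + q * f w))
     \<and> (\<forall>f \<in> tens d 3. Rop d R 0 (Rop d R 1 (Rop d R 0 f)) = Rop d R 1 (Rop d R 0 (Rop d R 1 f)))"

text \<open>H_n-submodule of V^{\<otimes>n}: subspace stable under all T_{i+1} (i+1 < n) acting by R_{i+1}.\<close>
definition inv_sub :: "nat \<Rightarrow> (nat \<Rightarrow> nat \<Rightarrow> nat \<Rightarrow> nat \<Rightarrow> 'k::field) \<Rightarrow> nat \<Rightarrow> (nat list \<Rightarrow> 'k) set \<Rightarrow> bool" where
  "inv_sub d R n M \<longleftrightarrow> module.subspace sc M \<and> M \<subseteq> tens d n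
     \<and> (\<forall>i. Suc i < n \<longrightarrow> (\<forall>m \<in> M. Rop d R i m \<in> M))"

definition indec_summand :: "nat \<Rightarrow> (nat \<Rightarrow> nat \<Rightarrow> nat \<Rightarrow> nat \<Rightarrow> 'k::field) \<Rightarrow> nat \<Rightarrow> (nat list \<Rightarrow> 'k) set \<Rightarrow> bool" where
  "indec_summand d R n M \<longleftrightarrow> inv_sub d R n M
     \<and> (\<exists>N. inv_sub d R n N \<and> M \<inter> N = {0} \<and> tens d n = {m + x | m x. m \<in> M \<and> x \<in> N})
     \<and> M \<noteq> {0}
     \<and> (\<forall>M1 M2. inv_sub d R n M1 \<and> inv_sub d R n M2 \<and> M1 \<inter> M2 = {0}
            \<and> M = {a + b | a b. a \<in> M1 \<and> b \<in> M2} \<longrightarrow> M1 = {0} \<or> M2 = {0})"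

definition perms :: "nat \<Rightarrow> (nat \<Rightarrow> nat) set" where
  "perms n = {p. p permutes {..<n}}"

text \<open>Coxeter length = number of inversions.\<close>
definition hlen :: "nat \<Rightarrow> (nat \<Rightarrow> nat) \<Rightarrow> nat" where
  "hlen n p = card {(i, j). i < j \<and> j < n \<and> p j < p i}"

text \<open>Elements of H_n: coefficient functions x with x = \<Sum>_w x(w) T_w.\<close>
definition hecke :: "nat \<Rightarrow> ((nat \<Rightarrow> nat) \<Rightarrow> 'k::field) set" where
  "hecke n = {x. \<forall>p. p \<notin> perms n \<longrightarrow> x p = 0}"

text \<open>Simple transposition s_{s+1} = (s, s+1) (0-indexed positions); T_{s+1} in the paper.\<close>
definition sgen :: "nat \<Rightarrow> nat \<Rightarrow> nat" where
  "sgen s = transpose s (Suc s)"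

text \<open>Left multiplication by T_{s+1}: T_s T_w = T_{sw} if l(sw) > l(w), else q T_{sw} + (q-1) T_w.\<close>
definition hl :: "nat \<Rightarrow> 'k::field \<Rightarrow> nat \<Rightarrow> ((nat \<Rightarrow> nat) \<Rightarrow> 'k) \<Rightarrow> ((nat \<Rightarrow> nat) \<Rightarrow> 'k)" where
  "hl n q s x = (\<lambda>u. if hlen n (sgen s \<circ> u) < hlen n u
       then x (sgen s \<circ> u) + (q - 1) * x u else q * x (sgen s \<circ> u))"

definition hr :: "nat \<Rightarrow> 'k::field \<Rightarrow> ((nat \<Rightarrow> nat) \<Rightarrow> 'k) \<Rightarrow> nat \<Rightarrow> ((nat \<Rightarrow> nat) \<Rightarrow> 'k)" where
  "hr n q x s = (\<lambda>u. if hlen n (u \<circ> sgen s) < hlen n u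
       then x (u \<circ> sgen s) + (q - 1) * x u else q * x (u \<circ> sgen s))"

definition composition :: "nat \<Rightarrow> nat list \<Rightarrow> bool" where
  "composition n lam \<longleftrightarrow> (\<forall>p \<in> set lam. 0 < p) \<and> sum_list lam = n"

definition breaks :: "nat list \<Rightarrow> nat set" where
  "breaks lam = {sum_list (take k lam) | k. 1 \<le> k \<and> k \<le> length lam}"

text \<open>0-indexed generators s of H_lam: T_{s+1} with s+1 \<notin> {lam_1, lam_1+lam_2, ...}.\<close>
definition par_gens :: "nat \<Rightarrow> nat list \<Rightarrow> nat set" where
  "par_gens n lam = {s. Suc s < n \<and> Suc s \<notin> breaks lam}"

text \<open>1-dimensional representation of H_lam: values chi(s) on generators T_{s+1} satisfying
  the defining (quadratic and braid) relations of H_lam (commutation relations are automatic).\<close>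
definition one_dim_rep :: "'k::field \<Rightarrow> nat \<Rightarrow> nat list \<Rightarrow> (nat \<Rightarrow> 'k) \<Rightarrow> bool" where
  "one_dim_rep q n lam chi \<longleftrightarrow>
     (\<forall>s \<in> par_gens n lam. (chi s - q) * (chi s + 1) = 0)
     \<and> (\<forall>s. s \<in> par_gens n lam \<and> Suc s \<in> par_gens n lam \<longrightarrow>
           chi s * chi (Suc s) * chi s = chi (Suc s) * chi s * chi (Suc s))"

text \<open>Ind = H_n \<otimes>_{H_lam} k_chi = H_n / K with K = span { x T_s - chi(s) x }.\<close>
definition ind_kernel :: "nat \<Rightarrow> 'k::field \<Rightarrow> nat list \<Rightarrow> (nat \<Rightarrow> 'k) \<Rightarrow> ((nat \<Rightarrow> nat) \<Rightarrow> 'k) set" where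
  "ind_kernel n q lam chi = module.span sc
     {(\<lambda>u. hr n q x s u - chi s * x u) | x s. x \<in> hecke n \<and> s \<in> par_gens n lam}"

text \<open>M is isomorphic to a direct summand of Ind: there are H_n-module maps
  f : M \<rightarrow> H_n/K and g : H_n/K \<rightarrow> M with g \<circ> f = id_M.\<close>
definition summand_of_induced :: "nat \<Rightarrow> 'k::field \<Rightarrow> (nat \<Rightarrow> nat \<Rightarrow> nat \<Rightarrow> nat \<Rightarrow> 'k) \<Rightarrow> nat
     \<Rightarrow> (nat list \<Rightarrow> 'k) set \<Rightarrow> nat list \<Rightarrow> (nat \<Rightarrow> 'k) \<Rightarrow> bool" where
  "summand_of_induced d q R n M lam chi \<longleftrightarrow>
     (\<exists>f g. (\<forall>m \<in> M. f m \<in> hecke n)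
        \<and> (\<forall>a \<in> M. \<forall>b \<in> M. f (a + b) = f a + f b)
        \<and> (\<forall>c. \<forall>a \<in> M. f (sc c a) = sc c (f a))
        \<and> (\<forall>m \<in> M. \<forall>s. Suc s < n \<longrightarrow> f (Rop d R s m) - hl n q s (f m) \<in> ind_kernel n q lam chi)
        \<and> (\<forall>x \<in> hecke n. g x \<in> M)
        \<and> (\<forall>x \<in> hecke n. \<forall>y \<in> hecke n. g (x + y) = g x + g y)
        \<and> (\<forall>c. \<forall>x \<in> hecke n. g (sc c x) = sc c (g x))
        \<and> (\<forall>x \<in> ind_kernel n q lam chi. g x = 0)
        \<and> (\<forall>x \<in> hecke n. \<forall>s. Suc s < n \<longrightarrow> g (hl n q s x) = Rop d R s (g x))
        \<and> (\<forall>m \<in> M. g (f m) = m))"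

definition one_dim_source_cond :: "nat \<Rightarrow> 'k::field \<Rightarrow> (nat \<Rightarrow> nat \<Rightarrow> nat \<Rightarrow> nat \<Rightarrow> 'k) \<Rightarrow> bool" where
  "one_dim_source_cond d q R \<longleftrightarrow>
     (\<forall>n > 0. \<forall>M. indec_summand d R n M \<longrightarrow>
        (\<exists>lam chi. composition n lam \<and> one_dim_rep q n lam chi
                   \<and> summand_of_induced d q R n M lam chi))"

definition emb :: "nat \<Rightarrow> (nat list \<Rightarrow> 'k::field) set \<Rightarrow> nat \<Rightarrow> nat \<Rightarrow> (nat list \<Rightarrow> 'k) set" where
  "emb d I i j = tensor_sp i (tens d i) (tensor_sp 2 I (tens d j))"

text \<open>Degree-m part of the ideal (I): J_m = \<Sum>_{i+2+j=m} V^i \<otimes> I \<otimes> V^j; A_m = V^{\<otimes>m}/J_m.\<close>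
definition Jsp :: "nat \<Rightarrow> (nat list \<Rightarrow> 'k::field) set \<Rightarrow> nat \<Rightarrow> (nat list \<Rightarrow> 'k) set" where
  "Jsp d I m = (if m < 2 then {0} else module.span sc (\<Union>i \<in> {..m-2}. emb d I i (m - 2 - i)))"

text \<open>W_n = (A^!_n)^* = \<Inter>_{i+2+j=n} V^i \<otimes> I \<otimes> V^j (W_0 = k, W_1 = V).\<close>
definition Wsp :: "nat \<Rightarrow> (nat list \<Rightarrow> 'k::field) set \<Rightarrow> nat \<Rightarrow> (nat list \<Rightarrow> 'k) set" where
  "Wsp d I n = (if n < 2 then tens d n else (\<Inter>i \<in> {..n-2}. emb d I i (n - 2 - i)))"

text \<open>Right Koszul complex K_n = W_n \<otimes> A; its component W_n \<otimes> A_m = Ccx n m / Zcx n m, with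
  differential W_n \<otimes> A_m \<rightarrow> W_{n-1} \<otimes> A_{m+1} induced by the identity of V^{\<otimes>(n+m)}.\<close>
definition Ccx :: "nat \<Rightarrow> (nat list \<Rightarrow> 'k::field) set \<Rightarrow> nat \<Rightarrow> nat \<Rightarrow> (nat list \<Rightarrow> 'k) set" where
  "Ccx d I n m = tensor_sp n (Wsp d I n) (tens d m)"

definition Zcx :: "nat \<Rightarrow> (nat list \<Rightarrow> 'k::field) set \<Rightarrow> nat \<Rightarrow> nat \<Rightarrow> (nat list \<Rightarrow> 'k) set" where
  "Zcx d I n m = tensor_sp n (Wsp d I n) (Jsp d I m)"

text \<open>Koszul: the right Koszul complex \<dots> \<rightarrow> W_2 \<otimes> A \<rightarrow> W_1 \<otimes> A \<rightarrow> A \<rightarrow> k \<rightarrow> 0 is exact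
  (exactness at W_n \<otimes> A_m for n \<ge> 1, and ker(A \<rightarrow> k) = A_+ = image of W_1 \<otimes> A).\<close>
definition koszul :: "nat \<Rightarrow> (nat list \<Rightarrow> 'k::field) set \<Rightarrow> bool" where
  "koszul d I \<longleftrightarrow>
     (\<forall>n m. 1 \<le> n \<longrightarrow> (\<forall>x \<in> Ccx d I n m. x \<in> Zcx d I (n - 1) (Suc m) \<longrightarrow>
         (if m = 0 then x \<in> Zcx d I n 0
          else (\<exists>y \<in> Ccx d I (Suc n) (m - 1). x - y \<in> Zcx d I n m))))
     \<and> (\<forall>m. 1 \<le> m \<longrightarrow> (\<forall>x \<in> Ccx d I 0 m. \<exists>y \<in> Ccx d I 1 (m - 1). x - y \<in> Zcx d I 0 m))"

text \<open>dim A_n = dim V^{\<otimes>n} - dim J_n.\<close>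
definition hdim :: "nat \<Rightarrow> (nat list \<Rightarrow> 'k::field) set \<Rightarrow> nat \<Rightarrow> nat" where
  "hdim d I n = vector_space.dim (sc :: 'k \<Rightarrow> _) (tens d n) - vector_space.dim (sc :: 'k \<Rightarrow> _) (Jsp d I n)"

text \<open>Relations of S(V,R): Im(R - q id); of \<Lambda>(V,R): Ker(R - q id).\<close>
definition IS :: "nat \<Rightarrow> 'k::field \<Rightarrow> (nat \<Rightarrow> nat \<Rightarrow> nat \<Rightarrow> nat \<Rightarrow> 'k) \<Rightarrow> (nat list \<Rightarrow> 'k) set" where
  "IS d q R = {(\<lambda>w. Rop d R 0 f w - q * f w) | f. f \<in> tens d 2}"

definition IL :: "nat \<Rightarrow> 'k::field \<Rightarrow> (nat \<Rightarrow> nat \<Rightarrow> nat \<Rightarrow> nat \<Rightarrow> 'k) \<Rightarrow> (nat list \<Rightarrow> 'k) set" where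
  "IL d q R = {f \<in> tens d 2. Rop d R 0 f = sc q f}"

end

theory Submission
  imports Defs "HOL-Combinatorics.Multiset_Permutations" "HOL-Computational_Algebra.Polynomial"
begin

text \<open>The components of degree \<open>N\<close> of the Koszul complexes of \<open>S(V,R)\<close> and \<open>\<Lambda>(V,R)\<close> are obtained from the
  \<open>H_N\<close>-module \<open>V^N\<close> by additive functors, so exactness passes to direct summands and it suffices to treat a module
  induced from a character of a parabolic subalgebra. Such a module is a weight space of the tensor power of a standard
  super vector space, where the letters are even or odd according to the character. There both algebras have PBW bases
  and the complex is a cube, contracted by moving the smallest letter of the weight.

  Exactness of the complex of \<open>\<Lambda>\<close> expresses \<open>h_\<Lambda>\<close> through the dimensions of the invariants
  \<open>\<Inter>i. Ker (R_i - q)\<close> of \<open>V^n\<close>, whereas \<open>dim S_n\<close> is the dimension of the coinvariants. For a summand \<open>e X\<close> of an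
  induced module \<open>X\<close> both are 0 or 1 according to the scalars by which \<open>e\<close> acts on the invariants and the coinvariants of
  \<open>X\<close>. These scalars are specialisations of polynomials in \<open>q\<close>, which coincide because for generic \<open>q\<close> the invariants map
  isomorphically onto the coinvariants.\<close>

section \<open>Finite dimensional subspaces of function spaces\<close>

text \<open>The parameter \<open>q\<close> may be a root of unity, even \<open>-1\<close>, so
  neither symmetrizers nor a splitting of \<open>V^2\<close> into \<open>Im (R - q)\<close> and
  \<open>Ker (R - q)\<close> are available. What survives is that every term of the complex is cut
  out of \<open>V^N\<close> by images and kernels of single operators \<open>R_i - q\<close>, and
  module maps respect these. The differential is induced by the identity of \<open>V^N\<close>, so
  exactness can be stated as membership in subspaces of one module, without forming quotients. On
  words both algebras are governed by a commutation scalar and a set of letters whose squares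
  vanish; the \<open>W\<close> part obeys the same kind of rules with the sign of the scalar changed
  and the set complemented. Each distinct letter of the weight then contributes one binary choice,
  hence the cube. Averaging over all rearrangements multiplies by the Poincare polynomial, which may
  vanish at \<open>q\<close>; so the scalars cannot be compared over the field itself. The lift to
  polynomials works because the condition on the image of the cyclic generator, symmetry of its
  coefficients under certain adjacent swaps, does not mention \<open>q\<close>.\<close>

interpretation fs: vector_space "sc :: 'k::field \<Rightarrow> ('a \<Rightarrow> 'k) \<Rightarrow> 'a \<Rightarrow> 'k"
  by unfold_locales (auto simp: sc_def algebra_simps fun_eq_iff)

lemma fun_sum_apply: "(\<Sum>i\<in>A. f i) w = (\<Sum>i\<in>A. f i w)"
  by (induction A rule: infinite_finite_induct) auto

text \<open>Spaces of functions on all words are infinite dimensional, so finite dimension is a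
  property carried along for each subspace.\<close>

definition fin_dim :: "('a \<Rightarrow> 'k::field) set \<Rightarrow> bool" where
  "fin_dim S \<longleftrightarrow> (\<exists>B. finite B \<and> S \<subseteq> fs.span B)"

definition sum_sp :: "('a \<Rightarrow> 'k::field) set \<Rightarrow> ('a \<Rightarrow> 'k) set \<Rightarrow> ('a \<Rightarrow> 'k) set" where
  "sum_sp A B = {a + b | a b. a \<in> A \<and> b \<in> B}"

lemma fin_dim_subset: "fin_dim T \<Longrightarrow> S \<subseteq> T \<Longrightarrow> fin_dim S"
  unfolding fin_dim_def by blast

lemma subspace_sum_sp: "fs.subspace A \<Longrightarrow> fs.subspace B \<Longrightarrow> fs.subspace (sum_sp A B)"
  unfolding sum_sp_def by (rule fs.subspace_sums)

lemma fin_dim_basis_extend: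
  fixes S :: "('a \<Rightarrow> 'k::field) set"
  assumes "fs.subspace S" "fin_dim S" "C \<subseteq> S" "fs.independent C"
  obtains B where "C \<subseteq> B" "finite B" "B \<subseteq> S" "fs.independent B" "fs.span B = S" "card B = fs.dim S"
proof -
  obtain B where B: "C \<subseteq> B" "B \<subseteq> S" "fs.independent B" "S \<subseteq> fs.span B"
    using fs.maximal_independent_subset_extend[OF assms(3,4)] by blast
  obtain G where G: "finite G" "S \<subseteq> fs.span G" using assms(2) unfolding fin_dim_def by blast
  have "finite B" using fs.independent_span_bound[OF G(1) B(3)] B(2) G(2) by blast
  moreover have "fs.span B = S" using B assms(1) fs.span_minimal by blast
  moreover have "card B = fs.dim S" using fs.basis_card_eq_dim B by blast
  ultimately show ?thesis using that B by blast
qed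

lemma fin_dim_basis:
  fixes S :: "('a \<Rightarrow> 'k::field) set"
  assumes "fs.subspace S" "fin_dim S"
  obtains B where "finite B" "B \<subseteq> S" "fs.independent B" "fs.span B = S" "card B = fs.dim S"
  using fin_dim_basis_extend[OF assms, of "{}"] fs.independent_empty by auto

lemma independent_Un:
  fixes P Q :: "('a \<Rightarrow> 'k::field) set"
  assumes "finite P" "finite Q" "fs.independent P" "fs.independent Q" "fs.span P \<inter> fs.span Q = {0}"
  shows "fs.independent (P \<union> Q)" "P \<inter> Q = {}"
proof -
  show d: "P \<inter> Q = {}"
  proof (rule ccontr)
    assume "P \<inter> Q \<noteq> {}"
    then obtain x where x: "x \<in> P" "x \<in> Q" by blast
    hence "x \<in> fs.span P \<inter> fs.span Q" by (auto intro: fs.span_base)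
    hence "x = 0" using assms by auto
    thus False using x assms(3) fs.dependent_zero by blast
  qed
  show "fs.independent (P \<union> Q)"
  proof
    assume "fs.dependent (P \<union> Q)"
    then obtain u v where u: "v \<in> P \<union> Q" "u v \<noteq> 0" "(\<Sum>v\<in>P \<union> Q. sc (u v) v) = 0"
      using assms(1,2) by (auto simp: fs.dependent_finite)
    have e: "(\<Sum>v\<in>P. sc (u v) v) + (\<Sum>v\<in>Q. sc (u v) v) = 0"
      using u(3) sum.union_disjoint[OF assms(1,2) d] by metis
    have p: "(\<Sum>v\<in>P. sc (u v) v) \<in> fs.span P" and q: "(\<Sum>v\<in>Q. sc (u v) v) \<in> fs.span Q"
      by (intro fs.span_sum fs.span_scale fs.span_base, assumption)+
    have "(\<Sum>v\<in>P. sc (u v) v) = - (\<Sum>v\<in>Q. sc (u v) v)"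
      using e by (rule eq_neg_iff_add_eq_0[THEN iffD2])
    moreover have "- (\<Sum>v\<in>Q. sc (u v) v) \<in> fs.span Q" using q by (rule fs.span_neg)
    ultimately have "(\<Sum>v\<in>P. sc (u v) v) \<in> fs.span P \<inter> fs.span Q" using p by (simp only: Int_iff)
    hence z: "(\<Sum>v\<in>P. sc (u v) v) = 0" using assms by auto
    hence z2: "(\<Sum>v\<in>Q. sc (u v) v) = 0" using e by simp
    have "\<forall>v\<in>P. u v = 0" using z assms(3) fs.dependent_finite[OF assms(1)] by blast
    moreover have "\<forall>v\<in>Q. u v = 0" using z2 assms(4) fs.dependent_finite[OF assms(2)] by blast
    ultimately show False using u by blast
  qed
qed

lemma span_Un_eq_sum_sp: "fs.span (P \<union> Q) = sum_sp (fs.span P) (fs.span Q)"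
  unfolding sum_sp_def by (rule fs.span_Un)

lemma dim_direct_sum:
  fixes A B :: "('a \<Rightarrow> 'k::field) set"
  assumes "fs.subspace A" "fs.subspace B" "fin_dim A" "fin_dim B" "A \<inter> B = {0}"
  shows "fs.dim (sum_sp A B) = fs.dim A + fs.dim B"
proof -
  obtain P where P: "finite P" "P \<subseteq> A" "fs.independent P" "fs.span P = A" "card P = fs.dim A"
    using fin_dim_basis[OF assms(1,3)] .
  obtain Q where Q: "finite Q" "Q \<subseteq> B" "fs.independent Q" "fs.span Q = B" "card Q = fs.dim B"
    using fin_dim_basis[OF assms(2,4)] .
  have i: "fs.independent (P \<union> Q)" "P \<inter> Q = {}"
    using independent_Un[OF P(1) Q(1) P(3) Q(3)] P Q assms by auto
  have "fs.dim (fs.span (P \<union> Q)) = card (P \<union> Q)" by (rule fs.dim_span_eq_card_independent[OF i(1)])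
  moreover have "fs.span (P \<union> Q) = sum_sp A B" using span_Un_eq_sum_sp[of P Q] P Q by simp
  ultimately show ?thesis using card_Un_disjoint[OF P(1) Q(1) i(2)] P Q by simp
qed

text \<open>A complement of the intersection inside \<open>B\<close> meets \<open>A\<close>
  trivially and has the same sum with \<open>A\<close>, so the direct case applies.\<close>

lemma dim_sum_Int:
  fixes A B :: "('a \<Rightarrow> 'k::field) set"
  assumes A: "fs.subspace A" "fin_dim A" and B: "fs.subspace B" "fin_dim B"
  shows "fs.dim (sum_sp A B) + fs.dim (A \<inter> B) = fs.dim A + fs.dim B"
proof -
  have I: "fs.subspace (A \<inter> B)" "fin_dim (A \<inter> B)"
    using A B fs.subspace_inter fin_dim_subset[of A "A \<inter> B"] by auto
  obtain C where C: "finite C" "C \<subseteq> A \<inter> B" "fs.independent C" "fs.span C = A \<inter> B" "card C = fs.dim (A \<inter> B)"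
    using fin_dim_basis[OF I] .
  obtain E where E: "C \<subseteq> E" "finite E" "E \<subseteq> B" "fs.independent E" "fs.span E = B" "card E = fs.dim B"
    using fin_dim_basis_extend[OF B, of C] C by auto
  let ?D = "fs.span (E - C)"
  have iD: "fs.independent (E - C)" using E(4) fs.independent_mono by blast
  have DB: "?D \<subseteq> B" using E fs.span_mono[of "E - C" E] by auto
  have dD: "fs.dim ?D = card E - card C"
    using fs.dim_span_eq_card_independent[OF iD] card_Diff_subset[OF C(1) E(1)] by simp
  have int0: "A \<inter> ?D = {0}"
  proof -
    have "x = 0" if xA: "x \<in> A" "x \<in> ?D" for x
    proof -
      have "x \<in> fs.span C" using xA DB C by blast
      then obtain f where f: "x = (\<Sum>v\<in>C. sc (f v) v)" using C(1) by (auto simp: fs.span_finite)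
      obtain g where g: "x = (\<Sum>v\<in>E - C. sc (g v) v)" using xA(2) E(2) fs.span_finite[of "E - C"] by auto
      \<comment> \<open>The expansions of \<open>x\<close> over \<open>C\<close> and over
        \<open>E - C\<close> combine to a linear relation on the basis \<open>E\<close>.\<close>
      let ?u = "\<lambda>v. if v \<in> C then f v else - g v"
      have "(\<Sum>v\<in>E. sc (?u v) v) = (\<Sum>v\<in>E - C. sc (?u v) v) + (\<Sum>v\<in>C. sc (?u v) v)"
        using sum.subset_diff[OF E(1) E(2)] by blast
      also have "(\<Sum>v\<in>E - C. sc (?u v) v) = - x"
        unfolding g sum_negf[symmetric] by (rule sum.cong) auto
      also have "(\<Sum>v\<in>C. sc (?u v) v) = x" unfolding f by (rule sum.cong) auto
      finally have "(\<Sum>v\<in>E. sc (?u v) v) = 0" by (simp only: left_minus)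
      hence u0: "?u v = 0" if "v \<in> E" for v
        using fs.independentD[OF E(4) E(2) order_refl _ that, of ?u] by blast
      have "f v = 0" if "v \<in> C" for v using u0[of v] that E(1) by auto
      thus ?thesis using f by simp
    qed
    moreover have "0 \<in> A \<inter> ?D" using A fs.subspace_0 fs.span_zero by blast
    ultimately show ?thesis by blast
  qed
  have "sum_sp A B = sum_sp A ?D"
  proof
    show "sum_sp A ?D \<subseteq> sum_sp A B" using DB unfolding sum_sp_def by blast
    show "sum_sp A B \<subseteq> sum_sp A ?D"
    proof
      fix x assume "x \<in> sum_sp A B"
      then obtain a b where ab: "x = a + b" "a \<in> A" "b \<in> B" unfolding sum_sp_def by blast
      have "fs.span (C \<union> (E - C)) = sum_sp (fs.span C) ?D" by (rule span_Un_eq_sum_sp)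
      hence "b \<in> sum_sp (fs.span C) ?D" using ab E(1,5) by (simp add: Un_absorb1)
      then obtain c e where ce: "b = c + e" "c \<in> fs.span C" "e \<in> ?D" unfolding sum_sp_def by blast
      hence "a + c \<in> A" using ab A C fs.subspace_add by blast
      moreover have "x = (a + c) + e" using ab ce by (simp add: add.assoc)
      ultimately show "x \<in> sum_sp A ?D" unfolding sum_sp_def using ce by blast
    qed
  qed
  moreover have "fs.dim (sum_sp A ?D) = fs.dim A + fs.dim ?D"
    using dim_direct_sum[OF A(1) fs.subspace_span A(2) _ int0] fin_dim_subset[OF B(2) DB] by simp
  moreover have "card C \<le> card E" using card_mono[OF E(2,1)] .
  ultimately show ?thesis using dD C E by simp
qed

lemma dim_mono_fin:
  fixes A B :: "('a \<Rightarrow> 'k::field) set"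
  assumes "A \<subseteq> B" "fs.subspace B" "fin_dim B"
  shows "fs.dim A \<le> fs.dim B"
proof -
  obtain P where P: "finite P" "P \<subseteq> B" "fs.independent P" "fs.span P = B" "card P = fs.dim B"
    using fin_dim_basis[OF assms(2,3)] .
  thus ?thesis using fs.dim_le_card[of A P] assms(1) by simp
qed

lemma dim_zero_sp [simp]: "fs.dim ({0} :: ('a \<Rightarrow> 'k::field) set) = 0"
  using fs.dim_span_eq_card_independent[of "{} :: ('a \<Rightarrow> 'k) set"] fs.independent_empty by simp

lemma dim_pos_fin:
  fixes A :: "('a \<Rightarrow> 'k::field) set"
  assumes "fs.subspace A" "fin_dim A" "A \<noteq> {0}"
  shows "fs.dim A > 0"
proof -
  obtain P where P: "finite P" "P \<subseteq> A" "fs.independent P" "fs.span P = A" "card P = fs.dim A"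
    using fin_dim_basis[OF assms(1,2)] .
  have "P \<noteq> {}" using P(4) assms(3) by auto
  thus ?thesis using P card_gt_0_iff by metis
qed

lemma dim_line:
  fixes x :: "'a \<Rightarrow> 'k::field"
  assumes "x \<noteq> 0"
  shows "fs.dim (range (\<lambda>c. sc c x)) = 1"
proof -
  have "fs.span {x} = range (\<lambda>c. sc c x)" by (rule fs.span_singleton)
  moreover have "fs.independent {x}" using assms by simp
  ultimately show ?thesis using fs.dim_span_eq_card_independent[of "{x}"] by simp
qed

definition supp_in :: "'a set \<Rightarrow> ('a \<Rightarrow> 'k::field) set" where
  "supp_in W = {f. \<forall>w. w \<notin> W \<longrightarrow> f w = 0}"

definition dlt :: "'a \<Rightarrow> 'a \<Rightarrow> 'k::comm_ring_1" where
  "dlt v = (\<lambda>w. if w = v then 1 else 0)"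

lemma subspace_supp_in: "fs.subspace (supp_in W)"
  by (auto simp: fs.subspace_def supp_in_def sc_def)

lemma supp_in_expand:
  assumes "finite W" "f \<in> supp_in W"
  shows "f = (\<Sum>v\<in>W. sc (f v) (dlt v))"
proof
  fix w
  have "(\<Sum>v\<in>W. sc (f v) (dlt v)) w = (\<Sum>v\<in>W. if v = w then f v else 0)"
    unfolding fun_sum_apply by (rule sum.cong) (auto simp: sc_def dlt_def)
  thus "f w = (\<Sum>v\<in>W. sc (f v) (dlt v)) w" using assms by (auto simp: supp_in_def)
qed

lemma dlt_in_supp_in: "v \<in> W \<Longrightarrow> dlt v \<in> supp_in W"
  by (auto simp: supp_in_def dlt_def)

lemma span_dlt: "finite W \<Longrightarrow> fs.span (dlt ` W) = (supp_in W :: ('a \<Rightarrow> 'k::field) set)"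
proof
  show "fs.span (dlt ` W) \<subseteq> (supp_in W :: ('a \<Rightarrow> 'k) set)"
    by (rule fs.span_minimal) (auto simp: dlt_in_supp_in subspace_supp_in)
  assume "finite W"
  show "(supp_in W :: ('a \<Rightarrow> 'k) set) \<subseteq> fs.span (dlt ` W)"
  proof
    fix f :: "'a \<Rightarrow> 'k" assume "f \<in> supp_in W"
    hence "f = (\<Sum>v\<in>W. sc (f v) (dlt v))" by (rule supp_in_expand[OF \<open>finite W\<close>])
    moreover have "(\<Sum>v\<in>W. sc (f v) (dlt v)) \<in> fs.span (dlt ` W)"
      by (intro fs.span_sum fs.span_scale fs.span_base imageI)
    ultimately show "f \<in> fs.span (dlt ` W)" by simp
  qed
qed

lemma fin_dim_supp_in: "finite W \<Longrightarrow> fin_dim (supp_in W :: ('a \<Rightarrow> 'k::field) set)"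
  unfolding fin_dim_def using span_dlt[of W] by (metis finite_imageI order_refl)

section \<open>Functoriality of the Koszul complex\<close>

definition lin_ops :: "(nat \<Rightarrow> ('a \<Rightarrow> 'k::field) \<Rightarrow> 'a \<Rightarrow> 'k) \<Rightarrow> bool" where
  "lin_ops T \<longleftrightarrow> (\<forall>i x y. T i (x + y) = T i x + T i y) \<and> (\<forall>i c x. T i (sc c x) = sc c (T i x))"

definition hmod :: "nat \<Rightarrow> (nat \<Rightarrow> ('a \<Rightarrow> 'k::field) \<Rightarrow> 'a \<Rightarrow> 'k) \<Rightarrow> ('a \<Rightarrow> 'k) set \<Rightarrow> bool" where
  "hmod N T M \<longleftrightarrow> lin_ops T \<and> fs.subspace M \<and> (\<forall>i. Suc i < N \<longrightarrow> (\<forall>m\<in>M. T i m \<in> M))"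

definition hhom :: "nat \<Rightarrow> (nat \<Rightarrow> ('a \<Rightarrow> 'k::field) \<Rightarrow> 'a \<Rightarrow> 'k) \<Rightarrow> ('a \<Rightarrow> 'k) set
    \<Rightarrow> (nat \<Rightarrow> ('b \<Rightarrow> 'k) \<Rightarrow> 'b \<Rightarrow> 'k) \<Rightarrow> ('b \<Rightarrow> 'k) set \<Rightarrow> (('a \<Rightarrow> 'k) \<Rightarrow> 'b \<Rightarrow> 'k) \<Rightarrow> bool" where
  "hhom N T M T' M' f \<longleftrightarrow> (\<forall>m\<in>M. f m \<in> M') \<and> (\<forall>a\<in>M. \<forall>b\<in>M. f (a + b) = f a + f b)
     \<and> (\<forall>c. \<forall>a\<in>M. f (sc c a) = sc c (f a)) \<and> (\<forall>m\<in>M. \<forall>i. Suc i < N \<longrightarrow> f (T i m) = T' i (f m))"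

text \<open>These are the quadratic relations of \<open>S(V,R)\<close> (\<open>im\<close>) and \<open>\<Lambda>(V,R)\<close> (\<open>\<not> im\<close>) in the positions
  \<open>i, i + 1\<close>, made functorial in the module so that the component \<open>W_n \<otimes> A_m\<close> of the Koszul complex becomes
  \<open>Fsp n / Zsp n\<close> below.\<close>
definition bop :: "bool \<Rightarrow> (nat \<Rightarrow> ('a \<Rightarrow> 'k::field) \<Rightarrow> 'a \<Rightarrow> 'k) \<Rightarrow> 'k \<Rightarrow> nat \<Rightarrow> ('a \<Rightarrow> 'k) set \<Rightarrow> ('a \<Rightarrow> 'k) set" where
  "bop im T q i P = (if im then (\<lambda>x. T i x - sc q x) ` P else {x \<in> P. T i x = sc q x})"

definition Fsp :: "bool \<Rightarrow> (nat \<Rightarrow> ('a \<Rightarrow> 'k::field) \<Rightarrow> 'a \<Rightarrow> 'k) \<Rightarrow> 'k \<Rightarrow> ('a \<Rightarrow> 'k) set \<Rightarrow> nat \<Rightarrow> ('a \<Rightarrow> 'k) set" where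
  "Fsp im T q M n = {x \<in> M. \<forall>i. Suc i < n \<longrightarrow> x \<in> bop im T q i M}"

text \<open>Relations are imposed inside \<open>Fsp\<close>, not inside \<open>M\<close>: the
  subspace to be divided out is \<open>W_n\<close> tensored with the ideal.\<close>

definition Zsp :: "bool \<Rightarrow> (nat \<Rightarrow> ('a \<Rightarrow> 'k::field) \<Rightarrow> 'a \<Rightarrow> 'k) \<Rightarrow> 'k \<Rightarrow> ('a \<Rightarrow> 'k) set \<Rightarrow> nat \<Rightarrow> nat \<Rightarrow> ('a \<Rightarrow> 'k) set" where
  "Zsp im T q M N n = fs.span (\<Union>i\<in>{i. n \<le> i \<and> Suc i < N}. bop im T q i (Fsp im T q M n))"

text \<open>A cycle is an element of \<open>Fsp n\<close> lying in \<open>Zsp (n - 1)\<close>; a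
  boundary is an element of \<open>Fsp (n + 1)\<close> up to \<open>Zsp n\<close>. At
  \<open>n = N\<close> there are no boundaries and \<open>Zsp N\<close> is zero, hence
  \<open>x = 0\<close>.\<close>

definition exact_cx :: "bool \<Rightarrow> (nat \<Rightarrow> ('a \<Rightarrow> 'k::field) \<Rightarrow> 'a \<Rightarrow> 'k) \<Rightarrow> 'k \<Rightarrow> ('a \<Rightarrow> 'k) set \<Rightarrow> nat \<Rightarrow> bool" where
  "exact_cx im T q M N \<longleftrightarrow> (\<forall>n x. 1 \<le> n \<and> n \<le> N \<and> x \<in> Fsp im T q M n \<and> x \<in> Zsp im T q M N (n - 1) \<longrightarrow>
     (if n = N then x = 0 else \<exists>y\<in>Fsp im T q M (Suc n). x - y \<in> Zsp im T q M N n))"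

lemma lin_opsD:
  assumes "lin_ops T"
  shows "T i (x + y) = T i x + T i y" "T i (sc c x) = sc c (T i x)" "T i 0 = 0" "T i (- x) = - T i x"
    "T i (x - y) = T i x - T i y"
proof -
  show a: "T i (x + y) = T i x + T i y" and s: "T i (sc c x) = sc c (T i x)" for x y c
    using assms unfolding lin_ops_def by blast+
  show "T i 0 = 0" using s[of 0 0] by simp
  show m: "T i (- x) = - T i x" for x using s[of "-1" x] by (simp add: fs.scale_minus_left)
  show "T i (x - y) = T i x - T i y" using a[of x "- y"] m[of y] by (simp only: diff_conv_add_uminus)
qed

lemma hhomD:
  assumes "hhom N T M T' M' f" "fs.subspace M"
  shows "m \<in> M \<Longrightarrow> f m \<in> M'" "a \<in> M \<Longrightarrow> b \<in> M \<Longrightarrow> f (a + b) = f a + f b"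
    "a \<in> M \<Longrightarrow> f (sc c a) = sc c (f a)" "m \<in> M \<Longrightarrow> Suc i < N \<Longrightarrow> f (T i m) = T' i (f m)"
    "f 0 = 0" "a \<in> M \<Longrightarrow> b \<in> M \<Longrightarrow> f (a - b) = f a - f b"
proof -
  show "m \<in> M \<Longrightarrow> f m \<in> M'" and a: "\<And>a b. a \<in> M \<Longrightarrow> b \<in> M \<Longrightarrow> f (a + b) = f a + f b" and
    s: "\<And>a c. a \<in> M \<Longrightarrow> f (sc c a) = sc c (f a)" and "m \<in> M \<Longrightarrow> Suc i < N \<Longrightarrow> f (T i m) = T' i (f m)"
    using assms(1) unfolding hhom_def by blast+
  have "0 \<in> M" using assms(2) by (rule fs.subspace_0)
  thus "f 0 = 0" using s[of 0 0] by simp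
  show "f (a - b) = f a - f b" if "a \<in> M" "b \<in> M"
  proof -
    have n: "- b = sc (-1) b" by (simp add: fs.scale_minus_left)
    have "- b \<in> M" using that assms(2) fs.subspace_neg by blast
    hence "f (a + - b) = f a + f (- b)" using a that by blast
    also have "f (- b) = - f b" unfolding n s[OF that(2)] by (simp add: fs.scale_minus_left)
    finally show ?thesis by (simp only: diff_conv_add_uminus)
  qed
qed

lemma hmodD:
  assumes "hmod N T M"
  shows "lin_ops T" "fs.subspace M" "Suc i < N \<Longrightarrow> m \<in> M \<Longrightarrow> T i m \<in> M"
  using assms unfolding hmod_def by blast+

lemma subspace_bop: "lin_ops T \<Longrightarrow> fs.subspace P \<Longrightarrow> fs.subspace (bop im T q i P)"
proof -
  assume T: "lin_ops T" and P: "fs.subspace P"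
  note l = lin_opsD[OF T]
  show ?thesis
  proof (cases im)
    case True
    have "\<exists>z\<in>P. (T i x - sc q x) + (T i y - sc q y) = T i z - sc q z" if "x \<in> P" "y \<in> P" for x y
      using that P by (intro bexI[of _ "x + y"]) (auto simp: l fs.scale_right_distrib fs.subspace_add)
    moreover have "\<exists>z\<in>P. sc c (T i x - sc q x) = T i z - sc q z" if "x \<in> P" for x c
      using that P by (intro bexI[of _ "sc c x"]) (auto simp: l fs.scale_right_diff_distrib mult.commute fs.subspace_scale)
    moreover have "\<exists>z\<in>P. 0 = T i z - sc q z"
      using P by (intro bexI[of _ 0]) (auto simp: l fs.subspace_0)
    ultimately show ?thesis using True unfolding bop_def fs.subspace_def image_iff by (auto simp only: if_True image_iff)
  next
    case False
    thus ?thesis using P unfolding bop_def fs.subspace_def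
      by (auto simp: l fs.scale_right_distrib mult.commute)
  qed
qed

lemma bop_mono: "P \<subseteq> Q \<Longrightarrow> bop im T q i P \<subseteq> bop im T q i Q"
  unfolding bop_def by auto

lemma bop_subset: "hmod N T M \<Longrightarrow> Suc i < N \<Longrightarrow> bop im T q i M \<subseteq> M"
  unfolding bop_def hmod_def by (auto intro!: fs.subspace_diff fs.subspace_scale)

lemma subspace_Fsp: "lin_ops T \<Longrightarrow> fs.subspace M \<Longrightarrow> fs.subspace (Fsp im T q M n)"
proof -
  assume a: "lin_ops T" "fs.subspace M"
  have "fs.subspace (M \<inter> (\<Inter>i\<in>{i. Suc i < n}. bop im T q i M))"
    using a subspace_bop by (intro fs.subspace_inter fs.subspace_Inter) auto
  moreover have "Fsp im T q M n = M \<inter> (\<Inter>i\<in>{i. Suc i < n}. bop im T q i M)"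
    unfolding Fsp_def by auto
  ultimately show ?thesis by simp
qed

lemma Fsp_subset: "Fsp im T q M n \<subseteq> M"
  unfolding Fsp_def by auto

lemma Fsp_antimono: "n \<le> n' \<Longrightarrow> Fsp im T q M n' \<subseteq> Fsp im T q M n"
  unfolding Fsp_def by auto

lemma subspace_Zsp: "fs.subspace (Zsp im T q M N n)"
  unfolding Zsp_def by (rule fs.subspace_span)

lemma Zsp_subset: "hmod N T M \<Longrightarrow> Zsp im T q M N n \<subseteq> M"
  unfolding Zsp_def
proof (rule fs.span_minimal)
  assume "hmod N T M"
  thus "(\<Union>i\<in>{i. n \<le> i \<and> Suc i < N}. bop im T q i (Fsp im T q M n)) \<subseteq> M" and "fs.subspace M"
    using bop_subset[of N T M] bop_mono[OF Fsp_subset] hmodD by blast+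
qed

lemma Zsp_antimono: "n \<le> n' \<Longrightarrow> Zsp im T q M N n' \<subseteq> Zsp im T q M N n"
  unfolding Zsp_def
proof (rule fs.span_mono)
  assume n: "n \<le> n'"
  show "(\<Union>i\<in>{i. n' \<le> i \<and> Suc i < N}. bop im T q i (Fsp im T q M n')) \<subseteq>
        (\<Union>i\<in>{i. n \<le> i \<and> Suc i < N}. bop im T q i (Fsp im T q M n))"
    by (intro UN_mono bop_mono Fsp_antimono n) (use n in auto)
qed

text \<open>In use \<open>P\<close> is \<open>Fsp n\<close>; its images under \<open>T i\<close> are
  only known to lie in \<open>M\<close>, which is enough for \<open>f\<close> to be applied to
  them.\<close>

lemma hhom_bop:
  assumes h: "hhom N T M T' M' f" and M: "fs.subspace M" and P: "P \<subseteq> M" "f ` P \<subseteq> P'"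
    and TM: "\<And>m. m \<in> P \<Longrightarrow> T i m \<in> M" and i: "Suc i < N" and x: "x \<in> bop im T q i P"
  shows "f x \<in> bop im T' q i P'"
proof (cases im)
  case True
  then obtain y where y: "y \<in> P" "x = T i y - sc q y" using x by (auto simp: bop_def)
  have "sc q y \<in> M" using y P M fs.subspace_scale by blast
  hence "f x = T' i (f y) - sc q (f y)"
    unfolding y(2) using hhomD[OF h M] y P TM i by (simp add: subset_iff)
  thus ?thesis using True y P by (auto simp: bop_def)
next
  case False
  hence y: "x \<in> P" "T i x = sc q x" using x by (auto simp: bop_def)
  hence xM: "x \<in> M" using P by blast
  have "T' i (f x) = f (T i x)" using hhomD(4)[OF h M xM i] by simp
  also have "\<dots> = sc q (f x)" using y hhomD(3)[OF h M xM] by simp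
  finally show ?thesis using False y P by (auto simp: bop_def)
qed

lemma hhom_Fsp:
  assumes h: "hhom N T M T' M' f" and M: "hmod N T M" and n: "n \<le> N" and x: "x \<in> Fsp im T q M n"
  shows "f x \<in> Fsp im T' q M' n"
proof -
  note s = hmodD[OF M]
  have xM: "x \<in> M" using x Fsp_subset by blast
  have "f x \<in> bop im T' q i M'" if "Suc i < n" for i
    using hhom_bop[OF h s(2) order_refl _ s(3), of M' i x] x that n hhomD(1)[OF h s(2)]
    by (auto simp: Fsp_def)
  thus ?thesis using hhomD(1)[OF h s(2) xM] by (auto simp: Fsp_def)
qed

lemma hhom_span:
  assumes h: "hhom N T M T' M' f" and M: "fs.subspace M" and S: "S \<subseteq> M" and x: "x \<in> fs.span S"
    and S': "\<And>s. s \<in> S \<Longrightarrow> f s \<in> fs.span S'"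
  shows "f x \<in> fs.span S'"
proof -
  have "x \<in> M \<and> f x \<in> fs.span S'" using x
  proof (induction rule: fs.span_induct_alt)
    case base
    show ?case unfolding hhomD(5)[OF h M] using fs.subspace_0[OF M] fs.span_zero by blast
  next
    case (step c s y)
    have sM: "s \<in> M" "sc c s \<in> M" using step S M fs.subspace_scale by blast+
    have "f (sc c s + y) = f (sc c s) + f y" using hhomD(2)[OF h M sM(2)] step by blast
    also have "\<dots> = sc c (f s) + f y" by (simp only: hhomD(3)[OF h M sM(1)])
    finally have e: "f (sc c s + y) = sc c (f s) + f y" .
    have "sc c (f s) + f y \<in> fs.span S'"
      using step S' by (intro fs.span_add fs.span_scale) auto
    moreover have "sc c s + y \<in> M" using step sM M fs.subspace_add by blast
    ultimately show ?case unfolding e by blast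
  qed
  thus ?thesis by blast
qed

lemma hhom_Zsp:
  assumes h: "hhom N T M T' M' f" and M: "hmod N T M" and x: "x \<in> Zsp im T q M N n"
  shows "f x \<in> Zsp im T' q M' N n"
  using x unfolding Zsp_def
proof (rule hhom_span[OF h hmodD(2)[OF M], rotated])
  show "(\<Union>i\<in>{i. n \<le> i \<and> Suc i < N}. bop im T q i (Fsp im T q M n)) \<subseteq> M"
    using bop_subset[OF M] bop_mono[OF Fsp_subset] by blast
  fix s assume "s \<in> (\<Union>i\<in>{i. n \<le> i \<and> Suc i < N}. bop im T q i (Fsp im T q M n))"
  then obtain i where i: "n \<le> i" "Suc i < N" "s \<in> bop im T q i (Fsp im T q M n)" by blast
  have "f ` Fsp im T q M n \<subseteq> Fsp im T' q M' n" using hhom_Fsp[OF h M, of n] i by auto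
  moreover have "T i m \<in> M" if "m \<in> Fsp im T q M n" for m
    using that hmodD(3)[OF M i(2)] Fsp_subset by blast
  ultimately have "f s \<in> bop im T' q i (Fsp im T' q M' n)"
    using hhom_bop[OF h hmodD(2)[OF M] Fsp_subset _ _ i(2,3)] by blast
  thus "f s \<in> fs.span (\<Union>i\<in>{i. n \<le> i \<and> Suc i < N}. bop im T' q i (Fsp im T' q M' n))"
    using i by (intro fs.span_base) auto
qed

text \<open>The maps exhibit \<open>M\<close> as a summand of the sum of \<open>X\<close> and
  \<open>Y\<close>. Bounding elements found in \<open>X\<close> and \<open>Y\<close> are carried
  back and added, which serves both retracts (\<open>Y\<close> zero) and direct sums.\<close>

lemma exact_cx_retract2:
  assumes M: "hmod N T M" and X: "hmod N TX X" and Y: "hmod N TY Y"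
    and f: "hhom N T M TX X f" and g: "hhom N TX X T M g"
    and f': "hhom N T M TY Y f'" and g': "hhom N TY Y T M g'"
    and id: "\<And>m. m \<in> M \<Longrightarrow> g (f m) + g' (f' m) = m"
    and ex: "exact_cx im TX q X N" "exact_cx im TY q Y N"
  shows "exact_cx im T q M N"
  unfolding exact_cx_def
proof (intro allI impI)
  fix n x assume a: "1 \<le> n \<and> n \<le> N \<and> x \<in> Fsp im T q M n \<and> x \<in> Zsp im T q M N (n - 1)"
  hence xM: "x \<in> M" using Fsp_subset by blast
  have F: "f x \<in> Fsp im TX q X n" "f x \<in> Zsp im TX q X N (n - 1)"
    using hhom_Fsp[OF f M] hhom_Zsp[OF f M] a by auto
  have F': "f' x \<in> Fsp im TY q Y n" "f' x \<in> Zsp im TY q Y N (n - 1)"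
    using hhom_Fsp[OF f' M] hhom_Zsp[OF f' M] a by auto
  show "if n = N then x = 0 else \<exists>y\<in>Fsp im T q M (Suc n). x - y \<in> Zsp im T q M N n"
  proof (cases "n = N")
    case True
    have "f x = 0" using ex(1)[unfolded exact_cx_def, rule_format, of n "f x"] F a True by simp
    moreover have "f' x = 0" using ex(2)[unfolded exact_cx_def, rule_format, of n "f' x"] F' a True by simp
    ultimately have "x = 0"
      using id[OF xM] hhomD(5)[OF g hmodD(2)[OF X]] hhomD(5)[OF g' hmodD(2)[OF Y]] by simp
    thus ?thesis using True by simp
  next
    case False
    obtain y where y: "y \<in> Fsp im TX q X (Suc n)" "f x - y \<in> Zsp im TX q X N n"
      using ex(1)[unfolded exact_cx_def, rule_format, of n "f x"] F a False by auto
    obtain y' where y': "y' \<in> Fsp im TY q Y (Suc n)" "f' x - y' \<in> Zsp im TY q Y N n"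
      using ex(2)[unfolded exact_cx_def, rule_format, of n "f' x"] F' a False by auto
    have s: "Suc n \<le> N" using a False by simp
    have "g y + g' y' \<in> Fsp im T q M (Suc n)"
      using hhom_Fsp[OF g X s y(1)] hhom_Fsp[OF g' Y s y'(1)] subspace_Fsp[of T M] hmodD[OF M]
        fs.subspace_add by blast
    moreover have "x - (g y + g' y') \<in> Zsp im T q M N n"
    proof -
      have "g (f x - y) + g' (f' x - y') \<in> Zsp im T q M N n"
        using hhom_Zsp[OF g X y(2)] hhom_Zsp[OF g' Y y'(2)] subspace_Zsp fs.subspace_add by blast
      moreover have "g (f x - y) = g (f x) - g y"
        using hhomD(6)[OF g hmodD(2)[OF X]] F(1) y(1) Fsp_subset by blast
      moreover have "g' (f' x - y') = g' (f' x) - g' y'"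
        using hhomD(6)[OF g' hmodD(2)[OF Y]] F'(1) y'(1) Fsp_subset by blast
      ultimately have "(g (f x) + g' (f' x)) - (g y + g' y') \<in> Zsp im T q M N n"
        by (simp add: add_diff_add)
      thus ?thesis using id[OF xM] by simp
    qed
    ultimately show ?thesis using False by auto
  qed
qed

lemma hmod_zero: "lin_ops T \<Longrightarrow> hmod N T {0}"
  unfolding hmod_def by (auto simp: lin_opsD fs.subspace_single_0)

lemma exact_cx_zero:
  assumes "lin_ops T"
  shows "exact_cx im T q {0} N"
proof -
  have "0 \<in> Fsp im T q {0} (Suc n)" "0 \<in> Zsp im T q {0} N n" for n
    using subspace_Fsp[OF assms fs.subspace_single_0] subspace_Zsp fs.subspace_0 by blast+
  moreover have "x = 0" if "x \<in> Fsp im T q {0} n" for x n using that Fsp_subset[of im T q "{0}" n] by blast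
  ultimately show ?thesis unfolding exact_cx_def
    by (intro allI impI) (metis diff_self)
qed

lemma exact_cx_retract:
  assumes M: "hmod N T M" and X: "hmod N TX X"
    and f: "hhom N T M TX X f" and g: "hhom N TX X T M g"
    and id: "\<And>m. m \<in> M \<Longrightarrow> g (f m) = m" and ex: "exact_cx im TX q X N"
  shows "exact_cx im T q M N"
proof -
  have T: "lin_ops T" and M0: "0 \<in> M" using hmodD[OF M] fs.subspace_0 by auto
  have z: "hhom N T M T {0} (\<lambda>_. 0)" "hhom N T {0} T M (\<lambda>_. 0)"
    unfolding hhom_def using M0 by (auto simp: lin_opsD[OF T])
  show ?thesis
    using exact_cx_retract2[OF M X hmod_zero[OF T] f g z _ ex exact_cx_zero[OF T]] id by auto
qed

section \<open>Permutation supermodules on words\<close>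

lemma split_at_adjacent:
  assumes "Suc i < length w"
  obtains s a b t where "w = s @ a # b # t" "length s = i"
proof -
  have "w = take i w @ w ! i # drop (Suc i) w" using assms by (simp add: id_take_nth_drop)
  also have "drop (Suc i) w = w ! Suc i # drop (Suc (Suc i)) w" using assms by (simp add: Cons_nth_drop_Suc)
  finally show ?thesis using that[of "take i w"] assms by simp
qed

text \<open>Removing a descent makes the word smaller in the lexicographic order on words of one
  length, and words without descents are sorted.\<close>

lemma bubble_induct [case_names sorted swap]:
  fixes l :: "nat list"
  assumes "\<And>l. sorted l \<Longrightarrow> P l"
    and "\<And>s a b t. a < b \<Longrightarrow> P (s @ a # b # t) \<Longrightarrow> P (s @ b # a # t)"
  shows "P l"
proof (induction l rule: wf_induct[OF wf_lex[OF wf_less_than]])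
  case (1 l)
  show ?case
  proof (cases "sorted l")
    case False
    then obtain i where i: "Suc i < length l" "l ! Suc i < l ! i" by (auto simp: sorted_iff_nth_Suc not_le)
    obtain s b a t where l: "l = s @ b # a # t" "length s = i" using split_at_adjacent[OF i(1)] .
    have ab: "a < b" using i l by (auto simp: nth_append)
    have "(s @ a # b # t, l) \<in> lex less_than"
      unfolding lex_conv l(1) using ab by auto
    hence "P (s @ a # b # t)" using 1 by blast
    thus ?thesis using assms(2)[OF ab] l by simp
  qed (rule assms(1))
qed

definition swp :: "nat \<Rightarrow> nat list \<Rightarrow> nat list" where
  "swp i w = w[i := w ! Suc i, Suc i := w ! i]"

lemma swp_append: "length s = i \<Longrightarrow> swp i (s @ a # b # t) = s @ b # a # t"
  by (auto simp: swp_def nth_append list_update_append)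

lemma length_swp [simp]: "length (swp i w) = length w"
  by (simp add: swp_def)

lemma mset_swp: "Suc i < length w \<Longrightarrow> mset (swp i w) = mset w"
  by (erule split_at_adjacent) (simp add: swp_append)

lemma swp_swp: "Suc i < length w \<Longrightarrow> swp i (swp i w) = w"
  by (erule split_at_adjacent) (simp add: swp_append)

lemma nth_swp: "Suc i < length w \<Longrightarrow> swp i w ! i = w ! Suc i" "Suc i < length w \<Longrightarrow> swp i w ! Suc i = w ! i"
  by (auto simp: swp_def)

text \<open>The standard \<open>q\<close>-permutation supermodule: \<open>T (e_a e_b) = e_b e_a\<close> and
  \<open>T (e_b e_a) = q e_a e_b + (q - 1) e_b e_a\<close> for \<open>a < b\<close>, written on coefficient functions. The letter \<open>c\<close> is
  even if \<open>chi c = q\<close> and odd if \<open>chi c = -1\<close>.\<close>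
definition TX :: "'k::comm_ring_1 \<Rightarrow> (nat \<Rightarrow> 'k) \<Rightarrow> nat \<Rightarrow> (nat list \<Rightarrow> 'k) \<Rightarrow> nat list \<Rightarrow> 'k" where
  "TX q chi i x w = (if Suc i < length w then
      if w ! i = w ! Suc i then chi (w ! i) * x w
      else if w ! i < w ! Suc i then q * x (swp i w) else x (swp i w) + (q - 1) * x w else 0)"

lemma TX_append:
  "length s = i \<Longrightarrow> TX q chi i x (s @ a # b # t) =
     (if a = b then chi a * x (s @ a # b # t) else if a < b then q * x (s @ b # a # t)
      else x (s @ b # a # t) + (q - 1) * x (s @ a # b # t))"
  by (auto simp: TX_def swp_append nth_append)

abbreviation perms_ms :: "'a multiset \<Rightarrow> 'a list set" where
  "perms_ms \<equiv> permutations_of_multiset"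

abbreviation XL :: "nat multiset \<Rightarrow> (nat list \<Rightarrow> 'k::field) set" where
  "XL L \<equiv> supp_in (perms_ms L)"

lemma XL_iff: "x \<in> XL L \<longleftrightarrow> (\<forall>w. mset w \<noteq> L \<longrightarrow> x w = 0)"
  by (auto simp: supp_in_def permutations_of_multiset_def)

lemma lin_ops_TX: "lin_ops (TX q chi)"
  by (auto simp: lin_ops_def TX_def sc_def fun_eq_iff algebra_simps)

lemma TX_in_XL: "x \<in> XL L \<Longrightarrow> TX q chi i x \<in> XL L"
  by (auto simp: XL_iff TX_def mset_swp)

lemma hmod_XL: "hmod N (TX q chi) (XL L)"
  by (simp add: hmod_def lin_ops_TX subspace_supp_in TX_in_XL)

section \<open>Image and kernel of \<open>T i - q\<close> in coordinates\<close>

definition lrule :: "'k::comm_ring_1 \<Rightarrow> nat set \<Rightarrow> nat \<Rightarrow> (nat list \<Rightarrow> 'k) \<Rightarrow> bool" where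
  "lrule al Y i x \<longleftrightarrow> (\<forall>w. Suc i < length w \<longrightarrow> (w ! i < w ! Suc i \<longrightarrow> x w = al * x (swp i w))
      \<and> (w ! i = w ! Suc i \<and> w ! i \<in> Y \<longrightarrow> x w = 0))"

lemma lrule_iff:
  "lrule al Y i x \<longleftrightarrow> (\<forall>s t a b. length s = i \<longrightarrow> (a < b \<longrightarrow> x (s @ a # b # t) = al * x (s @ b # a # t))
      \<and> (a = b \<and> a \<in> Y \<longrightarrow> x (s @ a # b # t) = 0))"
  (is "?L \<longleftrightarrow> ?R")
proof
  assume L: ?L
  show ?R
  proof (intro allI impI)
    fix s t :: "nat list" and a b assume "length s = i"
    thus "(a < b \<longrightarrow> x (s @ a # b # t) = al * x (s @ b # a # t)) \<and> (a = b \<and> a \<in> Y \<longrightarrow> x (s @ a # b # t) = 0)"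
      using L[unfolded lrule_def, rule_format, of "s @ a # b # t"] by (auto simp: swp_append nth_append)
  qed
next
  assume R: ?R
  show ?L unfolding lrule_def
  proof (intro allI impI)
    fix w :: "nat list" assume "Suc i < length w"
    then obtain s a b t where w: "w = s @ a # b # t" "length s = i" by (rule split_at_adjacent)
    thus "(w ! i < w ! Suc i \<longrightarrow> x w = al * x (swp i w)) \<and> (w ! i = w ! Suc i \<and> w ! i \<in> Y \<longrightarrow> x w = 0)"
      using R[rule_format, of s a b t] by (auto simp: swp_append nth_append)
  qed
qed

text \<open>Together with \<open>Y_of\<close> these are the parameters of \<open>lrule\<close>. On
  the image of \<open>T i - q\<close> the scalar is \<open>- q\<close> and coefficients vanish at
  repeated even letters; on the kernel the scalar is \<open>1\<close> and they vanish at repeated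
  odd letters. If \<open>q = -1\<close>, a letter with value \<open>-1\<close> counts as
  even.\<close>

definition al_of :: "bool \<Rightarrow> 'k::comm_ring_1 \<Rightarrow> 'k" where
  "al_of im q = (if im then - q else 1)"

definition Y_of :: "bool \<Rightarrow> 'k \<Rightarrow> (nat \<Rightarrow> 'k) \<Rightarrow> nat set" where
  "Y_of im q chi = (if im then {c. chi c = q} else {c. chi c \<noteq> q})"

lemma lrule_TX_minus:
  fixes q :: "'k::comm_ring_1"
  shows "lrule (- q) {c. chi c = q} i (\<lambda>w. TX q chi i y w - q * y w)"
  unfolding lrule_iff by (auto simp: TX_append algebra_simps)

lemma bop_XL_iff:
  assumes x: "x \<in> XL L" and i: "Suc i < size L"
  shows "x \<in> bop im (TX q chi) q i (XL L) \<longleftrightarrow> lrule (al_of im q) (Y_of im q chi) i x"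
proof (cases im)
  case True
  show ?thesis
  proof
    assume "x \<in> bop im (TX q chi) q i (XL L)"
    then obtain y where "x = TX q chi i y - sc q y" using True by (auto simp: bop_def)
    hence "x = (\<lambda>w. TX q chi i y w - q * y w)" by (simp add: fun_eq_iff sc_def)
    thus "lrule (al_of im q) (Y_of im q chi) i x"
      using lrule_TX_minus[of q chi i y] True by (simp add: al_of_def Y_of_def)
  next
    assume "lrule (al_of im q) (Y_of im q chi) i x"
    hence R: "\<And>s t a b. length s = i \<Longrightarrow> a < b \<Longrightarrow> x (s @ a # b # t) = - q * x (s @ b # a # t)"
      "\<And>s t a. length s = i \<Longrightarrow> chi a = q \<Longrightarrow> x (s @ a # a # t) = 0"
      using True by (auto simp: lrule_iff al_of_def Y_of_def)
    \<comment> \<open>A preimage supported on words that do not descend at \<open>i\<close>. For a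
      repeated letter with \<open>chi = q\<close> the division by zero gives 0, which fits because
      \<open>x\<close> vanishes there.\<close>
    define y where "y = (\<lambda>w. if Suc i < length w then if w ! i = w ! Suc i then x w / (chi (w ! i) - q)
        else if w ! i < w ! Suc i then x (swp i w) else 0 else 0)"
    have ya: "y (s @ a # b # t) = (if a = b then x (s @ a # b # t) / (chi a - q)
        else if a < b then x (s @ b # a # t) else 0)" if "length s = i" for s a b t
      using that by (auto simp: y_def swp_append nth_append)
    have yX: "y \<in> XL L" using x by (auto simp: XL_iff y_def mset_swp)
    have "x w = TX q chi i y w - q * y w" for w
    proof (cases "Suc i < length w")
      case True
      then obtain s a b t where w: "w = s @ a # b # t" "length s = i" by (rule split_at_adjacent)
      show ?thesis
      proof (cases "a = b")
        case True
        thus ?thesis unfolding w(1) using w(2) R(2)[of s a t]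
          by (cases "chi a = q") (auto simp: TX_append ya simp flip: diff_divide_distrib left_diff_distrib)
      next
        case False
        thus ?thesis unfolding w(1) using w(2) R(1)[of s a b t]
          by (auto simp: TX_append ya)
      qed
    next
      case False
      hence "mset w \<noteq> L" using i by auto
      thus ?thesis using False x by (auto simp: TX_def y_def XL_iff)
    qed
    hence "x = TX q chi i y - sc q y" by (simp add: fun_eq_iff sc_def)
    thus "x \<in> bop im (TX q chi) q i (XL L)" using yX True by (auto simp: bop_def)
  qed
next
  case False
  have "TX q chi i x = sc q x \<longleftrightarrow> lrule 1 {c. chi c \<noteq> q} i x"
  proof
    assume T: "TX q chi i x = sc q x"
    show "lrule 1 {c. chi c \<noteq> q} i x" unfolding lrule_iff
    proof (intro allI impI)
      fix s t :: "nat list" and a b assume s: "length s = i"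
      have "TX q chi i x (s @ b # a # t) = q * x (s @ b # a # t)" using T by (simp add: sc_def)
      thus "(a < b \<longrightarrow> x (s @ a # b # t) = 1 * x (s @ b # a # t)) \<and> (a = b \<and> a \<in> {c. chi c \<noteq> q} \<longrightarrow> x (s @ a # b # t) = 0)"
        using s by (auto simp: TX_append algebra_simps)
    qed
  next
    assume R: "lrule 1 {c. chi c \<noteq> q} i x"
    show "TX q chi i x = sc q x"
    proof
      fix w
      show "TX q chi i x w = sc q x w"
      proof (cases "Suc i < length w")
        case True
        then obtain s a b t where w: "w = s @ a # b # t" "length s = i" by (rule split_at_adjacent)
        show ?thesis using w(2) R[unfolded lrule_iff, rule_format, of s a b t] R[unfolded lrule_iff, rule_format, of s b a t]
          unfolding w(1) by (auto simp: TX_append sc_def algebra_simps)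
      next
        case False
        hence "mset w \<noteq> L" using i by auto
        thus ?thesis using False x by (auto simp: TX_def sc_def XL_iff)
      qed
    qed
  qed
  thus ?thesis using False x by (simp add: bop_def al_of_def Y_of_def)
qed

lemma Fsp_XL_iff:
  assumes n: "n \<le> size L"
  shows "x \<in> Fsp im (TX q chi) q (XL L) n \<longleftrightarrow>
    x \<in> XL L \<and> (\<forall>i. Suc i < n \<longrightarrow> lrule (al_of im q) (Y_of im q chi) i x)"
  using assms by (auto simp: Fsp_def bop_XL_iff)

text \<open>Modulo the relations \<open>e_b e_a = be e_a e_b\<close> (\<open>a < b\<close>) and \<open>e_c e_c = 0\<close> (\<open>c \<notin> Y\<close>) a word \<open>v\<close> equals
  \<open>kap be Y v\<close> times its sorted rearrangement; \<open>kc\<close> is the contribution of the first letter.\<close>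
definition kc :: "'k::comm_ring_1 \<Rightarrow> nat set \<Rightarrow> nat \<Rightarrow> nat multiset \<Rightarrow> 'k" where
  "kc be Y c m = (if c \<in> Y \<or> c \<notin># m then be ^ size (filter_mset (\<lambda>a. a < c) m) else 0)"

fun kap :: "'k::comm_ring_1 \<Rightarrow> nat set \<Rightarrow> nat list \<Rightarrow> 'k" where
  "kap be Y [] = 1"
| "kap be Y (c # v) = kc be Y c (mset v) * kap be Y v"

text \<open>The weights whose sorted monomial survives when the squares of the letters outside
  \<open>Y\<close> are zero.\<close>

definition adm :: "nat set \<Rightarrow> nat multiset \<Rightarrow> bool" where
  "adm Y m \<longleftrightarrow> (\<forall>c. c \<notin> Y \<longrightarrow> count m c \<le> 1)"

lemma adm_mono: "m \<subseteq># m' \<Longrightarrow> adm Y m' \<Longrightarrow> adm Y m"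
  unfolding adm_def by (meson le_trans mset_subset_eq_count)

lemma kap_swap: "a < b \<Longrightarrow> kap be Y (s @ b # a # t) = be * kap be Y (s @ a # b # t)"
proof (induction s)
  case Nil
  thus ?case by (auto simp: kc_def)
next
  case (Cons c s)
  have "mset (s @ b # a # t) = mset (s @ a # b # t)" by simp
  thus ?case using Cons by (auto simp: ac_simps simp del: mset_append)
qed

lemma kap_repeat: "c \<notin> Y \<Longrightarrow> kap be Y (s @ c # c # t) = 0"
  by (induction s) (auto simp: kc_def)

lemma kap_not_adm: "\<not> adm Y (mset v) \<Longrightarrow> kap be Y v = 0"
proof (induction v)
  case Nil
  thus ?case by (simp add: adm_def)
next
  case (Cons c v)
  show ?case
  proof (cases "c \<in> Y \<or> c \<notin> set v")
    case True
    hence "\<not> adm Y (mset v)" using Cons.prems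
      unfolding adm_def by (auto split: if_splits)
    thus ?thesis using Cons.IH by simp
  qed (simp add: kc_def)
qed

lemma kap_sorted: "sorted v \<Longrightarrow> adm Y (mset v) \<Longrightarrow> kap be Y v = 1"
proof (induction v)
  case (Cons c v)
  have f: "size (filter_mset (\<lambda>a. a < c) (mset v)) = 0" unfolding size_eq_0_iff_empty
    using Cons.prems(1) by (auto intro!: multiset_eqI simp: count_eq_zero_iff)
  have a: "adm Y (mset v)" using Cons.prems(2) by (rule adm_mono[rotated]) simp
  moreover have "c \<in> Y \<or> c \<notin># mset v"
    using Cons.prems(2)[unfolded adm_def, rule_format, of c] not_in_iff[of c "mset v"] by (auto simp: Suc_le_eq)
  ultimately show ?case using Cons.IH[OF _ a] Cons.prems(1) by (simp add: kc_def f del: size_eq_0_iff_empty)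
qed simp

lemma sorted_not_adm:
  assumes "sorted l" "\<not> adm Z (mset l)"
  obtains s c t where "l = s @ c # c # t" "c \<notin> Z"
proof -
  from assms have "\<exists>s c t. l = s @ c # c # t \<and> c \<notin> Z"
  proof (induction l)
    case Nil
    thus ?case by (simp add: adm_def)
  next
    case (Cons a l)
    show ?case
    proof (cases "adm Z (mset l)")
      case True
      then obtain c where c: "c \<notin> Z" "count (mset (a # l)) c > 1" "count (mset l) c \<le> 1"
        using Cons.prems(2) unfolding adm_def by (auto simp: not_le simp del: mset.simps)
      hence "c = a" "a \<in> set l" by (auto split: if_splits simp: count_mset_0_iff[symmetric])
      then obtain b l' where l: "l = b # l'" by (cases l) auto
      hence "b = a" using Cons.prems(1) \<open>a \<in> set l\<close> by force
      thus ?thesis using l c \<open>c = a\<close> by (intro exI[of _ "[]"]) auto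
    next
      case False
      then obtain s c t where "l = s @ c # c # t" "c \<notin> Z" using Cons by auto
      thus ?thesis by (intro exI[of _ "a # s"]) auto
    qed
  qed
  thus ?thesis using that by blast
qed

abbreviation slm :: "nat multiset \<Rightarrow> nat list" where
  "slm \<equiv> sorted_list_of_multiset"

text \<open>The rule expresses the value at an ascent by the value at the descent, so sorting runs
  on the reversed word and the base point is the weakly decreasing word. Repeated letters of
  \<open>Y\<close> give zero, hence the complement in \<open>kap\<close>.\<close>

lemma lrule_sort:
  assumes R: "\<And>i. Suc i < n \<Longrightarrow> lrule al Y i f" and u: "length u = n"
  shows "f u = kap al (- Y) (rev u) * f (rev (slm (mset u)))"
proof -
  have "length l = n \<Longrightarrow> f (rev l) = kap al (- Y) l * f (rev (slm (mset l)))" for l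
  proof (induction l rule: bubble_induct)
    case (sorted l)
    have e: "slm (mset l) = l" using sorted by (simp add: sorted_sort_id)
    show ?case
    proof (cases "adm (- Y) (mset l)")
      case True
      thus ?thesis using kap_sorted[OF sorted(1) True, of al] e by simp
    next
      case False
      then obtain s c t where l: "l = s @ c # c # t" "c \<in> Y" using sorted_not_adm[OF sorted(1) False] by auto
      have "Suc (length (rev t)) < n" using l sorted by auto
      from R[OF this, unfolded lrule_iff, rule_format, of "rev t" c c "rev s"] l
      have "f (rev l) = 0" by simp
      thus ?thesis using kap_not_adm[OF False, of al] by simp
    qed
  next
    case (swap s a b t)
    have "Suc (length (rev t)) < n" using swap by auto
    from R[OF this, unfolded lrule_iff, rule_format, of "rev t" a b "rev s"] swap(1)
    have "f (rev (s @ b # a # t)) = al * f (rev (s @ a # b # t))" by simp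
    also have "f (rev (s @ a # b # t)) = kap al (- Y) (s @ a # b # t) * f (rev (slm (mset (s @ a # b # t))))"
      using swap by simp
    also have "mset (s @ a # b # t) = mset (s @ b # a # t)" by simp
    finally show ?case using kap_swap[OF swap(1), of al "- Y" s t] by (simp add: mult.assoc)
  qed
  from this[of "rev u"] u show ?thesis by simp
qed

section \<open>Normal form functionals and the subspace they cut out\<close>

lemma lrule_left: "lrule al Y i x \<Longrightarrow> lrule al Y i (\<lambda>u. x (u @ v))"
  by (auto simp: lrule_iff)

lemma lrule_right: "lrule al Y (length u + i) x \<Longrightarrow> lrule al Y i (\<lambda>v. x (u @ v))"
  by (auto simp: lrule_iff simp flip: append_assoc)

text \<open>The words are grouped into orbits of the swap at \<open>i\<close>, each two-element
  orbit being listed by its ascending member.\<close>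

lemma sum_swap_split:
  fixes h :: "nat list \<Rightarrow> 'b::comm_monoid_add"
  assumes i: "Suc i < size m"
  shows "(\<Sum>v\<in>perms_ms m. h v) = (\<Sum>v | v \<in> perms_ms m \<and> v ! i < v ! Suc i. h v + h (swp i v))
    + (\<Sum>v | v \<in> perms_ms m \<and> v ! i = v ! Suc i. h v)"
proof -
  let ?W = "perms_ms m"
  let ?A = "{v. v \<in> ?W \<and> v ! i < v ! Suc i}" and ?B = "{v. v \<in> ?W \<and> v ! Suc i < v ! i}"
    and ?C = "{v. v \<in> ?W \<and> v ! i = v ! Suc i}"
  have len: "Suc i < length v" if "v \<in> ?W" for v
    using that i by (auto simp: permutations_of_multiset_def)
  have W: "mset (swp i v) = m" if "v \<in> ?W" for v
    using that mset_swp[OF len[OF that]] by (auto simp: permutations_of_multiset_def)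
  have "?W = (?A \<union> ?B) \<union> ?C" by auto
  hence "sum h ?W = sum h ((?A \<union> ?B) \<union> ?C)" by simp
  also have "\<dots> = sum h (?A \<union> ?B) + sum h ?C" by (rule sum.union_disjoint) auto
  also have "sum h (?A \<union> ?B) = sum h ?A + sum h ?B" by (rule sum.union_disjoint) auto
  also have "sum h ?B = sum (\<lambda>v. h (swp i v)) ?A"
    by (rule sum.reindex_bij_witness[of _ "swp i" "swp i"])
      (use len W in \<open>auto simp: swp_swp nth_swp permutations_of_multiset_def\<close>)
  finally show ?thesis by (simp add: sum.distrib)
qed

text \<open>The functional with coefficients \<open>kap\<close> reads off the coefficient of the
  sorted monomial, so it kills relations: in a swap orbit \<open>be\<close> cancels against
  \<open>- be\<close>, and at a repeated letter either \<open>x\<close> or \<open>kap\<close> is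
  zero.\<close>

lemma sum_lrule:
  fixes x :: "nat list \<Rightarrow> 'k::comm_ring_1"
  assumes R: "lrule (- be) Y i x" and i: "Suc i < size m"
  shows "(\<Sum>v\<in>perms_ms m. kap be Y v * x v) = 0"
proof -
  have split: "\<exists>s a b t. v = s @ a # b # t \<and> length s = i" if "v \<in> perms_ms m" for v
  proof -
    have "Suc i < length v" using that i by (auto simp: permutations_of_multiset_def)
    thus ?thesis by (rule split_at_adjacent) blast
  qed
  show ?thesis unfolding sum_swap_split[OF i]
  proof (rule trans[OF arg_cong2[where f = "(+)" and b = 0 and d = 0] add_0_left]; intro sum.neutral ballI)
    fix v assume v: "v \<in> {v. v \<in> perms_ms m \<and> v ! i < v ! Suc i}"
    then obtain s a b t where w: "v = s @ a # b # t" "length s = i" using split by blast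
    have ab: "a < b" using v w by (auto simp: nth_append)
    show "kap be Y v * x v + kap be Y (swp i v) * x (swp i v) = 0"
      using w R[unfolded lrule_iff, rule_format, of s a b t] ab kap_swap[OF ab, of be Y s t]
      by (simp add: swp_append)
  next
    fix v assume v: "v \<in> {v. v \<in> perms_ms m \<and> v ! i = v ! Suc i}"
    then obtain s a b t where w: "v = s @ a # b # t" "length s = i" using split by blast
    have "a = b" using v w by (auto simp: nth_append)
    thus "kap be Y v * x v = 0"
      using w R[unfolded lrule_iff, rule_format, of s a a t] kap_repeat[of a Y be s t] by auto
  qed
qed

text \<open>The class in the algebra of the slice of \<open>x\<close> after the prefix
  \<open>u\<close>. A weight space of the algebra is at most one dimensional, so one scalar records
  it.\<close>

definition pr :: "'k::comm_ring_1 \<Rightarrow> nat set \<Rightarrow> nat multiset \<Rightarrow> (nat list \<Rightarrow> 'k) \<Rightarrow> nat list \<Rightarrow> 'k" where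
  "pr be Y L x u = (\<Sum>v\<in>perms_ms (L - mset u). kap be Y v * x (u @ v))"

text \<open>Splitting by the first letter of the tail. When \<open>u\<close> is one letter shorter
  than the \<open>W\<close> part, this is the differential of the complex in coordinates.\<close>

lemma pr_expand:
  assumes "L - mset u \<noteq> {#}"
  shows "pr be Y L x u = (\<Sum>c\<in>set_mset (L - mset u). kc be Y c (L - mset u - {#c#}) * pr be Y L x (u @ [c]))"
proof -
  let ?m = "L - mset u"
  have "pr be Y L x u = (\<Sum>v\<in>(\<Union>c\<in>set_mset ?m. (#) c ` perms_ms (?m - {#c#})). kap be Y v * x (u @ v))"
    unfolding pr_def permutations_of_multiset_nonempty[OF assms] by simp
  also have "\<dots> = (\<Sum>c\<in>set_mset ?m. \<Sum>v\<in>(#) c ` perms_ms (?m - {#c#}). kap be Y v * x (u @ v))"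
    by (rule sum.UNION_disjoint) auto
  also have "\<dots> = (\<Sum>c\<in>set_mset ?m. kc be Y c (?m - {#c#}) * pr be Y L x (u @ [c]))"
  proof (rule sum.cong[OF refl])
    fix c assume "c \<in> set_mset ?m"
    have "(\<Sum>v\<in>(#) c ` perms_ms (?m - {#c#}). kap be Y v * x (u @ v)) =
        (\<Sum>v\<in>perms_ms (?m - {#c#}). kap be Y (c # v) * x (u @ c # v))"
      by (subst sum.reindex) auto
    also have "\<dots> = (\<Sum>v\<in>perms_ms (?m - {#c#}). kc be Y c (?m - {#c#}) * (kap be Y v * x ((u @ [c]) @ v)))"
      by (rule sum.cong[OF refl]) (auto simp: permutations_of_multiset_def mult.assoc)
    also have "\<dots> = kc be Y c (?m - {#c#}) * pr be Y L x (u @ [c])"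
      unfolding pr_def by (simp add: sum_distrib_left diff_diff_add_mset)
    finally show "(\<Sum>v\<in>(#) c ` perms_ms (?m - {#c#}). kap be Y v * x (u @ v)) = kc be Y c (?m - {#c#}) * pr be Y L x (u @ [c])" .
  qed
  finally show ?thesis .
qed

lemma pr_Zsp:
  assumes x: "x \<in> Zsp im (TX q chi) q (XL L) (size L) n" and u: "length u = n" "mset u \<subseteq># L"
  shows "pr (- al_of im q) (Y_of im q chi) L x u = 0"
  using x unfolding Zsp_def
proof (induction rule: fs.span_induct_alt)
  case base
  show ?case by (simp add: pr_def)
next
  case (step c s y)
  let ?pr = "\<lambda>x. pr (- al_of im q) (Y_of im q chi) L x u"
  from step(1) obtain i where i: "n \<le> i" "Suc i < size L" "s \<in> bop im (TX q chi) q i (Fsp im (TX q chi) q (XL L) n)"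
    by blast
  hence s: "s \<in> bop im (TX q chi) q i (XL L)" using bop_mono[OF Fsp_subset] by blast
  hence "s \<in> XL L" using bop_subset[OF hmod_XL i(2)] by blast
  hence "lrule (al_of im q) (Y_of im q chi) (length u + (i - n)) s" using s i u bop_XL_iff[of s L i im q chi] by simp
  hence "lrule (- (- al_of im q)) (Y_of im q chi) (i - n) (\<lambda>v. s (u @ v))" using lrule_right by simp
  moreover have "Suc (i - n) < size (L - mset u)" using i u by (simp add: size_Diff_submset)
  ultimately have "?pr s = 0" unfolding pr_def by (rule sum_lrule)
  moreover have "?pr (sc c s + y) = c * ?pr s + ?pr y"
    unfolding pr_def by (simp add: sc_def sum.distrib sum_distrib_left algebra_simps)
  ultimately show ?case using step by (simp only: mult_zero_right add_0_left)
qed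

text \<open>The tensor of the slice \<open>x (_ @ v)\<close> with the basis word \<open>v'\<close>.\<close>
definition place :: "nat \<Rightarrow> (nat list \<Rightarrow> 'k::field) \<Rightarrow> nat list \<Rightarrow> nat list \<Rightarrow> nat list \<Rightarrow> 'k" where
  "place n x v v' w = (if n \<le> length w \<and> drop n w = v' then x (take n w @ v) else 0)"

lemma place_append: "n \<le> length s \<Longrightarrow>
  place n x v v' (s @ t) = (if drop n s @ t = v' then x (take n s @ v) else 0)"
  by (simp add: place_def)

lemma place_in_XL:
  assumes "x \<in> XL L" "mset v = mset v'"
  shows "place n x v v' \<in> XL L"
  unfolding XL_iff
proof (intro allI impI)
  fix w assume w: "mset w \<noteq> L"
  show "place n x v v' w = 0"
  proof (cases "n \<le> length w \<and> drop n w = v'")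
    case True
    hence "mset (take n w @ v) = mset w" using assms(2)
      by (metis append_take_drop_id mset_append)
    thus ?thesis using w assms(1) by (simp add: place_def XL_iff)
  qed (auto simp: place_def)
qed

lemma place_lrule:
  assumes "lrule al Y i x" "Suc i < n"
  shows "lrule al Y i (place n x v v')"
  unfolding lrule_iff
proof (intro allI impI)
  fix s t :: "nat list" and a b assume s: "length s = i"
  have e: "place n x v v' (s @ c # d # t) = (if n \<le> length (s @ c # d # t) \<and> drop (n - Suc (Suc i)) t = v'
      then x (s @ c # d # (take (n - Suc (Suc i)) t @ v)) else 0)" for c d
    using s assms(2) by (auto simp: place_def drop_Cons' take_Cons' numeral_2_eq_2)
  show "(a < b \<longrightarrow> place n x v v' (s @ a # b # t) = al * place n x v v' (s @ b # a # t)) \<and>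
       (a = b \<and> a \<in> Y \<longrightarrow> place n x v v' (s @ a # b # t) = 0)"
    unfolding e using assms(1)[unfolded lrule_iff, rule_format, OF s, of a b] by auto
qed

lemma place_in_Fsp:
  assumes "x \<in> Fsp im (TX q chi) q (XL L) n" "mset v = mset v'" "n \<le> size L"
  shows "place n x v v' \<in> Fsp im (TX q chi) q (XL L) n"
  using assms(1) place_in_XL[OF _ assms(2)] place_lrule unfolding Fsp_XL_iff[OF assms(3)] by blast

lemma place_adjacent:
  assumes "length w = n + length s"
  shows "place n x v (s @ a # b # t) (w @ c # e # w2) =
    (if drop n w = s \<and> c = a \<and> e = b \<and> w2 = t then x (take n w @ v) else 0)"
  using assms by (auto simp: place_append)

lemma place_swap_in_bop:
  assumes x: "x \<in> Fsp im (TX q chi) q (XL L) n" and ab: "a < b" and v: "mset v = mset (s @ a # b # t)"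
    and n: "n + length v = size L"
  shows "place n x v (s @ b # a # t) + sc (al_of im q) (place n x v (s @ a # b # t))
    \<in> bop im (TX q chi) q (n + length s) (Fsp im (TX q chi) q (XL L) n)"
proof -
  let ?i = "n + length s" and ?P = "place n x v (s @ a # b # t)" and ?P' = "place n x v (s @ b # a # t)"
  have nL: "n \<le> size L" using n by simp
  have lv: "length v = length s + 2 + length t"
    using v by (metis size_mset length_append length_Cons add_Suc_right add_2_eq_Suc' add_Suc)
  have i: "Suc ?i < size L" using n lv by simp
  have P: "?P \<in> Fsp im (TX q chi) q (XL L) n" "?P' \<in> Fsp im (TX q chi) q (XL L) n"
    using x v nL by (intro place_in_Fsp; simp)+
  have PX: "?P \<in> XL L" "?P' \<in> XL L" using P Fsp_subset by blast+
  let ?z = "?P' + sc (al_of im q) ?P"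
  have zF: "?z \<in> Fsp im (TX q chi) q (XL L) n"
    using P subspace_Fsp[OF lin_ops_TX subspace_supp_in] by (meson fs.subspace_add fs.subspace_scale)
  show ?thesis
  proof (cases im)
    case True
    \<comment> \<open>From the ascending pair \<open>a b\<close> the operator only moves the weight
      to \<open>b a\<close>, so \<open>?z\<close> is \<open>T - q\<close> applied to
      \<open>?P\<close>.\<close>
    have "?z w = TX q chi ?i ?P w - q * ?P w" for w
    proof (cases "Suc ?i < length w")
      case True
      then obtain w1 c e w2 where w: "w = w1 @ c # e # w2" "length w1 = ?i" by (rule split_at_adjacent)
      show ?thesis using w(2) ab \<open>im\<close> unfolding w(1)
        by (auto simp: TX_append place_adjacent sc_def al_of_def)
    next
      case False
      hence "mset w \<noteq> L" using i by auto
      thus ?thesis using False PX by (auto simp: TX_def sc_def XL_iff)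
    qed
    hence "?z = TX q chi ?i ?P - sc q ?P" by (simp add: fun_eq_iff sc_def)
    thus ?thesis unfolding bop_def if_P[OF True] using P(1) by (rule image_eqI)
  next
    case False
    \<comment> \<open>Here the scalar is \<open>1\<close>: the sum over both orders is symmetric
      under the swap and so lies in the kernel.\<close>
    have "lrule (al_of im q) (Y_of im q chi) ?i ?z"
      unfolding lrule_iff using False ab
      by (auto simp: place_adjacent sc_def al_of_def)
    hence "?z \<in> bop im (TX q chi) q ?i (XL L)" using bop_XL_iff[OF subsetD[OF Fsp_subset zF] i] by blast
    thus ?thesis unfolding bop_def if_not_P[OF False] using zF by blast
  qed
qed

lemma place_repeat_in_bop:
  assumes x: "x \<in> Fsp im (TX q chi) q (XL L) n" and c: "c \<notin> Y_of im q chi" and v: "mset v = mset (s @ c # c # t)"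
    and n: "n + length v = size L"
  shows "place n x v (s @ c # c # t) \<in> bop im (TX q chi) q (n + length s) (Fsp im (TX q chi) q (XL L) n)"
proof -
  let ?i = "n + length s" and ?P = "place n x v (s @ c # c # t)"
  have nL: "n \<le> size L" using n by simp
  have lv: "length v = length s + 2 + length t"
    using v by (metis size_mset length_append length_Cons add_Suc_right add_2_eq_Suc' add_Suc)
  have i: "Suc ?i < size L" using n lv by simp
  have P: "?P \<in> Fsp im (TX q chi) q (XL L) n" using x v nL by (intro place_in_Fsp)
  have PX: "?P \<in> XL L" using P Fsp_subset by blast
  show ?thesis
  proof (cases im)
    case True
    hence cq: "chi c \<noteq> q" using c by (auto simp: Y_of_def)
    \<comment> \<open>On the pair \<open>c c\<close> the operator \<open>T - q\<close> is
      multiplication by the nonzero scalar \<open>chi c - q\<close>.\<close>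
    let ?y = "sc (1 / (chi c - q)) ?P"
    have "?P w = TX q chi ?i ?y w - q * ?y w" for w
    proof (cases "Suc ?i < length w")
      case True
      then obtain w1 d e w2 where w: "w = w1 @ d # e # w2" "length w1 = ?i" by (rule split_at_adjacent)
      show ?thesis using w(2) cq unfolding w(1)
        by (auto simp: TX_append place_adjacent sc_def simp flip: diff_divide_distrib left_diff_distrib)
    next
      case False
      hence "mset w \<noteq> L" using i by auto
      thus ?thesis using False PX by (auto simp: TX_def sc_def XL_iff)
    qed
    hence "?P = TX q chi ?i ?y - sc q ?y" by (simp add: fun_eq_iff sc_def)
    moreover have "?y \<in> Fsp im (TX q chi) q (XL L) n"
      using P subspace_Fsp[OF lin_ops_TX subspace_supp_in] by (meson fs.subspace_scale)
    ultimately show ?thesis unfolding bop_def if_P[OF True] by (rule image_eqI)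
  next
    case False
    have "lrule (al_of im q) (Y_of im q chi) ?i ?P"
      unfolding lrule_iff using c by (auto simp: place_adjacent)
    hence "?P \<in> bop im (TX q chi) q ?i (XL L)" using bop_XL_iff[OF PX i] by blast
    thus ?thesis unfolding bop_def if_not_P[OF False] using P by blast
  qed
qed

lemma bop_Zsp: "n \<le> i \<Longrightarrow> Suc i < N \<Longrightarrow> z \<in> bop im T q i (Fsp im T q M n) \<Longrightarrow> z \<in> Zsp im T q M N n"
  unfolding Zsp_def by (intro fs.span_base) auto

text \<open>Sorting to normal form in the algebra, with the \<open>W\<close> part carried along
  unchanged.\<close>

lemma place_sort:
  assumes x: "x \<in> Fsp im (TX q chi) q (XL L) n" and n: "n + length v = size L"
  shows "mset v = mset v' \<Longrightarrow> place n x v v' - sc (kap (- al_of im q) (Y_of im q chi) v') (place n x v (slm (mset v')))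
      \<in> Zsp im (TX q chi) q (XL L) (size L) n"
proof (induction v' rule: bubble_induct)
  case (sorted l)
  have e: "slm (mset l) = l" using sorted by (simp add: sorted_sort_id)
  show ?case
  proof (cases "adm (Y_of im q chi) (mset l)")
    case True
    hence "kap (- al_of im q) (Y_of im q chi) l = 1" using kap_sorted sorted by blast
    thus ?thesis unfolding e using fs.subspace_0[OF subspace_Zsp] by (simp only: fs.scale_one diff_self)
  next
    case False
    obtain s c t where l: "l = s @ c # c # t" "c \<notin> Y_of im q chi" using sorted_not_adm[OF sorted(1) False] .
    have "length v = length l" using sorted(2) by (metis size_mset)
    hence "place n x v l \<in> Zsp im (TX q chi) q (XL L) (size L) n"
      using place_repeat_in_bop[OF x l(2), of v s t] sorted(2) l n by (intro bop_Zsp[of n "n + length s"]) auto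
    thus ?thesis by (simp only: kap_not_adm[OF False] fs.scale_zero_left diff_zero)
  qed
next
  case (swap s a b t)
  let ?Z = "Zsp im (TX q chi) q (XL L) (size L) n"
  let ?k = "kap (- al_of im q) (Y_of im q chi) (s @ a # b # t)"
  let ?A = "place n x v (s @ a # b # t)" and ?B = "place n x v (s @ b # a # t)" and ?C = "place n x v (slm (mset (s @ a # b # t)))"
  have m: "mset v = mset (s @ a # b # t)" using swap(3) by simp
  have "length v = length (s @ a # b # t)" using m by (metis size_mset)
  hence 1: "?B + sc (al_of im q) ?A \<in> ?Z"
    using n by (intro bop_Zsp[OF _ _ place_swap_in_bop[OF x swap(1) m n]]) auto
  have 2: "sc (al_of im q) (?A - sc ?k ?C) \<in> ?Z"
    using swap(2)[OF m] fs.subspace_scale[OF subspace_Zsp] by blast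
  have "(?B + sc (al_of im q) ?A) - sc (al_of im q) (?A - sc ?k ?C) \<in> ?Z"
    using 1 2 fs.subspace_diff[OF subspace_Zsp] by blast
  also have "(?B + sc (al_of im q) ?A) - sc (al_of im q) (?A - sc ?k ?C) =
      ?B - sc (kap (- al_of im q) (Y_of im q chi) (s @ b # a # t)) ?C"
    unfolding kap_swap[OF swap(1)] by (simp add: fun_eq_iff sc_def algebra_simps)
  finally show ?case by (simp add: add_mset_commute)
qed

text \<open>Converse to \<open>pr_Zsp\<close>. Modulo the relations \<open>x\<close> is the sum of
  its slices placed on sorted tails, and the coefficients of that sum are the scalars
  \<open>pr\<close>.\<close>

lemma pr_zero_imp_Zsp:
  assumes x: "x \<in> Fsp im (TX q chi) q (XL L) n" and n: "n \<le> size L"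
    and p: "\<And>u. length u = n \<Longrightarrow> mset u \<subseteq># L \<Longrightarrow> pr (- al_of im q) (Y_of im q chi) L x u = 0"
  shows "x \<in> Zsp im (TX q chi) q (XL L) (size L) n"
proof -
  let ?Z = "Zsp im (TX q chi) q (XL L) (size L) n"
  let ?k = "kap (- al_of im q) (Y_of im q chi)"
  define V where "V = drop n ` perms_ms L"
  have fV: "finite V" unfolding V_def by simp
  have lenV: "n + length v = size L" if "v \<in> V" for v
    using that n by (auto simp: V_def permutations_of_multiset_def)
  have xX: "x \<in> XL L" using x Fsp_subset by blast
  have 1: "x = (\<Sum>v\<in>V. place n x v v)"
  proof
    fix w
    have "(\<Sum>v\<in>V. place n x v v w) = (if n \<le> length w \<and> drop n w \<in> V then x w else 0)"
    proof -
      have "(\<Sum>v\<in>V. place n x v v w) = (\<Sum>v\<in>V. if v = drop n w then (if n \<le> length w then x w else 0) else 0)"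
        by (rule sum.cong) (auto simp: place_def)
      thus ?thesis using fV by auto
    qed
    also have "\<dots> = x w"
    proof (cases "mset w = L")
      case True
      hence "w \<in> perms_ms L" by (simp add: permutations_of_multiset_def)
      thus ?thesis using n True by (auto simp: V_def)
    next
      case False
      thus ?thesis using xX by (auto simp: XL_iff)
    qed
    finally show "x w = (\<Sum>v\<in>V. place n x v v) w" by (simp add: fun_sum_apply)
  qed
  \<comment> \<open>At a word with sorted tail only slices of the same content contribute, and they
    add up to \<open>pr\<close> of the prefix.\<close>
  have 2: "(\<Sum>v\<in>V. sc (?k v) (place n x v (slm (mset v)))) = 0"
  proof
    fix w
    show "(\<Sum>v\<in>V. sc (?k v) (place n x v (slm (mset v)))) w = 0 w"
    proof (cases "mset w = L \<and> sorted (drop n w)")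
      case True
      let ?u = "take n w" and ?v = "drop n w"
      have w: "mset ?u + mset ?v = L" using True by (metis append_take_drop_id mset_append)
      have lu: "length ?u = n" using True n by auto
      hence nw: "n \<le> length w" by simp
      have m: "mset ?u \<subseteq># L" using w by (metis mset_subset_eq_add_left)
      have Lu: "L - mset ?u = mset ?v" using w by (metis add_diff_cancel_left')
      have iff: "?v = slm (mset v) \<longleftrightarrow> mset v = mset ?v" for v
        using True by (metis mset_sorted_list_of_multiset sorted_list_of_multiset_mset sorted_sort_id)
      have sub: "perms_ms (L - mset ?u) \<subseteq> V"
      proof
        fix v assume "v \<in> perms_ms (L - mset ?u)"
        hence "mset (?u @ v) = L" using w Lu by (simp add: permutations_of_multiset_def)
        hence "?u @ v \<in> perms_ms L" by (simp add: permutations_of_multiset_def)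
        hence "drop n (?u @ v) \<in> V" unfolding V_def by (rule imageI)
        thus "v \<in> V" using lu by simp
      qed
      have "(\<Sum>v\<in>V. ?k v * place n x v (slm (mset v)) w) = (\<Sum>v\<in>perms_ms (L - mset ?u). ?k v * x (?u @ v))"
        by (rule sum.mono_neutral_cong_right[OF fV sub])
          (simp_all only: place_def nw iff Lu permutations_of_multiset_def, simp_all)
      also have "\<dots> = 0" using p[OF lu m] by (simp add: pr_def)
      finally show ?thesis by (simp add: fun_sum_apply sc_def)
    next
      case False
      have "place n x v (slm (mset v)) w = 0" for v
      proof (cases "mset w = L")
        case True
        hence "\<not> sorted (drop n w)" using False by blast
        thus ?thesis by (auto simp: place_def)
      next
        case False
        thus ?thesis using place_in_XL[OF xX, of v "slm (mset v)" n] by (auto simp: XL_iff)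
      qed
      thus ?thesis by (simp add: fun_sum_apply sc_def)
    qed
  qed
  have "(\<Sum>v\<in>V. place n x v v - sc (?k v) (place n x v (slm (mset v)))) \<in> ?Z"
    using place_sort[OF x] lenV by (intro fs.subspace_sum[OF subspace_Zsp]) auto
  thus ?thesis unfolding sum_subtractf 2 using 1 by simp
qed

section \<open>Contraction of the complex in a fixed weight\<close>

lemma adm_remove: "adm Y m \<Longrightarrow> z \<in> Y \<or> z \<notin># m - {#z#}"
  unfolding adm_def not_in_iff by auto

text \<open>The components of the Koszul complex in a fixed weight \<open>L\<close> are functions of the content \<open>mu\<close> of the \<open>W\<close>-part.
  The homotopy moves the smallest letter of \<open>L\<close> from the \<open>A\<close>-part to the \<open>W\<close>-part.\<close>
lemma contracting_homotopy:
  fixes X :: "nat multiset \<Rightarrow> 'k::field"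
  assumes mL: "mu \<subseteq># L" and L: "L \<noteq> {#}" and a1: "adm (- Y) mu" and a2: "adm Y (L - mu)"
  defines "z \<equiv> Min (set_mset L)"
  assumes d: "z \<in># mu \<Longrightarrow> (\<Sum>c\<in>set_mset (L - (mu - {#z#})). kc (- al) Y c (L - (mu - {#z#}) - {#c#})
      * (kc al (- Y) c (mu - {#z#}) * X (add_mset c (mu - {#z#})))) = 0"
  shows "(\<Sum>c\<in>set_mset (L - mu). kc (- al) Y c (L - mu - {#c#}) * (kc al (- Y) c mu *
      (if z \<in># add_mset c mu then X (add_mset c mu - {#z#}) else 0))) = X mu"
proof -
  let ?nu = "L - mu"
  let ?A = "\<lambda>c. kc (- al) Y c (?nu - {#c#}) * (kc al (- Y) c mu *
      (if z \<in># add_mset c mu then X (add_mset c mu - {#z#}) else 0))"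
  have zL: "z \<in># L" unfolding z_def using L by simp
  have zmin: "z \<le> c" if "c \<in># L" for c unfolding z_def using that by simp
  have split: "L = mu + ?nu" using mL by simp
  have fz: "filter_mset (\<lambda>a. a < z) m = {#}" if "m \<subseteq># L" for m
  proof -
    have "\<not> a < z" if "a \<in># m" for a using zmin[of a] mset_subset_eqD[OF \<open>m \<subseteq># L\<close> that] by simp
    thus ?thesis by (auto intro!: multiset_eqI simp: count_eq_zero_iff)
  qed
  \<comment> \<open>No letter of \<open>L\<close> is smaller than \<open>z\<close>, so moving
    \<open>z\<close> costs no scalar; only the restriction on repetitions remains.\<close>
  have kz: "kc be Y' z m = (if z \<in> Y' \<or> z \<notin># m then 1 else 0)" if "m \<subseteq># L" for be :: 'k and Y' m
    unfolding kc_def fz[OF that] by simp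
  have sub: "?nu \<subseteq># L" "?nu - {#z#} \<subseteq># L" "mu - {#z#} \<subseteq># L"
    using mL by (auto intro: subset_mset.order_trans[OF diff_subset_eq_self])
  have total: "(\<Sum>c\<in>set_mset ?nu. ?A c) = (if z \<in># ?nu then ?A z else 0) + (\<Sum>c\<in>set_mset ?nu - {z}. ?A c)"
    by (cases "z \<in># ?nu") (simp_all only: sum.remove[OF finite_set_mset] if_True if_False Diff_insert0 Diff_empty add_0_left not_False_eq_True)
  have zc: "count mu z + count ?nu z > 0" using zL split by (metis count_greater_zero_iff count_union)
  show ?thesis
  proof (cases "z \<in># mu")
    case False
    hence z: "z \<in># ?nu" using zc by (auto simp: not_in_iff simp flip: count_greater_zero_iff)
    \<comment> \<open>For \<open>c\<close> other than \<open>z\<close> the content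
      \<open>add_mset c mu\<close> still lacks \<open>z\<close>, so the homotopy gives zero.\<close>
    have "(\<Sum>c\<in>set_mset ?nu - {z}. ?A c) = 0" by (rule sum.neutral) (use False in auto)
    hence "(\<Sum>c\<in>set_mset ?nu. ?A c) = ?A z" unfolding total using z by (simp only: if_True add_0_right)
    also have "\<dots> = X mu"
    proof -
      have "z \<in> Y \<or> z \<notin># ?nu - {#z#}"
        using a2 by (rule adm_remove)
      thus ?thesis using kz[OF sub(2), of "- al" Y] kz[OF mL, of al "- Y"] False by simp
    qed
    finally show ?thesis .
  next
    case True
    have e: "L - (mu - {#z#}) = add_mset z ?nu"
    proof -
      obtain mu' where mu': "mu = add_mset z mu'" using multi_member_split[OF True] by blast
      obtain nu where nu: "L = mu + nu" using mL by (auto simp: mset_subset_eq_exists_conv)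
      have "L - mu' = add_mset z nu" unfolding nu mu' by simp
      thus ?thesis unfolding nu unfolding mu' by simp
    qed
    let ?B = "\<lambda>c. kc (- al) Y c (add_mset z ?nu - {#c#}) * (kc al (- Y) c (mu - {#z#}) * X (add_mset c (mu - {#z#})))"
    have "(\<Sum>c\<in>insert z (set_mset ?nu). ?B c) = 0" using d[OF True] unfolding e by simp
    hence B0: "?B z + (\<Sum>c\<in>set_mset ?nu - {z}. ?B c) = 0" by (simp add: sum.insert_remove)
    \<comment> \<open>Passing \<open>z\<close> costs \<open>- al\<close> on the algebra side and
      \<open>al\<close> on the \<open>W\<close> side, so moving \<open>c\<close> and moving
      \<open>z\<close> anticommute.\<close>
    have AB: "?A c = - ?B c" if c: "c \<in> set_mset ?nu - {z}" for c
    proof -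
      have cL: "c \<in># L" using c mset_subset_eqD[OF sub(1)] by blast
      have zc: "z < c" using zmin[OF cL] c by auto
      have 1: "add_mset z ?nu - {#c#} = add_mset z (?nu - {#c#})" using c by auto
      have 2: "kc (- al) Y c (add_mset z (?nu - {#c#})) = - al * kc (- al) Y c (?nu - {#c#})"
        using zc by (auto simp: kc_def)
      have 3: "kc al (- Y) c mu = al * kc al (- Y) c (mu - {#z#})"
      proof -
        have "kc al (- Y) c (add_mset z (mu - {#z#})) = al * kc al (- Y) c (mu - {#z#})"
          using zc by (auto simp: kc_def)
        thus ?thesis using True by simp
      qed
      have 4: "add_mset c mu - {#z#} = add_mset c (mu - {#z#})" using zc by auto
      show ?thesis unfolding 1 2 3 4 using True by simp
    qed
    have "(\<Sum>c\<in>set_mset ?nu - {z}. ?A c) = (\<Sum>c\<in>set_mset ?nu - {z}. - ?B c)"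
      by (rule sum.cong[OF refl AB])
    also have "\<dots> = - (\<Sum>c\<in>set_mset ?nu - {z}. ?B c)" by (rule sum_negf)
    also have "\<dots> = ?B z" using B0 by (rule eq_neg_iff_add_eq_0[THEN iffD2, symmetric])
    finally have "(\<Sum>c\<in>set_mset ?nu - {z}. ?A c) = ?B z" .
    \<comment> \<open>Exactly one of \<open>?A z\<close> and \<open>?B z\<close> yields
      \<open>X mu\<close>: the former if \<open>z\<close> occurs in \<open>?nu\<close> and may not
      be repeated there, the latter otherwise.\<close>
    moreover have "?B z = (if z \<in> Y \<or> z \<notin># ?nu then X mu else 0)"
    proof -
      have "z \<in> - Y \<or> z \<notin># mu - {#z#}"
        using a1 by (rule adm_remove)
      thus ?thesis using kz[OF sub(1), of "- al" Y] kz[OF sub(3), of al "- Y"] True by simp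
    qed
    moreover have "(if z \<in># ?nu then ?A z else 0) = (if z \<in> Y \<or> z \<notin># ?nu then 0 else X mu)"
    proof (cases "z \<in># ?nu")
      case z: True
      have "z \<in> Y \<or> z \<notin># ?nu - {#z#}"
        using a2 by (rule adm_remove)
      thus ?thesis using kz[OF sub(2), of "- al" Y] kz[OF mL, of al "- Y"] True z by auto
    qed simp
    ultimately show ?thesis using total by auto
  qed
qed

lemma exact_cx_XL:
  fixes q :: "'k::field"
  assumes L: "L \<noteq> {#}"
  shows "exact_cx im (TX q chi) q (XL L) (size L)"
  unfolding exact_cx_def
proof (intro allI impI)
  let ?T = "TX q chi"
  define al where "al = al_of im q"
  define Y where "Y = Y_of im q chi"
  fix n x
  assume A: "1 \<le> n \<and> n \<le> size L \<and> x \<in> Fsp im ?T q (XL L) n \<and> x \<in> Zsp im ?T q (XL L) (size L) (n - 1)"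
  hence n: "1 \<le> n" "n \<le> size L" and xF: "x \<in> Fsp im ?T q (XL L) n" by auto
  have xX: "x \<in> XL L" and xR: "\<And>i. Suc i < n \<Longrightarrow> lrule al Y i x"
    using xF unfolding Fsp_XL_iff[OF n(2)] al_def Y_def by auto
  let ?P = "pr (- al) Y L x"
  \<comment> \<open>By \<open>lrule_sort\<close> the function \<open>?P\<close> is determined by its
    values on weakly decreasing words, kept in \<open>X\<close>; \<open>tau\<close> holds the
    scalars relating the other words to them.\<close>
  define X where "X mu = ?P (rev (slm mu))" for mu
  define tau where "tau u = kap al (- Y) (rev u)" for u
  define z where "z = Min (set_mset L)"
  have P0: "?P u = 0" if "length u = n - 1" "mset u \<subseteq># L" for u
    using pr_Zsp[of x im q chi L "n - 1" u] A that unfolding al_def Y_def by blast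
  have PR: "lrule al Y i ?P" if "Suc i < n" for i
  proof -
    have l: "lrule al Y i (\<lambda>u. x (u @ v))" for v using lrule_left[OF xR[OF that]] .
    show ?thesis unfolding lrule_iff
    proof (intro allI impI)
      fix s t :: "nat list" and a b assume s: "length s = i"
      have m: "mset (s @ a # b # t) = mset (s @ b # a # t)" by simp
      show "(a < b \<longrightarrow> ?P (s @ a # b # t) = al * ?P (s @ b # a # t)) \<and>
          (a = b \<and> a \<in> Y \<longrightarrow> ?P (s @ a # b # t) = 0)"
        using l[unfolded lrule_iff, rule_format, OF s, of a b t] unfolding pr_def m
        by (auto simp: sum_distrib_left mult.left_commute intro!: sum.cong sum.neutral)
    qed
  qed
  have PX: "?P u = tau u * X (mset u)" if "length u = n" for u
    unfolding tau_def X_def by (rule lrule_sort[OF PR that])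
  have tau_snoc: "tau (u @ [c]) = kc al (- Y) c (mset u) * tau u" for u c
    by (simp add: tau_def)
  have tau_adm: "\<not> adm (- Y) (mset u) \<Longrightarrow> tau u = 0" for u
    unfolding tau_def by (rule kap_not_adm) simp
  have pr_adm: "\<not> adm Y (L - mset u) \<Longrightarrow> pr (- al) Y L x' u = 0" for u and x' :: "nat list \<Rightarrow> 'k"
    unfolding pr_def by (rule sum.neutral) (auto simp: permutations_of_multiset_def intro: kap_not_adm)
  have key: "(\<Sum>c\<in>set_mset (L - mu). kc (- al) Y c (L - mu - {#c#}) * (kc al (- Y) c mu *
      (if z \<in># add_mset c mu then X (add_mset c mu - {#z#}) else 0))) = X mu"
    if mu: "mu \<subseteq># L" "size mu = n" "adm (- Y) mu" "adm Y (L - mu)" for mu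
    unfolding z_def
  proof (rule contracting_homotopy[OF mu(1) L mu(3,4)], fold z_def)
    assume z: "z \<in># mu"
    let ?u = "rev (slm (mu - {#z#}))"
    have mu': "mset ?u = mu - {#z#}" by simp
    have lu: "length ?u = n - 1" using mu' mu(2) z by (metis size_mset size_Diff_singleton)
    have sub: "mu - {#z#} \<subseteq># L" using mu(1) by (meson diff_subset_eq_self subset_mset.order_trans)
    have a: "adm (- Y) (mu - {#z#})" using mu(3) adm_mono diff_subset_eq_self by blast
    have t1: "tau ?u = 1" unfolding tau_def rev_rev_ident
      by (rule kap_sorted) (use a in auto)
    have "size (L - (mu - {#z#})) = size L - (n - 1)"
      using size_Diff_submset[OF sub] mu(2) z by (simp add: size_Diff_singleton)
    hence ne: "L - mset ?u \<noteq> {#}" using n mu' by auto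
    \<comment> \<open>The cycle condition at the content \<open>mu\<close> without one
      \<open>z\<close> supplies the hypothesis of the homotopy.\<close>
    have "0 = ?P ?u" using P0[OF lu] sub mu' by simp
    also have "\<dots> = (\<Sum>c\<in>set_mset (L - mset ?u). kc (- al) Y c (L - mset ?u - {#c#}) * ?P (?u @ [c]))"
      by (rule pr_expand[OF ne])
    also have "\<dots> = (\<Sum>c\<in>set_mset (L - mset ?u). kc (- al) Y c (L - mset ?u - {#c#})
      * (kc al (- Y) c (mset ?u) * X (add_mset c (mset ?u))))"
    proof (rule sum.cong[OF refl])
      fix c
      have "length (?u @ [c]) = n" using lu n by simp
      hence "?P (?u @ [c]) = tau (?u @ [c]) * X (mset (?u @ [c]))" by (rule PX)
      thus "kc (- al) Y c (L - mset ?u - {#c#}) * ?P (?u @ [c]) = kc (- al) Y c (L - mset ?u - {#c#})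
      * (kc al (- Y) c (mset ?u) * X (add_mset c (mset ?u)))" using tau_snoc t1 by simp
    qed
    finally show "(\<Sum>c\<in>set_mset (L - (mu - {#z#})). kc (- al) Y c (L - (mu - {#z#}) - {#c#})
      * (kc al (- Y) c (mu - {#z#}) * X (add_mset c (mu - {#z#})))) = 0" unfolding mu' by simp
  qed
  show "if n = size L then x = 0 else \<exists>y\<in>Fsp im ?T q (XL L) (Suc n). x - y \<in> Zsp im ?T q (XL L) (size L) n"
  proof (cases "n = size L")
    case True
    have "x w = 0" for w
    proof (cases "mset w = L")
      case w: True
      have xw: "x w = ?P w" unfolding pr_def w by simp
      also have "\<dots> = tau w * X L" using PX[of w] w True by (metis size_mset)
      also have "\<dots> = 0"
      proof (cases "adm (- Y) L")
        case a: True
        \<comment> \<open>With no letters left on the algebra side the sum in \<open>key\<close> is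
          empty.\<close>
        have "X L = 0" using key[of L] a True by (simp add: adm_def)
        thus ?thesis by simp
      qed (use tau_adm[of w] w in auto)
      finally show ?thesis .
    qed (use xX in \<open>auto simp: XL_iff\<close>)
    thus ?thesis using True by (auto simp: fun_eq_iff)
  next
    case False
    hence sn: "Suc n \<le> size L" using n by simp
    define h where "h mu = (if z \<in># mu then X (mu - {#z#}) else 0)" for mu
    define y where "y w = (if mset w = L \<and> sorted (drop (Suc n) w)
      then tau (take (Suc n) w) * h (mset (take (Suc n) w)) else 0)" for w
    have yX: "y \<in> XL L" by (simp add: XL_iff y_def)
    have yR: "lrule al Y i y" if i: "Suc i < Suc n" for i
      unfolding lrule_iff
    proof (intro allI impI)
      fix s t :: "nat list" and a b assume s: "length s = i"
      define k where "k = n - Suc i"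
      have k: "Suc n = length s + Suc (Suc k)" using i s unfolding k_def by simp
      have tk: "take (Suc n) (s @ c # d # t) = s @ c # d # take k t"
        and dr: "drop (Suc n) (s @ c # d # t) = drop k t" for c d
        unfolding k by simp_all
      have m: "mset (s @ b # a # t) = mset (s @ a # b # t)" "mset (s @ b # a # take k t) = mset (s @ a # b # take k t)"
        by simp_all
      have tl: "a < b \<Longrightarrow> tau (s @ a # b # take k t) = al * tau (s @ b # a # take k t)"
        unfolding tau_def using kap_swap[of a b al "- Y" "rev (take k t)" "rev s"] by simp
      have tz: "a \<in> Y \<Longrightarrow> tau (s @ a # a # take k t) = 0"
        unfolding tau_def using kap_repeat[of a "- Y" al "rev (take k t)" "rev s"] by simp
      show "(a < b \<longrightarrow> y (s @ a # b # t) = al * y (s @ b # a # t)) \<and> (a = b \<and> a \<in> Y \<longrightarrow> y (s @ a # b # t) = 0)"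
        unfolding y_def tk dr m using tl tz by (auto simp del: mset_append)
    qed
    have yF: "y \<in> Fsp im ?T q (XL L) (Suc n)"
      using yX yR unfolding Fsp_XL_iff[OF sn] al_def Y_def by blast
    have py: "pr (- al) Y L y u = ?P u" if u: "length u = n" "mset u \<subseteq># L" for u
    proof (cases "adm Y (L - mset u)")
      case aY: True
      have ne: "L - mset u \<noteq> {#}" using size_Diff_submset[OF u(2)] u sn by auto
      have py1: "kc (- al) Y c (L - mset u - {#c#}) * pr (- al) Y L y (u @ [c]) =
          kc (- al) Y c (L - mset u - {#c#}) * (kc al (- Y) c (mset u) * h (add_mset c (mset u))) * tau u"
        if c: "c \<in># L - mset u" for c
      proof -
        let ?m = "L - mset (u @ [c])"
        have c': "{#c#} \<subseteq># L - mset u" using c by simp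
        have mm: "?m = L - mset u - {#c#}" by (simp add: diff_diff_add_mset)
        have cs: "mset (u @ [c]) + ?m = L"
        proof -
          have "add_mset c (L - mset u - {#c#}) = L - mset u" using c by (rule insert_DiffM)
          hence "mset u + add_mset c (L - mset u - {#c#}) = L" using u(2) by simp
          thus ?thesis unfolding mm by (simp del: diff_diff_add_mset diff_add_mset_swap)
        qed
        have am: "adm Y ?m" unfolding mm using aY diff_subset_eq_self by (rule adm_mono[rotated])
        have fin: "finite (perms_ms ?m)" by simp
        have yv: "y ((u @ [c]) @ v) = (if v = slm ?m then tau (u @ [c]) * h (mset (u @ [c])) else 0)"
          if v: "v \<in> perms_ms ?m" for v
        proof -
          have mv: "mset v = ?m" using v by (simp add: permutations_of_multiset_def)
          have "mset ((u @ [c]) @ v) = L" unfolding mset_append[of "u @ [c]" v] mv by (rule cs)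
          moreover have "sorted v \<longleftrightarrow> v = slm ?m"
            unfolding mv[symmetric] by (metis sorted_sort sorted_list_of_multiset_mset sorted_sort_id)
          moreover have "take (Suc n) ((u @ [c]) @ v) = u @ [c]" "drop (Suc n) ((u @ [c]) @ v) = v"
            using u(1) by simp_all
          ultimately show ?thesis unfolding y_def by (simp only: simp_thms if_cancel)
        qed
        have "pr (- al) Y L y (u @ [c]) = (\<Sum>v\<in>perms_ms ?m. if v = slm ?m then kap (- al) Y v * (tau (u @ [c]) * h (mset (u @ [c]))) else 0)"
          unfolding pr_def by (rule sum.cong[OF refl]) (simp only: yv, simp)
        also have "\<dots> = kap (- al) Y (slm ?m) * (tau (u @ [c]) * h (mset (u @ [c])))"
          unfolding sum.delta[OF fin] by (simp add: permutations_of_multiset_def)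
        also have "kap (- al) Y (slm ?m) = 1" by (rule kap_sorted) (use am in auto)
        finally have "pr (- al) Y L y (u @ [c]) = tau (u @ [c]) * h (mset (u @ [c]))" by simp
        thus ?thesis by (simp add: tau_snoc)
      qed
      have "pr (- al) Y L y u = (\<Sum>c\<in>set_mset (L - mset u). kc (- al) Y c (L - mset u - {#c#}) * pr (- al) Y L y (u @ [c]))"
        by (rule pr_expand[OF ne])
      also have "\<dots> = (\<Sum>c\<in>set_mset (L - mset u). kc (- al) Y c (L - mset u - {#c#}) *
          (kc al (- Y) c (mset u) * h (add_mset c (mset u)))) * tau u"
        unfolding sum_distrib_right by (rule sum.cong[OF refl]) (rule py1)
      also have "\<dots> = tau u * X (mset u)"
      proof (cases "adm (- Y) (mset u)")
        case True
        show ?thesis unfolding h_def using key[OF u(2) _ True aY] u(1) by (simp only: size_mset mult.commute)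
      qed (simp add: tau_adm)
      also have "\<dots> = ?P u" using PX[OF u(1)] by simp
      finally show ?thesis .
    qed (simp add: pr_adm)
    have yF': "y \<in> Fsp im ?T q (XL L) n" by (rule subsetD[OF Fsp_antimono[OF le_SucI[OF order_refl]] yF])
    have "x - y \<in> Zsp im ?T q (XL L) (size L) n"
    proof (rule pr_zero_imp_Zsp[OF _ n(2)], fold al_def Y_def)
      show "x - y \<in> Fsp im ?T q (XL L) n"
        using xF yF' subspace_Fsp[OF lin_ops_TX subspace_supp_in] by (meson fs.subspace_diff)
      fix u :: "nat list" assume u: "length u = n" "mset u \<subseteq># L"
      have "pr (- al) Y L (x - y) u = ?P u - pr (- al) Y L y u"
        unfolding pr_def by (simp add: sum_subtractf right_diff_distrib)
      thus "pr (- al) Y L (x - y) u = 0" using py[OF u] by simp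
    qed
    thus ?thesis using False yF by auto
  qed
qed

section \<open>Induced modules as word modules\<close>

definition Invs :: "nat \<Rightarrow> (nat \<Rightarrow> nat) \<Rightarrow> (nat \<times> nat) set" where
  "Invs N p = {(i, j). i < j \<and> j < N \<and> p j < p i}"

lemma finite_Invs: "finite (Invs N p)"
  by (rule finite_subset[of _ "{..<N} \<times> {..<N}"]) (auto simp: Invs_def)

lemma hlen_eq: "hlen N p = card (Invs N p)"
  by (simp add: hlen_def Invs_def)

lemma sgen_less_iff: "x \<noteq> y \<Longrightarrow> sgen s x < sgen s y \<longleftrightarrow> (x < y \<and> \<not> (x = s \<and> y = Suc s)) \<or> (x = Suc s \<and> y = s)"
  by (auto simp: sgen_def transpose_def)

lemma sgen_sgen [simp]: "sgen s (sgen s x) = x" "sgen s \<circ> (sgen s \<circ> p) = p" "(p \<circ> sgen s) \<circ> sgen s = p"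
  by (simp_all add: sgen_def fun_eq_iff)

lemma sgen_perms: "Suc s < N \<Longrightarrow> sgen s \<in> perms N"
  unfolding perms_def sgen_def by (auto intro!: permutes_swap_id)

lemma sgen_comp_perms: "Suc s < N \<Longrightarrow> p \<in> perms N \<Longrightarrow> sgen s \<circ> p \<in> perms N" "Suc s < N \<Longrightarrow> p \<in> perms N \<Longrightarrow> p \<circ> sgen s \<in> perms N"
  using sgen_perms[of s N] unfolding perms_def by (auto intro: permutes_compose)

lemma perms_inv:
  assumes "p \<in> perms N"
  shows "p (inv p x) = x" "inv p (p x) = x" "inj p" "bij p" "inv p x < N \<longleftrightarrow> x < N" "p x < N \<longleftrightarrow> x < N"
  using assms unfolding perms_def
  by (auto simp: permutes_inverses permutes_inj permutes_bij permutes_in_image[of _ "{..<N}", simplified] dest: permutes_inv)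

lemma inv_sgen_comp: "p \<in> perms N \<Longrightarrow> inv (sgen s \<circ> p) x = inv p (sgen s x)"
  using perms_inv(4)[of p N] by (subst o_inv_distrib) (auto simp: sgen_def bij_betw_def)

lemma inv_comp_sgen: "p \<in> perms N \<Longrightarrow> inv (p \<circ> sgen s) x = sgen s (inv p x)"
  using perms_inv(4)[of p N] by (subst o_inv_distrib) (auto simp: sgen_def bij_betw_def)

text \<open>The sets of inversions are compared and not just their sizes, because the scalar
  \<open>cf\<close> is a product over them.\<close>

lemma Invs_sgen_left:
  assumes p: "p \<in> perms N" and s: "Suc s < N" and up: "inv p s < inv p (Suc s)"
  shows "Invs N (sgen s \<circ> p) = insert (inv p s, inv p (Suc s)) (Invs N p)" "(inv p s, inv p (Suc s)) \<notin> Invs N p"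
proof -
  note i = perms_inv[OF p]
  have flip: "sgen s (p b) < sgen s (p a) \<longleftrightarrow> (p b < p a) \<or> (a = inv p s \<and> b = inv p (Suc s))" if "a < b" for a b
  proof -
    have ne: "p b \<noteq> p a" using that i(3) by (auto dest: injD)
    have "\<not> (p b = s \<and> p a = Suc s)"
    proof
      assume "p b = s \<and> p a = Suc s"
      hence "b = inv p s" "a = inv p (Suc s)" using i(2) by metis+
      thus False using that up by simp
    qed
    moreover have "(p b = Suc s \<and> p a = s) \<longleftrightarrow> (a = inv p s \<and> b = inv p (Suc s))" using i(1,2) by metis
    ultimately show ?thesis unfolding sgen_less_iff[OF ne] by blast
  qed
  show "Invs N (sgen s \<circ> p) = insert (inv p s, inv p (Suc s)) (Invs N p)"
    using up s i(5) flip unfolding Invs_def by auto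
  show "(inv p s, inv p (Suc s)) \<notin> Invs N p" using i(1) by (auto simp: Invs_def)
qed

lemma Invs_sgen_right:
  assumes p: "p \<in> perms N" and s: "Suc s < N" and up: "p s < p (Suc s)"
  shows "Invs N (p \<circ> sgen s) = insert (s, Suc s) ((\<lambda>(a, b). (sgen s a, sgen s b)) ` Invs N p)"
    "(s, Suc s) \<notin> (\<lambda>(a, b). (sgen s a, sgen s b)) ` Invs N p"
proof -
  note sp = perms_inv(6)[OF sgen_perms[OF s]]
  have ss: "sgen s s = Suc s" "sgen s (Suc s) = s" by (auto simp: sgen_def)
  have lt: "sgen s a < sgen s b" if "a < b" "(a, b) \<noteq> (s, Suc s)" for a b
    using that sgen_less_iff[of a b s] by auto
  show "Invs N (p \<circ> sgen s) = insert (s, Suc s) ((\<lambda>(a, b). (sgen s a, sgen s b)) ` Invs N p)"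
  proof (intro equalityI subsetI)
    fix x assume "x \<in> Invs N (p \<circ> sgen s)"
    then obtain a b where x: "x = (a, b)" "a < b" "b < N" "p (sgen s b) < p (sgen s a)" by (auto simp: Invs_def)
    show "x \<in> insert (s, Suc s) ((\<lambda>(a, b). (sgen s a, sgen s b)) ` Invs N p)"
    proof (cases "(a, b) = (s, Suc s)")
      case False
      have "(sgen s a, sgen s b) \<in> Invs N p" using lt[OF x(2) False] x sp by (auto simp: Invs_def)
      hence "(\<lambda>(a, b). (sgen s a, sgen s b)) (sgen s a, sgen s b) \<in> (\<lambda>(a, b). (sgen s a, sgen s b)) ` Invs N p"
        by (rule imageI)
      thus ?thesis using x by simp
    qed (simp add: x)
  next
    fix x assume "x \<in> insert (s, Suc s) ((\<lambda>(a, b). (sgen s a, sgen s b)) ` Invs N p)"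
    then consider "x = (s, Suc s)" | a b where "x = (sgen s a, sgen s b)" "(a, b) \<in> Invs N p" by auto
    thus "x \<in> Invs N (p \<circ> sgen s)"
    proof cases
      case 1
      thus ?thesis using up s by (auto simp: Invs_def ss)
    next
      case 2
      hence "(a, b) \<noteq> (s, Suc s)" using up by (auto simp: Invs_def)
      thus ?thesis using 2 lt[of a b] sp by (auto simp: Invs_def)
    qed
  qed
  show "(s, Suc s) \<notin> (\<lambda>(a, b). (sgen s a, sgen s b)) ` Invs N p"
  proof
    assume "(s, Suc s) \<in> (\<lambda>(a, b). (sgen s a, sgen s b)) ` Invs N p"
    then obtain x where x: "x \<in> Invs N p" "(s, Suc s) = (case x of (a, b) \<Rightarrow> (sgen s a, sgen s b))" by blast
    obtain a b where "x = (a, b)" by (cases x)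
    hence ab: "sgen s a = s" "sgen s b = Suc s" "(a, b) \<in> Invs N p" using x by auto
    hence "a = Suc s" "b = s" using sgen_sgen(1)[of s a] sgen_sgen(1)[of s b] ss by auto
    thus False using ab by (auto simp: Invs_def)
  qed
qed

lemma hlen_left:
  assumes p: "p \<in> perms N" and s: "Suc s < N" and up: "inv p s < inv p (Suc s)"
  shows "hlen N (sgen s \<circ> p) = Suc (hlen N p)"
  unfolding hlen_eq Invs_sgen_left(1)[OF assms]
  using Invs_sgen_left(2)[OF assms] finite_Invs by (simp add: card_insert_if)

lemma inj_sgen_pair: "inj_on (\<lambda>(a, b). (sgen s a, sgen s b)) A"
  by (rule inj_onI) (auto, (metis sgen_sgen(1))+)

lemma hlen_right:
  assumes p: "p \<in> perms N" and s: "Suc s < N" and up: "p s < p (Suc s)"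
  shows "hlen N (p \<circ> sgen s) = Suc (hlen N p)"
  unfolding hlen_eq Invs_sgen_right(1)[OF assms]
  using Invs_sgen_right(2)[OF assms] finite_Invs card_image[OF inj_sgen_pair] by (simp add: card_insert_if)

lemma finite_perms: "finite (perms N)"
  unfolding perms_def by (simp add: finite_permutations)

lemma hecke_eq: "hecke N = supp_in (perms N)"
  by (simp add: hecke_def supp_in_def)

lemma sum_perms_left:
  assumes s: "Suc s < N"
  shows "(\<Sum>p\<in>perms N. G p) = (\<Sum>p | p \<in> perms N \<and> inv p s < inv p (Suc s). G p + G (sgen s \<circ> p))"
proof -
  let ?U = "{p \<in> perms N. inv p s < inv p (Suc s)}" and ?D = "{p \<in> perms N. inv p (Suc s) < inv p s}"
  have ss: "sgen s s = Suc s" "sgen s (Suc s) = s" by (auto simp: sgen_def)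
  have ne: "inv p s \<noteq> inv p (Suc s)" if "p \<in> perms N" for p
    using perms_inv(1)[OF that, of s] perms_inv(1)[OF that, of "Suc s"] by auto
  have "perms N = ?U \<union> ?D" using ne by (auto simp: linorder_neq_iff)
  hence "(\<Sum>p\<in>perms N. G p) = sum G (?U \<union> ?D)" by simp
  also have "\<dots> = sum G ?U + sum G ?D" by (rule sum.union_disjoint) (auto simp: finite_perms)
  also have "sum G ?D = sum (\<lambda>p. G (sgen s \<circ> p)) ?U"
    by (rule sum.reindex_bij_witness[of _ "\<lambda>p. sgen s \<circ> p" "\<lambda>p. sgen s \<circ> p"])
      (auto simp: sgen_comp_perms[OF s] inv_sgen_comp ss)
  finally show ?thesis by (simp add: sum.distrib)
qed

lemma sum_perms_right:
  assumes s: "Suc s < N"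
  shows "(\<Sum>p\<in>perms N. G p) = (\<Sum>p | p \<in> perms N \<and> p s < p (Suc s). G p + G (p \<circ> sgen s))"
proof -
  let ?U = "{p \<in> perms N. p s < p (Suc s)}" and ?D = "{p \<in> perms N. p (Suc s) < p s}"
  have ss: "sgen s s = Suc s" "sgen s (Suc s) = s" by (auto simp: sgen_def)
  have ne: "p s \<noteq> p (Suc s)" if "p \<in> perms N" for p
    using perms_inv(2)[OF that, of s] perms_inv(2)[OF that, of "Suc s"] by auto
  have "perms N = ?U \<union> ?D" using ne by (auto simp: linorder_neq_iff)
  hence "(\<Sum>p\<in>perms N. G p) = sum G (?U \<union> ?D)" by simp
  also have "\<dots> = sum G ?U + sum G ?D" by (rule sum.union_disjoint) (auto simp: finite_perms)
  also have "sum G ?D = sum (\<lambda>p. G (p \<circ> sgen s)) ?U"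
    by (rule sum.reindex_bij_witness[of _ "\<lambda>p. p \<circ> sgen s" "\<lambda>p. p \<circ> sgen s"])
      (auto simp: sgen_comp_perms[OF s] ss)
  finally show ?thesis by (simp add: sum.distrib)
qed

lemma TX_dlt:
  fixes u :: "nat list"
  assumes s: "Suc s < length u" and le: "u ! s \<le> u ! Suc s"
  shows "u ! s = u ! Suc s \<Longrightarrow> TX q chi s (dlt u) = (\<lambda>w. chi (u ! s) * dlt u w)"
    "u ! s < u ! Suc s \<Longrightarrow> TX q chi s (dlt u) = dlt (swp s u)"
    "u ! s < u ! Suc s \<Longrightarrow> TX q chi s (dlt (swp s u)) = (\<lambda>w. q * dlt u w + (q - 1) * dlt (swp s u) w)"
proof -
  obtain l a b t where u: "u = l @ a # b # t" "length l = s" using split_at_adjacent[OF s] .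
  have ab: "u ! s = a" "u ! Suc s = b" "swp s u = l @ b # a # t" using u by (auto simp: nth_append swp_append)
  have ex: "f = g" if "\<And>m c e n. length m = s \<Longrightarrow> f (m @ c # e # n) = g (m @ c # e # n)"
    "\<And>w. \<not> Suc s < length w \<Longrightarrow> f w = g w" for f g :: "nat list \<Rightarrow> 'a"
  proof
    fix w show "f w = g w"
      using that(1) that(2)[of w] split_at_adjacent[of s w] by metis
  qed
  have short: "TX q chi s f w = 0" if "\<not> Suc s < length w" for f w using that by (simp add: TX_def)
  have short': "dlt u w = 0" "dlt (swp s u) w = 0" if "\<not> Suc s < length w" for w
    using that s by (auto simp: dlt_def)
  show "TX q chi s (dlt u) = (\<lambda>w. chi (u ! s) * dlt u w)" if "u ! s = u ! Suc s"
    by (rule ex) (use that u(2) in \<open>auto simp: TX_append short short' ab\<close>, auto simp: dlt_def u(1))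
  show "TX q chi s (dlt u) = dlt (swp s u)" if "u ! s < u ! Suc s"
    by (rule ex) (use that u(2) in \<open>auto simp: TX_append short short' ab\<close>, auto simp: dlt_def u(1))
  show "TX q chi s (dlt (swp s u)) = (\<lambda>w. q * dlt u w + (q - 1) * dlt (swp s u) w)" if "u ! s < u ! Suc s"
    by (rule ex) (use that u(2) in \<open>auto simp: TX_append short short' ab\<close>, auto simp: dlt_def u(1))
qed

lemma TX_add: "TX Q chi i (x + y) = TX Q chi i x + TX Q chi i y"
  by (auto simp: TX_def fun_eq_iff algebra_simps)

lemma TX_sum: "TX Q chi i (\<Sum>j\<in>A. f j) = (\<Sum>j\<in>A. TX Q chi i (f j))"
proof (induction A rule: infinite_finite_induct)
  have "TX Q chi i 0 = 0" by (auto simp: TX_def fun_eq_iff)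
  thus "TX Q chi i (\<Sum>j\<in>{}. f j) = (\<Sum>j\<in>{}. TX Q chi i (f j))"
    and "infinite A \<Longrightarrow> TX Q chi i (\<Sum>j\<in>A. f j) = (\<Sum>j\<in>A. TX Q chi i (f j))" for A by simp_all
qed (simp only: sum.insert TX_add not_False_eq_True)

text \<open>\<open>bl\<close> gives the blocks of a parabolic subgroup and \<open>chl\<close> the value of the character on each block. The induced module
  is identified with \<open>XL letters\<close> by sending \<open>T_p\<close> to the sorted word permuted by \<open>p\<close>, times the character value \<open>cf p\<close> of
  the parabolic component of \<open>p\<close>.\<close>
locale young =
  fixes N :: nat and q :: "'k::field" and bl :: "nat \<Rightarrow> nat" and chl :: "nat \<Rightarrow> 'k"
  assumes bl_mono: "i \<le> j \<Longrightarrow> bl i \<le> bl j"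
    and quad: "(chl c - q) * (chl c + 1) = 0"
begin

definition wd :: "(nat \<Rightarrow> nat) \<Rightarrow> nat list" where
  "wd p = map (\<lambda>i. bl (inv p i)) [0..<N]"

definition cf :: "(nat \<Rightarrow> nat) \<Rightarrow> 'k" where
  "cf p = (\<Prod>(i, j)\<in>Invs N p. if bl i = bl j then chl (bl i) else 1)"

definition letters :: "nat multiset" where
  "letters = mset (map bl [0..<N])"

definition phi :: "((nat \<Rightarrow> nat) \<Rightarrow> 'k) \<Rightarrow> nat list \<Rightarrow> 'k" where
  "phi x = (\<Sum>p\<in>perms N. sc (cf p * x p) (dlt (wd p)))"

definition ind_ker :: "((nat \<Rightarrow> nat) \<Rightarrow> 'k) set" where
  "ind_ker = fs.span {(\<lambda>u. hr N q x s u - chl (bl s) * x u) | x s. x \<in> hecke N \<and> Suc s < N \<and> bl s = bl (Suc s)}"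

lemma chl_sq: "chl c * chl c = (q - 1) * chl c + q"
proof -
  have "chl c * chl c - ((q - 1) * chl c + q) = (chl c - q) * (chl c + 1)" by (simp add: algebra_simps)
  thus ?thesis using quad[of c] by simp
qed

lemma size_letters: "size letters = N"
  by (simp add: letters_def)

lemma length_wd [simp]: "length (wd p) = N"
  by (simp add: wd_def)

lemma nth_wd: "i < N \<Longrightarrow> wd p ! i = bl (inv p i)"
  by (simp add: wd_def)

lemma mset_wd:
  assumes "p \<in> perms N"
  shows "mset (wd p) = letters"
proof -
  have "inv p ` {0..<N} = {0..<N}"
    using assms permutes_image[OF permutes_inv, of p "{..<N}"] by (simp add: perms_def atLeast0LessThan)
  moreover have "inj_on (inv p) {0..<N}"
    using assms permutes_inj[OF permutes_inv, of p "{..<N}"] by (auto simp: perms_def intro: inj_on_subset)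
  ultimately have "image_mset (inv p) (mset_set {0..<N}) = mset_set {0..<N}"
    by (simp add: image_mset_mset_set)
  hence "image_mset bl (image_mset (inv p) (mset_set {0..<N})) = image_mset bl (mset_set {0..<N})" by simp
  thus ?thesis unfolding wd_def letters_def mset_map mset_upt by (simp add: multiset.map_comp comp_def)
qed

lemma wd_perms: "p \<in> perms N \<Longrightarrow> wd p \<in> perms_ms letters"
  by (simp add: permutations_of_multiset_def mset_wd)

lemma wd_left:
  assumes p: "p \<in> perms N" and s: "Suc s < N"
  shows "wd (sgen s \<circ> p) = swp s (wd p)"
proof (rule nth_equalityI)
  fix i assume "i < length (wd (sgen s \<circ> p))"
  hence i: "i < N" by simp
  have "wd (sgen s \<circ> p) ! i = bl (inv p (sgen s i))" using nth_wd[OF i] inv_sgen_comp[OF p] by simp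
  also have "\<dots> = swp s (wd p) ! i"
    unfolding swp_def using i s by (auto simp: nth_list_update nth_wd sgen_def transpose_def)
  finally show "wd (sgen s \<circ> p) ! i = swp s (wd p) ! i" .
qed simp

lemma bl_sgen: "bl s = bl (Suc s) \<Longrightarrow> bl (sgen s a) = bl a"
  by (auto simp: sgen_def transpose_def)

lemma wd_right:
  assumes p: "p \<in> perms N" and s: "bl s = bl (Suc s)"
  shows "wd (p \<circ> sgen s) = wd p"
  unfolding wd_def using inv_comp_sgen[OF p] bl_sgen[OF s] by simp

lemma cf_left:
  assumes p: "p \<in> perms N" and s: "Suc s < N" and up: "inv p s < inv p (Suc s)"
  shows "cf (sgen s \<circ> p) = (if bl (inv p s) = bl (inv p (Suc s)) then chl (bl (inv p s)) else 1) * cf p"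
  unfolding cf_def Invs_sgen_left(1)[OF assms]
  using Invs_sgen_left(2)[OF assms] finite_Invs by simp

lemma cf_right:
  assumes p: "p \<in> perms N" and s: "Suc s < N" and up: "p s < p (Suc s)" and b: "bl s = bl (Suc s)"
  shows "cf (p \<circ> sgen s) = chl (bl s) * cf p"
proof -
  let ?g = "\<lambda>(i, j). if bl i = bl j then chl (bl i) else 1" and ?h = "\<lambda>(a, b). (sgen s a, sgen s b)"
  have "cf (p \<circ> sgen s) = ?g (s, Suc s) * prod ?g (?h ` Invs N p)"
    unfolding cf_def Invs_sgen_right(1)[OF assms(1-3)]
    using Invs_sgen_right(2)[OF assms(1-3)] finite_Invs by (intro prod.insert) auto
  also have "prod ?g (?h ` Invs N p) = prod (?g \<circ> ?h) (Invs N p)"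
    by (rule prod.reindex[OF inj_sgen_pair])
  also have "?g \<circ> ?h = ?g" by (auto simp: fun_eq_iff bl_sgen[OF b])
  also have "?g (s, Suc s) = chl (bl s)" using b by simp
  finally show ?thesis unfolding cf_def .
qed

lemma phi_add: "phi (x + y) = phi x + phi y"
  unfolding phi_def by (simp add: fun_eq_iff fun_sum_apply sc_def distrib_left distrib_right sum.distrib)

lemma phi_sc: "phi (sc c x) = sc c (phi x)"
  unfolding phi_def by (simp add: fun_eq_iff fun_sum_apply sc_def sum_distrib_left algebra_simps)

lemma phi_in_XL: "phi x \<in> XL letters"
  unfolding phi_def
  by (intro fs.subspace_sum[OF subspace_supp_in] fs.subspace_scale[OF subspace_supp_in] dlt_in_supp_in wd_perms)

text \<open>For \<open>p\<close> and its left multiple by \<open>s\<close>, the letters at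
  \<open>s\<close> and \<open>s + 1\<close> either differ, and the length rule of the Hecke algebra
  becomes the rule defining \<open>TX\<close>, or agree, and the quadratic relation for the
  character value merges the two terms.\<close>

lemma phi_hl:
  assumes s: "Suc s < N"
  shows "phi (hl N q s x) = TX q chl s (phi x)"
proof -
  let ?U = "{p. p \<in> perms N \<and> inv p s < inv p (Suc s)}"
  let ?T = "TX q chl s"
  have T: "?T (phi x) = (\<Sum>p\<in>perms N. sc (cf p * x p) (?T (dlt (wd p))))"
    unfolding phi_def TX_sum lin_opsD(2)[OF lin_ops_TX] ..
  show ?thesis unfolding T unfolding phi_def sum_perms_left[OF s]
  proof (rule sum.cong[OF refl])
    fix p assume "p \<in> ?U"
    hence p: "p \<in> perms N" and up: "inv p s < inv p (Suc s)" by auto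
    let ?p = "sgen s \<circ> p" and ?u = "wd p"
    have h: "hl N q s x p = q * x ?p" "hl N q s x ?p = x p + (q - 1) * x ?p"
      unfolding hl_def using hlen_left[OF p s up] by simp_all
    have u: "?u ! s = bl (inv p s)" "?u ! Suc s = bl (inv p (Suc s))" using s by (simp_all add: nth_wd)
    have le: "?u ! s \<le> ?u ! Suc s" unfolding u using up by (intro bl_mono) simp
    have len: "Suc s < length ?u" using s by simp
    have w: "wd ?p = swp s ?u" by (rule wd_left[OF p s])
    note c = cf_left[OF p s up]
    show "sc (cf p * hl N q s x p) (dlt ?u) + sc (cf ?p * hl N q s x ?p) (dlt (wd ?p)) =
      sc (cf p * x p) (?T (dlt ?u)) + sc (cf ?p * x ?p) (?T (dlt (wd ?p)))"
    proof (cases "?u ! s = ?u ! Suc s")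
      case True
      have sw: "swp s ?u = ?u" using True by (metis list_update_id swp_def)
      let ?c = "chl (?u ! s)"
      have cp: "cf ?p = ?c * cf p" using c u True by simp
      have t: "?T (dlt ?u) = (\<lambda>w. ?c * dlt ?u w)" using TX_dlt(1)[OF len le True] .
      have "cf p * (q * x ?p) + ?c * cf p * (x p + (q - 1) * x ?p) =
          cf p * x p * ?c + cf p * x ?p * ((q - 1) * ?c + q)" by (simp add: algebra_simps)
      also have "\<dots> = cf p * x p * ?c + ?c * cf p * x ?p * ?c"
        unfolding chl_sq[of "?u ! s", symmetric] by (simp add: algebra_simps)
      finally have e: "cf p * (q * x ?p) + ?c * cf p * (x p + (q - 1) * x ?p) =
          cf p * x p * ?c + ?c * cf p * x ?p * ?c" .
      show ?thesis unfolding w sw t h cp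
      proof
        fix v
        have "(cf p * (q * x ?p) + ?c * cf p * (x p + (q - 1) * x ?p)) * dlt ?u v =
          (cf p * x p * ?c + ?c * cf p * x ?p * ?c) * dlt ?u v" unfolding e ..
        thus "(sc (cf p * (q * x ?p)) (dlt ?u) + sc (?c * cf p * (x p + (q - 1) * x ?p)) (dlt ?u)) v =
          (sc (cf p * x p) (\<lambda>w. ?c * dlt ?u w) + sc (?c * cf p * x ?p) (\<lambda>w. ?c * dlt ?u w)) v"
          by (simp add: sc_def algebra_simps)
      qed
    next
      case False
      hence lt: "?u ! s < ?u ! Suc s" using le by simp
      have cp: "cf ?p = cf p" using c u False by simp
      show ?thesis unfolding w TX_dlt(2)[OF len le lt] TX_dlt(3)[OF len le lt] h cp
        by (simp add: fun_eq_iff sc_def algebra_simps)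
    qed
  qed
qed

text \<open>Multiplying on the right inside a block leaves the word unchanged and changes
  \<open>cf\<close> by the character value.\<close>

lemma phi_hr:
  assumes s: "Suc s < N" and b: "bl s = bl (Suc s)"
  shows "phi (hr N q x s) = sc (chl (bl s)) (phi x)"
  unfolding phi_def sum_perms_right[OF s] fs.scale_sum_right
proof (rule sum.cong[OF refl])
  fix p assume "p \<in> {p. p \<in> perms N \<and> p s < p (Suc s)}"
  hence p: "p \<in> perms N" and up: "p s < p (Suc s)" by auto
  let ?p = "p \<circ> sgen s" and ?u = "wd p" and ?c = "chl (bl s)"
  have h: "hr N q x s p = q * x ?p" "hr N q x s ?p = x p + (q - 1) * x ?p"
    unfolding hr_def using hlen_right[OF p s up] by simp_all
  have cp: "cf ?p = ?c * cf p" by (rule cf_right[OF p s up b])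
  have w: "wd ?p = ?u" by (rule wd_right[OF p b])
  have "cf p * (q * x ?p) + ?c * cf p * (x p + (q - 1) * x ?p) =
      cf p * x p * ?c + cf p * x ?p * ((q - 1) * ?c + q)" by (simp add: algebra_simps)
  also have "\<dots> = ?c * (cf p * x p + ?c * cf p * x ?p)"
    unfolding chl_sq[of "bl s", symmetric] by (simp add: algebra_simps)
  finally have e: "cf p * (q * x ?p) + ?c * cf p * (x p + (q - 1) * x ?p) =
      ?c * (cf p * x p + ?c * cf p * x ?p)" .
  show "sc (cf p * hr N q x s p) (dlt ?u) + sc (cf ?p * hr N q x s ?p) (dlt (wd ?p)) =
      sc ?c (sc (cf p * x p) (dlt ?u) + sc (cf ?p * x ?p) (dlt (wd ?p)))"
    unfolding w h cp fs.scale_left_distrib[symmetric] fs.scale_scale e ..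
qed

lemma phi_ind_ker: "x \<in> ind_ker \<Longrightarrow> phi x = 0"
  unfolding ind_ker_def
proof (induction rule: fs.span_induct_alt)
  case base
  show ?case unfolding phi_def by (rule sum.neutral) (simp add: sc_def fun_eq_iff)
next
  case (step c k y)
  then obtain x s where k: "k = (\<lambda>u. hr N q x s u - chl (bl s) * x u)" "Suc s < N" "bl s = bl (Suc s)" by blast
  have "k = hr N q x s + sc (- chl (bl s)) x" unfolding k(1) by (simp add: sc_def fun_eq_iff)
  hence "phi k = sc (chl (bl s)) (phi x) + sc (- chl (bl s)) (phi x)"
    by (simp only: phi_add phi_sc phi_hr[OF k(2,3)])
  hence "phi k = 0" by (simp add: sc_def fun_eq_iff)
  thus ?case using step by (simp only: phi_add phi_sc fs.scale_zero_right add_0_left)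
qed

text \<open>These are the minimal length representatives of the cosets of the parabolic subgroup,
  which acts on the right.\<close>

definition block_incr :: "(nat \<Rightarrow> nat) \<Rightarrow> bool" where
  "block_incr p \<longleftrightarrow> (\<forall>i j. i < j \<and> j < N \<and> bl i = bl j \<longrightarrow> p i < p j)"

lemma cf_block_incr: "block_incr p \<Longrightarrow> cf p = 1"
  unfolding cf_def block_incr_def by (rule prod.neutral) (auto simp: Invs_def dest: less_asym)

lemma block_incr_unique:
  assumes p: "p \<in> perms N" "block_incr p" and p': "p' \<in> perms N" "block_incr p'" and w: "wd p = wd p'"
  shows "p = p'"
proof (rule ccontr)
  assume "p \<noteq> p'"
  have aux: False
    if p: "p \<in> perms N" "block_incr p" and p': "p' \<in> perms N" "block_incr p'" and w: "wd p = wd p'"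
      and l: "\<And>j. j < i \<Longrightarrow> p j = p' j" and i: "p i < p' i" "i < N" for p p' i
  proof -
    \<comment> \<open>At the first difference \<open>i\<close>, \<open>?j\<close> is the place where
      \<open>p'\<close> takes the value \<open>p i\<close>. Equal words put it in the block of
      \<open>i\<close>, and each position relative to \<open>i\<close> is then
      contradictory.\<close>
    let ?j = "inv p' (p i)"
    have pi: "p i < N" using perms_inv(6)[OF p(1)] i by simp
    have "bl ?j = bl (inv p (p i))" using w nth_wd[OF pi, of p] nth_wd[OF pi, of p'] by simp
    hence b: "bl ?j = bl i" using perms_inv(2)[OF p(1)] by simp
    have pj: "p' ?j = p i" using perms_inv(1)[OF p'(1)] by simp
    have jN: "?j < N" using perms_inv(5)[OF p'(1)] pi by simp
    consider "?j < i" | "?j = i" | "i < ?j" by linarith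
    thus False
    proof cases
      case 1
      hence "p ?j = p i" using l pj by simp
      hence "?j = i" using perms_inv(3)[OF p(1)] by (auto dest: injD)
      thus False using 1 by simp
    next
      case 2
      thus False using pj i by simp
    next
      case 3
      hence "p' i < p' ?j" using p'(2) jN b unfolding block_incr_def by auto
      thus False using pj i by simp
    qed
  qed
  define i where "i = (LEAST i. p i \<noteq> p' i)"
  have ex: "\<exists>i. p i \<noteq> p' i" using \<open>p \<noteq> p'\<close> by auto
  have i: "p i \<noteq> p' i" and l: "\<And>j. j < i \<Longrightarrow> p j = p' j"
    unfolding i_def using LeastI_ex[OF ex] not_less_Least by blast+
  have iN: "i < N"
  proof (rule ccontr)
    assume "\<not> i < N"
    hence "p i = i" "p' i = i" using p(1) p'(1) by (auto simp: perms_def permutes_def)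
    thus False using i by simp
  qed
  from i show False
  proof (rule linorder_neqE_nat)
    assume "p i < p' i"
    thus False using aux[OF p p' w l _ iN] by blast
  next
    assume "p' i < p i"
    thus False using aux[OF p' p w[symmetric] l[symmetric] _ iN] by blast
  qed
qed

lemma hr_dlt:
  assumes p: "p \<in> perms N" and s: "Suc s < N" and up: "p s < p (Suc s)"
  shows "hr N q (dlt p) s = dlt (p \<circ> sgen s)"
proof
  fix u
  have ne: "p \<noteq> p \<circ> sgen s" using up by (metis comp_apply less_irrefl sgen_def transpose_apply_first)
  have iff: "u \<circ> sgen s = p \<longleftrightarrow> u = p \<circ> sgen s" by (metis sgen_sgen(3))
  show "hr N q (dlt p) s u = dlt (p \<circ> sgen s) u"
    unfolding hr_def using hlen_right[OF assms] ne iff by (auto simp: dlt_def)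
qed

lemma subspace_ind_ker: "fs.subspace ind_ker"
  unfolding ind_ker_def by (rule fs.subspace_span)

text \<open>A descent inside a block allows a right factor \<open>T_s\<close> to be split off and,
  modulo the kernel, replaced by the character value; this shortens \<open>p\<close>.\<close>

lemma reduce_to_block_incr:
  assumes "p \<in> perms N"
  shows "\<exists>p'\<in>perms N. block_incr p' \<and> wd p' = wd p \<and> dlt p - sc (cf p) (dlt p') \<in> ind_ker"
  using assms
proof (induction "hlen N p" arbitrary: p rule: less_induct)
  case less
  show ?case
  proof (cases "block_incr p")
    case True
    have "dlt p - sc (cf p) (dlt p) \<in> ind_ker"
      unfolding cf_block_incr[OF True] ind_ker_def by (simp only: fs.scale_one diff_self fs.span_zero)
    thus ?thesis by (intro bexI[of _ p] conjI True refl less.prems)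
  next
    case False
    then obtain i j where ij: "i < j" "j < N" "bl i = bl j" "\<not> p i < p j" unfolding block_incr_def by blast
    have "\<exists>s. i \<le> s \<and> s < j \<and> \<not> p s < p (Suc s)"
    proof (rule ccontr)
      assume "\<nexists>s. i \<le> s \<and> s < j \<and> \<not> p s < p (Suc s)"
      hence st: "\<And>s. i \<le> s \<Longrightarrow> s < j \<Longrightarrow> p s < p (Suc s)" by blast
      have "k \<le> j \<Longrightarrow> i < k \<Longrightarrow> p i < p k" for k
      proof (induction k)
        case (Suc k)
        show ?case
        proof (cases "i = k")
          case False
          hence "p i < p k" using Suc.IH Suc.prems by simp
          also have "p k < p (Suc k)" by (rule st) (use Suc.prems in simp_all)
          finally show ?thesis .
        next
          case True
          show ?thesis unfolding True by (rule st) (use Suc.prems True in simp_all)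
        qed
      qed simp
      thus False using ij by blast
    qed
    then obtain s where s: "i \<le> s" "s < j" "\<not> p s < p (Suc s)" by (elim exE conjE)
    have sN: "Suc s < N" using s ij by simp
    have "p s \<noteq> p (Suc s)" using injD[OF perms_inv(3)[OF less.prems], of s "Suc s"] by auto
    hence dn: "p (Suc s) < p s" using s by simp
    \<comment> \<open>Blocks are intervals by monotonicity, so a descent between \<open>i\<close>
      and \<open>j\<close> stays in their block.\<close>
    have "bl i \<le> bl s" by (rule bl_mono[OF s(1)])
    moreover have "bl s \<le> bl (Suc s)" by (rule bl_mono) simp
    moreover have "bl (Suc s) \<le> bl j" by (rule bl_mono) (use s in simp)
    ultimately have b: "bl s = bl (Suc s)" using ij(3) by linarith
    let ?p = "p \<circ> sgen s"
    have p1: "?p \<in> perms N" using sgen_comp_perms(2)[OF sN less.prems] .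
    have ss: "sgen s s = Suc s" "sgen s (Suc s) = s" by (auto simp: sgen_def)
    have up: "?p s < ?p (Suc s)" using dn ss by simp
    have hl: "hlen N p = Suc (hlen N ?p)" using hlen_right[OF p1 sN up] by (simp only: sgen_sgen)
    have "hlen N ?p < hlen N p" unfolding hl by (rule lessI)
    from less.hyps[OF this p1]
    obtain p' where p': "p' \<in> perms N" "block_incr p'" "wd p' = wd ?p" "dlt ?p - sc (cf ?p) (dlt p') \<in> ind_ker"
      by (elim bexE conjE)
    have "(\<lambda>u. hr N q (dlt ?p) s u - chl (bl s) * dlt ?p u) \<in> ind_ker"
      unfolding ind_ker_def
      by (intro fs.span_base CollectI exI[of _ "dlt ?p"] exI[of _ s] conjI refl sN b)
        (unfold hecke_eq, rule dlt_in_supp_in[OF p1])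
    moreover have "(\<lambda>u. hr N q (dlt ?p) s u - chl (bl s) * dlt ?p u) = dlt p - sc (chl (bl s)) (dlt ?p)"
      unfolding hr_dlt[OF p1 sN up] sgen_sgen by (rule ext) (simp add: sc_def)
    ultimately have "dlt p - sc (chl (bl s)) (dlt ?p) \<in> ind_ker" by (simp only:)
    hence "(dlt p - sc (chl (bl s)) (dlt ?p)) + sc (chl (bl s)) (dlt ?p - sc (cf ?p) (dlt p')) \<in> ind_ker"
      by (rule fs.subspace_add[OF subspace_ind_ker _ fs.subspace_scale[OF subspace_ind_ker p'(4)]])
    moreover have "cf p = chl (bl s) * cf ?p" using cf_right[OF p1 sN up b] by (simp only: sgen_sgen)
    moreover have "(A - sc c B) + sc c (B - sc e C) = A - sc (c * e) C" for A B C :: "(nat \<Rightarrow> nat) \<Rightarrow> 'k" and c e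
      by (simp add: fun_eq_iff sc_def algebra_simps)
    ultimately have "dlt p - sc (cf p) (dlt p') \<in> ind_ker" by (simp only:)
    moreover have "wd p' = wd p" using p'(3) wd_right[OF less.prems b] by (simp only:)
    ultimately show ?thesis by (intro bexI[OF _ p'(1)] conjI p'(2))
  qed
qed

lemma wd_surj:
  assumes "w \<in> perms_ms letters"
  shows "\<exists>p\<in>perms N. block_incr p \<and> wd p = w"
proof -
  have "mset w = mset (map bl [0..<N])" using assms by (simp add: permutations_of_multiset_def letters_def)
  then obtain f where f: "f permutes {..<length (map bl [0..<N])}" "permute_list f (map bl [0..<N]) = w"
    using mset_eq_permutation by blast
  have fp: "f \<in> perms N" "inv f \<in> perms N" using f(1) by (auto simp: perms_def intro: permutes_inv)
  have "wd (inv f) = w"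
    unfolding f(2)[symmetric] wd_def permute_list_def inv_inv_eq[OF perms_inv(4)[OF fp(1)]]
    using perms_inv(6)[OF fp(1)] by auto
  thus ?thesis using reduce_to_block_incr[OF fp(2)] by auto
qed

definition min_rep :: "nat list \<Rightarrow> nat \<Rightarrow> nat" where
  "min_rep w = (SOME p. p \<in> perms N \<and> block_incr p \<and> wd p = w)"

text \<open>A section of \<open>phi\<close> on minimal representatives. It is a two-sided inverse
  only modulo \<open>ind_ker\<close>, which maps out of the induced module do not see.\<close>

definition psi :: "(nat list \<Rightarrow> 'k) \<Rightarrow> (nat \<Rightarrow> nat) \<Rightarrow> 'k" where
  "psi v = (\<Sum>w\<in>perms_ms letters. sc (v w) (dlt (min_rep w)))"

lemma min_rep:
  assumes "w \<in> perms_ms letters"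
  shows "min_rep w \<in> perms N" "block_incr (min_rep w)" "wd (min_rep w) = w"
proof -
  have "\<exists>p. p \<in> perms N \<and> block_incr p \<and> wd p = w" using wd_surj[OF assms] by blast
  from someI_ex[OF this] show "min_rep w \<in> perms N" "block_incr (min_rep w)" "wd (min_rep w) = w" unfolding min_rep_def by auto
qed

lemma psi_add: "psi (x + y) = psi x + psi y"
  unfolding psi_def by (simp add: fun_eq_iff fun_sum_apply sc_def distrib_right sum.distrib)

lemma psi_sc: "psi (sc c x) = sc c (psi x)"
  unfolding psi_def by (simp add: fun_eq_iff fun_sum_apply sc_def sum_distrib_left algebra_simps)

lemma psi_in_hecke: "psi v \<in> hecke N"
  unfolding psi_def hecke_eq
  by (intro fs.subspace_sum[OF subspace_supp_in] fs.subspace_scale[OF subspace_supp_in] dlt_in_supp_in min_rep(1))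

lemma psi_sum: "psi (\<Sum>j\<in>A. f j) = (\<Sum>j\<in>A. psi (f j))"
proof (induction A rule: infinite_finite_induct)
  have "psi 0 = 0" using psi_sc[of 0 0] by simp
  thus "psi (\<Sum>j\<in>{}. f j) = (\<Sum>j\<in>{}. psi (f j))" and "infinite A \<Longrightarrow> psi (\<Sum>j\<in>A. f j) = (\<Sum>j\<in>A. psi (f j))" for A
    by simp_all
qed (simp only: sum.insert psi_add not_False_eq_True)

lemma phi_sum: "phi (\<Sum>j\<in>A. f j) = (\<Sum>j\<in>A. phi (f j))"
proof (induction A rule: infinite_finite_induct)
  have "phi 0 = 0" using phi_sc[of 0 0] by simp
  thus "phi (\<Sum>j\<in>{}. f j) = (\<Sum>j\<in>{}. phi (f j))" and "infinite A \<Longrightarrow> phi (\<Sum>j\<in>A. f j) = (\<Sum>j\<in>A. phi (f j))" for A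
    by simp_all
qed (simp only: sum.insert phi_add not_False_eq_True)

lemma psi_dlt: "w \<in> perms_ms letters \<Longrightarrow> psi (dlt w) = dlt (min_rep w)"
proof -
  assume w: "w \<in> perms_ms letters"
  have "psi (dlt w) = (\<Sum>v\<in>perms_ms letters. if v = w then dlt (min_rep w) else 0)"
    unfolding psi_def by (rule sum.cong) (auto simp: dlt_def)
  thus ?thesis using w by simp
qed

lemma phi_dlt: "p \<in> perms N \<Longrightarrow> phi (dlt p) = sc (cf p) (dlt (wd p))"
proof -
  assume p: "p \<in> perms N"
  have "phi (dlt p) = (\<Sum>v\<in>perms N. if v = p then sc (cf p) (dlt (wd p)) else 0)"
    unfolding phi_def by (rule sum.cong) (auto simp: dlt_def)
  thus ?thesis using p finite_perms by simp
qed

lemma phi_psi: "v \<in> XL letters \<Longrightarrow> phi (psi v) = v"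
proof -
  assume v: "v \<in> XL letters"
  have "phi (psi v) = (\<Sum>w\<in>perms_ms letters. sc (v w) (dlt w))"
    unfolding psi_def phi_sum phi_sc
    by (rule sum.cong[OF refl]) (simp add: phi_dlt min_rep cf_block_incr)
  thus ?thesis using supp_in_expand[OF _ v] by simp
qed

lemma psi_phi: "x \<in> hecke N \<Longrightarrow> x - psi (phi x) \<in> ind_ker"
proof -
  assume x: "x \<in> hecke N"
  have x': "x = (\<Sum>p\<in>perms N. sc (x p) (dlt p))" using supp_in_expand[OF finite_perms] x by (simp add: hecke_eq)
  have "psi (phi x) = (\<Sum>p\<in>perms N. sc (x p) (sc (cf p) (dlt (min_rep (wd p)))))"
    unfolding phi_def psi_sum psi_sc
    by (rule sum.cong[OF refl]) (simp add: psi_dlt wd_perms mult.commute)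
  from arg_cong2[where f = "(-)", OF x' this]
  have "x - psi (phi x) = (\<Sum>p\<in>perms N. sc (x p) (dlt p - sc (cf p) (dlt (min_rep (wd p)))))"
    by (simp only: sum_subtractf fs.scale_right_diff_distrib)
  moreover have "dlt p - sc (cf p) (dlt (min_rep (wd p))) \<in> ind_ker" if p: "p \<in> perms N" for p
  proof -
    obtain p' where p': "p' \<in> perms N" "block_incr p'" "wd p' = wd p" "dlt p - sc (cf p) (dlt p') \<in> ind_ker"
      using reduce_to_block_incr[OF p] by blast
    have "p' = min_rep (wd p)" using block_incr_unique[OF p'(1,2)] min_rep[OF wd_perms[OF p]] p'(3) by simp
    thus ?thesis using p' by simp
  qed
  ultimately show ?thesis unfolding ind_ker_def by (simp only:) (intro fs.span_sum fs.span_scale)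
qed

end

section \<open>Characters of parabolic subalgebras as block data\<close>

definition block_index :: "nat list \<Rightarrow> nat \<Rightarrow> nat" where
  "block_index lam i = card (breaks lam \<inter> {..i})"

lemma block_index_mono: "i \<le> j \<Longrightarrow> block_index lam i \<le> block_index lam j"
  unfolding block_index_def by (intro card_mono) auto

text \<open>With positions counted from 0, a break point is the first position of the next block, so
  the index jumps exactly there.\<close>

lemma block_index_Suc: "block_index lam s = block_index lam (Suc s) \<longleftrightarrow> Suc s \<notin> breaks lam"
proof -
  have "breaks lam \<inter> {..Suc s} = (if Suc s \<in> breaks lam then insert (Suc s) (breaks lam \<inter> {..s}) else breaks lam \<inter> {..s})"
    by (auto simp: atMost_Suc)
  thus ?thesis unfolding block_index_def by auto
qed

lemma par_gens_iff: "s \<in> par_gens N lam \<longleftrightarrow> Suc s < N \<and> block_index lam s = block_index lam (Suc s)"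
  by (simp add: par_gens_def block_index_Suc)

text \<open>Since \<open>q\<close> is nonzero, the quadratic relation makes all values nonzero, and
  the braid relation between neighbours then cancels to an equality.\<close>

lemma one_dim_rep_block_const:
  assumes q: "q \<noteq> 0" and r: "one_dim_rep q N lam chi"
    and s: "s \<in> par_gens N lam" and s': "s' \<in> par_gens N lam" and le: "s \<le> s'"
    and b: "block_index lam s = block_index lam s'"
  shows "chi s = chi s'"
proof -
  have nz: "chi t \<noteq> 0" if "t \<in> par_gens N lam" for t
  proof -
    have "(chi t - q) * (chi t + 1) = 0" using r that unfolding one_dim_rep_def by blast
    thus ?thesis using q by auto
  qed
  have step: "chi t = chi (Suc t)" if "t \<in> par_gens N lam" "Suc t \<in> par_gens N lam" for t
  proof -
    have "chi t * chi (Suc t) * chi t = chi (Suc t) * chi t * chi (Suc t)"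
      using r that unfolding one_dim_rep_def by blast
    thus ?thesis using nz[OF that(1)] nz[OF that(2)] by simp
  qed
  have "chi s = chi t" if "s \<le> t" "t \<le> s'" for t
    using that
  proof (induction t rule: dec_induct)
    case (step t)
    \<comment> \<open>Monotonicity of the block index makes every position between two generators of
      one block a generator.\<close>
    have in_par: "u \<in> par_gens N lam" if u: "s \<le> u" "u \<le> s'" for u
    proof (cases "u = s'")
      case False
      have "block_index lam s \<le> block_index lam u" by (rule block_index_mono[OF u(1)])
      moreover have "block_index lam u \<le> block_index lam (Suc u)" by (rule block_index_mono) simp
      moreover have "block_index lam (Suc u) \<le> block_index lam s'" by (rule block_index_mono) (use u False in simp)
      moreover have "Suc u < N" using u s' by (simp add: par_gens_def)
      ultimately show ?thesis using b by (simp add: par_gens_iff)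
    qed (use s' in simp)
    have "chi t = chi (Suc t)" using step \<open>\<And>t. t \<in> par_gens N lam \<Longrightarrow> Suc t \<in> par_gens N lam \<Longrightarrow> chi t = chi (Suc t)\<close> in_par by simp
    thus ?case using step by simp
  qed simp
  thus ?thesis using le by simp
qed

lemma summand_of_induced_retract:
  fixes q :: "'k::field"
  assumes q: "q \<noteq> 0" and r: "one_dim_rep q N lam chi" and si: "summand_of_induced d q R N M lam chi"
    and M: "fs.subspace M"
  obtains L chl f g where "size L = N"
    "hhom N (Rop d R) M (TX q chl) (XL L) f" "hhom N (TX q chl) (XL L) (Rop d R) M g"
    "\<And>m. m \<in> M \<Longrightarrow> g (f m) = m"
proof -
  let ?bl = "block_index lam"
  \<comment> \<open>The value on a block is read off any of its generators. A block of size one has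
    none; the default \<open>q\<close> satisfies the quadratic relation.\<close>
  define chl where "chl c = (if \<exists>s\<in>par_gens N lam. ?bl s = c then chi (SOME s. s \<in> par_gens N lam \<and> ?bl s = c) else q)" for c
  have chl: "chl (?bl s) = chi s" if "s \<in> par_gens N lam" for s
  proof -
    define t where "t = (SOME t. t \<in> par_gens N lam \<and> ?bl t = ?bl s)"
    have "t \<in> par_gens N lam \<and> ?bl t = ?bl s" unfolding t_def by (rule someI[of _ s]) (use that in simp)
    hence t: "t \<in> par_gens N lam" "?bl t = ?bl s" by blast+
    have "chi t = chi s"
    proof (cases "t \<le> s")
      case True
      show ?thesis by (rule one_dim_rep_block_const[OF q r t(1) that True t(2)])
    next
      case False
      hence "s \<le> t" by simp
      thus ?thesis using one_dim_rep_block_const[OF q r that t(1) _ t(2)[symmetric]] by (simp only:)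
    qed
    moreover have "\<exists>u\<in>par_gens N lam. ?bl u = ?bl s" using that by blast
    ultimately show ?thesis unfolding chl_def t_def by (simp only: if_True)
  qed
  have quad: "(chl c - q) * (chl c + 1) = 0" for c
  proof (cases "\<exists>s\<in>par_gens N lam. ?bl s = c")
    case True
    then obtain s where s: "s \<in> par_gens N lam" "?bl s = c" by blast
    have "(chi s - q) * (chi s + 1) = 0" using r s(1) unfolding one_dim_rep_def by blast
    thus ?thesis using chl[OF s(1)] s(2) by simp
  qed (simp add: chl_def)
  interpret young N q ?bl chl
    by unfold_locales (fact block_index_mono, fact quad)
  have ind_ker: "ind_kernel N q lam chi = ind_ker"
  proof -
    have "(k = (\<lambda>u. hr N q x s u - chi s * x u) \<and> x \<in> hecke N \<and> s \<in> par_gens N lam) \<longleftrightarrow>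
      (k = (\<lambda>u. hr N q x s u - chl (?bl s) * x u) \<and> x \<in> hecke N \<and> Suc s < N \<and> ?bl s = ?bl (Suc s))" for k x s
    proof (cases "s \<in> par_gens N lam")
      case True
      show ?thesis unfolding chl[OF True] par_gens_iff ..
    next
      case False
      thus ?thesis unfolding par_gens_iff by blast
    qed
    thus ?thesis unfolding ind_kernel_def ind_ker_def by (simp only:)
  qed
  obtain f g where
    f: "\<forall>m\<in>M. f m \<in> hecke N" "\<forall>a\<in>M. \<forall>b\<in>M. f (a + b) = f a + f b"
      "\<forall>c. \<forall>a\<in>M. f (sc c a) = sc c (f a)"
      "\<forall>m\<in>M. \<forall>s. Suc s < N \<longrightarrow> f (Rop d R s m) - hl N q s (f m) \<in> ind_ker"
    and g: "\<forall>x\<in>hecke N. g x \<in> M" "\<forall>x\<in>hecke N. \<forall>y\<in>hecke N. g (x + y) = g x + g y"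
      "\<forall>c. \<forall>x\<in>hecke N. g (sc c x) = sc c (g x)" "\<forall>x\<in>ind_ker. g x = 0"
      "\<forall>x\<in>hecke N. \<forall>s. Suc s < N \<longrightarrow> g (hl N q s x) = Rop d R s (g x)"
    and gf: "\<forall>m\<in>M. g (f m) = m"
    using si unfolding summand_of_induced_def ind_ker by (elim exE conjE)
  note f = f[rule_format] and g = g[rule_format] and gf = gf[rule_format]
  have hsub: "fs.subspace (hecke N :: ((nat \<Rightarrow> nat) \<Rightarrow> 'k) set)" unfolding hecke_eq by (rule subspace_supp_in)
  \<comment> \<open>\<open>g\<close> factors through the induced module, so replacing
    \<open>x\<close> by the representative \<open>psi (phi x)\<close> does not affect it.\<close>
  have gpsi: "g (psi (phi x)) = g x" if x: "x \<in> hecke N" for x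
  proof -
    have "x - psi (phi x) \<in> hecke N" using x psi_in_hecke fs.subspace_diff[OF hsub] by blast
    hence "g ((x - psi (phi x)) + psi (phi x)) = g (x - psi (phi x)) + g (psi (phi x))"
      by (rule g(2)[OF _ psi_in_hecke])
    thus ?thesis by (simp only: g(4)[OF psi_phi[OF x]] add_0_left diff_add_cancel)
  qed
  have hl_hecke: "hl N q s x \<in> hecke N" if "x \<in> hecke N" "Suc s < N" for s x
  proof -
    have "hl N q s x u = 0" if "u \<notin> perms N" for u
    proof -
      have "sgen s \<circ> u \<notin> perms N"
        using that sgen_comp_perms(1)[OF \<open>Suc s < N\<close>, of "sgen s \<circ> u"] by (auto simp only: sgen_sgen)
      thus ?thesis using that \<open>x \<in> hecke N\<close> by (simp add: hl_def hecke_def)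
    qed
    thus ?thesis by (simp add: hecke_def)
  qed
  have 1: "hhom N (Rop d R) M (TX q chl) (XL letters) (\<lambda>m. phi (f m))"
    unfolding hhom_def
  proof (intro conjI ballI allI impI)
    fix m i assume m: "m \<in> M" "Suc i < N"
    \<comment> \<open>\<open>f\<close> commutes with the operators only up to the kernel, which
      \<open>phi\<close> annihilates.\<close>
    have "f (Rop d R i m) = (f (Rop d R i m) - hl N q i (f m)) + hl N q i (f m)" by (simp only: diff_add_cancel)
    from arg_cong[where f = phi, OF this]
    have "phi (f (Rop d R i m)) = phi (f (Rop d R i m) - hl N q i (f m)) + phi (hl N q i (f m))"
      by (simp only: phi_add)
    also have "phi (f (Rop d R i m) - hl N q i (f m)) = 0" by (rule phi_ind_ker[OF f(4)[OF m]])
    finally show "phi (f (Rop d R i m)) = TX q chl i (phi (f m))" by (simp only: phi_hl[OF m(2)] add_0_left)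
  qed (simp_all only: f phi_add phi_sc phi_in_XL)
  have 2: "hhom N (TX q chl) (XL letters) (Rop d R) M (\<lambda>v. g (psi v))"
    unfolding hhom_def
  proof (intro conjI ballI allI impI)
    fix v :: "nat list \<Rightarrow> 'k" and i assume v: "v \<in> XL letters" "Suc i < N"
    have "TX q chl i v = phi (hl N q i (psi v))" using phi_hl[OF v(2)] phi_psi[OF v(1)] by simp
    hence "g (psi (TX q chl i v)) = g (hl N q i (psi v))" using gpsi hl_hecke[OF psi_in_hecke v(2)] by simp
    thus "g (psi (TX q chl i v)) = Rop d R i (g (psi v))" using g(5)[OF psi_in_hecke v(2)] by simp
  qed (simp_all only: g psi_in_hecke psi_add psi_sc)
  show ?thesis
    by (rule that[OF size_letters 1 2]) (simp only: gpsi f gf)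
qed

section \<open>Invariants and coinvariants\<close>

lemma nth_swp_far: "j \<noteq> i \<Longrightarrow> j \<noteq> Suc i \<Longrightarrow> swp i w ! j = w ! j"
  by (simp add: swp_def)

lemma swp_commute: "Suc i < j \<Longrightarrow> swp i (swp j w) = swp j (swp i w)"
  by (simp add: swp_def list_update_swap[of j i] list_update_swap[of "Suc j" i]
    list_update_swap[of j "Suc i"] list_update_swap[of "Suc j" "Suc i"])

lemma lex_lessI: "x < y \<Longrightarrow> length m = length n \<Longrightarrow> (l @ x # m, l @ y # n) \<in> lex less_than"
  by (auto simp: lex_conv)

section \<open>Reduced words for rearrangements of a multiset\<close>

definition desc :: "nat \<Rightarrow> nat list \<Rightarrow> bool" where
  "desc s w \<longleftrightarrow> Suc s < length w \<and> w ! Suc s < w ! s"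

definition fdesc :: "nat list \<Rightarrow> nat" where
  "fdesc w = (LEAST s. desc s w)"

lemma fdesc: "\<not> sorted w \<Longrightarrow> desc (fdesc w) w" "desc s w \<Longrightarrow> fdesc w \<le> s"
proof -
  assume "\<not> sorted w"
  hence "\<exists>s. desc s w" by (auto simp: sorted_iff_nth_Suc desc_def not_le)
  thus "desc (fdesc w) w" unfolding fdesc_def by (rule LeastI_ex)
qed (simp add: fdesc_def Least_le)

lemma desc_append: "length s = i \<Longrightarrow> desc i (s @ b # a # t) \<longleftrightarrow> a < b"
  by (simp add: desc_def nth_append)

lemma desc_swp_lex: "desc s w \<Longrightarrow> (swp s w, w) \<in> lex less_than"
proof -
  assume d: "desc s w"
  obtain l b a t where w: "w = l @ b # a # t" "length l = s" using d split_at_adjacent unfolding desc_def by metis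
  have "a < b" using d w desc_append by simp
  thus ?thesis unfolding w(1) swp_append[OF w(2)] lex_conv by auto
qed

lemma desc_not_sorted: "desc s w \<Longrightarrow> \<not> sorted w"
  by (auto simp: desc_def sorted_iff_nth_Suc not_le)

text \<open>Always taking the first descent selects one reduced word;
  \<open>reduced_word_vec_desc\<close> shows that any descent could have been taken.\<close>

function reduced_word_vec :: "(nat \<Rightarrow> 'v \<Rightarrow> 'v) \<Rightarrow> 'v \<Rightarrow> nat list \<Rightarrow> 'v" where
  "reduced_word_vec T x0 w = (if sorted w then x0 else T (fdesc w) (reduced_word_vec T x0 (swp (fdesc w) w)))"
  by pat_completeness auto
termination
  by (relation "inv_image (lex less_than) (\<lambda>(T, x0, w). w)")
    (auto intro!: wf_inv_image wf_lex desc_swp_lex fdesc simp: in_inv_image)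

declare reduced_word_vec.simps [simp del]

text \<open>Matsumoto's theorem for multiset permutations: the vector obtained from \<open>x0\<close> along a reduced word for \<open>w\<close> does not
  depend on that word. \<open>E\<close> is multiplication by the scalar through which the stabiliser of the sorted word acts on \<open>x0\<close>.\<close>
locale hecke_ops =
  fixes T :: "nat \<Rightarrow> 'v \<Rightarrow> 'v" and x0 :: 'v and E :: "'v \<Rightarrow> 'v" and L :: "nat multiset"
  assumes comm: "Suc i < j \<Longrightarrow> T i (T j x) = T j (T i x)"
    and braid: "T i (T (Suc i) (T i x)) = T (Suc i) (T i (T (Suc i) x))"
    and TE: "T i (E x) = E (T i x)"
    and x0E: "Suc i < size L \<Longrightarrow> slm L ! i = slm L ! Suc i \<Longrightarrow> T i x0 = E x0"
begin

lemma reduced_word_vec_fdesc: "\<not> sorted w \<Longrightarrow> reduced_word_vec T x0 w = T (fdesc w) (reduced_word_vec T x0 (swp (fdesc w) w))"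
  by (simp add: reduced_word_vec.simps[of T x0 w])

lemma desc_swp_far: "Suc i < j \<or> Suc j < i \<Longrightarrow> desc j (swp i w) \<longleftrightarrow> desc j w"
  by (auto simp: desc_def nth_swp_far)

text \<open>Two distant descents commute. Two adjacent descents \<open>c b a\<close> both lead down
  to \<open>a b c\<close>, along reduced words that differ by a braid relation.\<close>

lemma reduced_word_vec_desc: "desc s w \<Longrightarrow> reduced_word_vec T x0 w = T s (reduced_word_vec T x0 (swp s w))"
proof (induction w arbitrary: s rule: wf_induct[OF wf_lex[OF wf_less_than]])
  case (1 w)
  have IH: "reduced_word_vec T x0 v = T r (reduced_word_vec T x0 (swp r v))" if "(v, w) \<in> lex less_than" "desc r v" for v r
    using 1(1) that by blast
  let ?V = "reduced_word_vec T x0" and ?s = "fdesc w"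
  have ns: "\<not> sorted w" using 1(2) by (rule desc_not_sorted)
  note d = fdesc(1)[OF ns] and le = fdesc(2)[OF 1(2)]
  have Vw: "?V w = T ?s (?V (swp ?s w))" by (rule reduced_word_vec_fdesc[OF ns])
  consider "s = ?s" | "Suc ?s < s" | "s = Suc ?s" using le by linarith
  thus ?case
  proof cases
    case 2
    have "?V (swp ?s w) = T s (?V (swp s (swp ?s w)))"
      by (rule IH[OF desc_swp_lex[OF d]]) (use 1(2) 2 desc_swp_far in blast)
    moreover have "?V (swp s w) = T ?s (?V (swp ?s (swp s w)))"
      by (rule IH[OF desc_swp_lex[OF 1(2)]]) (use d 2 desc_swp_far in blast)
    ultimately show ?thesis unfolding Vw swp_commute[OF 2] by (simp add: comm[OF 2])
  next
    case 3
    obtain l c b m where w0: "w = l @ c # b # m" "length l = ?s"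
      using d split_at_adjacent unfolding desc_def by metis
    have "m \<noteq> []" using 1(2) w0 3 by (auto simp: desc_def)
    then obtain a t where w: "w = l @ c # b # a # t" using w0 by (cases m) auto
    have cb: "b < c" using d w w0(2) desc_append[of l ?s c b "a # t"] by simp
    have ba: "a < b" using 1(2) w w0(2) 3 desc_append[of "l @ [c]" s b a t] by simp
    have sw: "swp ?s (l @ x # y # z # t) = l @ y # x # z # t" "swp s (l @ x # y # z # t) = l @ x # z # y # t" for x y z
      using w0(2) 3 swp_append[of l ?s x y "z # t"] swp_append[of "l @ [x]" s y z t] by simp_all
    have ds: "desc ?s (l @ x # y # z # t) \<longleftrightarrow> y < x" "desc s (l @ x # y # z # t) \<longleftrightarrow> z < y" for x y z
      using w0(2) 3 desc_append[of l ?s x y "z # t"] desc_append[of "l @ [x]" s y z t] by simp_all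
    have lx: "(l @ x # y # z # t, w) \<in> lex less_than" if "x < c \<or> (x = c \<and> y < b)" for x y z
    proof (cases "x < c")
      case True
      thus ?thesis unfolding w by (intro lex_lessI) auto
    next
      case False
      hence "y < b" "x = c" using that by auto
      thus ?thesis unfolding w using lex_lessI[of y b "z # t" "a # t" "l @ [c]"] by simp
    qed
    have e1: "?V (swp ?s w) = T s (T ?s (?V (l @ a # b # c # t)))"
    proof -
      have "?V (l @ b # c # a # t) = T s (?V (l @ b # a # c # t))"
        using IH[of "l @ b # c # a # t" s] lx ds sw cb ba by simp
      also have "?V (l @ b # a # c # t) = T ?s (?V (l @ a # b # c # t))"
        using IH[of "l @ b # a # c # t" ?s] lx ds sw cb ba by simp
      finally show ?thesis using w sw by simp
    qed
    have e2: "?V (swp s w) = T ?s (T s (?V (l @ a # b # c # t)))"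
    proof -
      have "?V (l @ c # a # b # t) = T ?s (?V (l @ a # c # b # t))"
        using IH[of "l @ c # a # b # t" ?s] lx ds sw cb ba by simp
      also have "?V (l @ a # c # b # t) = T s (?V (l @ a # b # c # t))"
        using IH[of "l @ a # c # b # t" s] lx ds sw cb ba by simp
      finally show ?thesis using w sw by simp
    qed
    show ?thesis unfolding Vw e1 e2 using braid[of ?s] 3 by simp
  qed (use Vw in simp)
qed

text \<open>An equal pair is a reflection stabilising the word. Moved along the reduced word it ends
  as a reflection stabilising the sorted word, where \<open>x0E\<close> applies.\<close>

lemma reduced_word_vec_equal: "mset w = L \<Longrightarrow> Suc s < length w \<Longrightarrow> w ! s = w ! Suc s \<Longrightarrow> T s (reduced_word_vec T x0 w) = E (reduced_word_vec T x0 w)"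
proof (induction w arbitrary: s rule: wf_induct[OF wf_lex[OF wf_less_than]])
  case (1 w)
  let ?V = "reduced_word_vec T x0" and ?r = "fdesc w"
  show ?case
  proof (cases "sorted w")
    case True
    have "slm L = w" using 1(2) True by (metis sorted_list_of_multiset_mset sorted_sort_id)
    moreover have "size L = length w" using 1(2) by auto
    ultimately show ?thesis using x0E[of s] 1(3,4) True by (simp add: reduced_word_vec.simps[of T x0 w])
  next
    case False
    note d = fdesc(1)[OF False]
    have len: "Suc ?r < length w" using d by (simp add: desc_def)
    have IH: "T i (?V v) = E (?V v)" if "(v, w) \<in> lex less_than" "mset v = L" "Suc i < length v" "v ! i = v ! Suc i" for v i
      using 1(1) that by blast
    have Vw: "?V w = T ?r (?V (swp ?r w))" by (rule reduced_word_vec_fdesc[OF False])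
    have m: "mset (swp ?r w) = L" using 1(2) mset_swp[OF len] by simp
    have "?r \<noteq> s" using d 1(4) by (auto simp: desc_def)
    then consider "Suc ?r < s" | "Suc s < ?r" | "s = Suc ?r" | "?r = Suc s" by linarith
    thus ?thesis
    proof cases
      case 1
      have "T s (?V (swp ?r w)) = E (?V (swp ?r w))"
        by (rule IH[OF desc_swp_lex[OF d] m]) (use 1 \<open>Suc s < length w\<close> \<open>w ! s = w ! Suc s\<close> in \<open>simp_all add: nth_swp_far\<close>)
      thus ?thesis unfolding Vw by (simp only: TE comm[OF 1, symmetric])
    next
      case 2
      have "T s (?V (swp ?r w)) = E (?V (swp ?r w))"
        by (rule IH[OF desc_swp_lex[OF d] m]) (use 2 \<open>Suc s < length w\<close> \<open>w ! s = w ! Suc s\<close> in \<open>simp_all add: nth_swp_far\<close>)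
      thus ?thesis unfolding Vw by (simp only: TE comm[OF 2])
    next
      case 3
      \<comment> \<open>The descent touches the equal pair: \<open>b a a\<close> is sorted in two
        steps to \<open>a a b\<close>, and the braid relation turns \<open>T s\<close> into
        \<open>T ?r\<close> on the shifted pair. The other overlap \<open>b b a\<close> is
        symmetric.\<close>
      obtain l b n where w0: "w = l @ b # n" "length l = ?r" by (metis Suc_lessD id_take_nth_drop len length_take min.absorb4)
      obtain a x t where n: "n = a # x # t"
        using w0 3 1(3) by (cases n rule: remdups_adj.cases) auto
      have xa: "x = a" using 1(4) w0 n 3 by (simp add: nth_append)
      have w: "w = l @ b # a # a # t" using w0 n xa by simp
      have ab: "a < b" using d w w0(2) desc_append[of l ?r b a "a # t"] by simp
      have sw: "swp ?r w = l @ a # b # a # t" using arg_cong[where f = "swp ?r", OF w] swp_append[OF w0(2), of b a "a # t"] by (rule trans)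
      have "desc s (l @ a # b # a # t)" using w0(2) 3 ab desc_append[of "l @ [a]" s b a t] by simp
      hence "?V (l @ a # b # a # t) = T s (?V (swp s (l @ a # b # a # t)))" by (rule reduced_word_vec_desc)
      also have "swp s (l @ a # b # a # t) = l @ a # a # b # t" using w0(2) 3 swp_append[of "l @ [a]" s b a t] by simp
      finally have V: "?V w = T ?r (T s (?V (l @ a # a # b # t)))" unfolding Vw sw by simp
      have "T ?r (?V (l @ a # a # b # t)) = E (?V (l @ a # a # b # t))"
      proof (rule IH)
        show "(l @ a # a # b # t, w) \<in> lex less_than" unfolding w lex_conv using ab by auto
        show "mset (l @ a # a # b # t) = L" using 1(2) w by auto
      qed (use w0(2) in \<open>simp_all add: nth_append\<close>)
      thus ?thesis unfolding V 3 by (simp only: braid[symmetric] TE)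
    next
      case 4
      obtain l x b a t where w0: "w = l @ x # b # a # t" "length l = s"
      proof -
        obtain l x n where n: "w = l @ x # n" "length l = s" by (metis Suc_lessD id_take_nth_drop 1(3) length_take min.absorb4)
        obtain b a t where "n = b # a # t" using n 4 len by (cases n rule: remdups_adj.cases) auto
        thus ?thesis using that n by simp
      qed
      have xb: "x = b" using 1(4) w0 by (simp add: nth_append)
      have w: "w = l @ b # b # a # t" using w0 xb by simp
      have ab: "a < b" using d w w0(2) 4 desc_append[of "l @ [b]" ?r b a t] by simp
      have sw: "swp ?r w = l @ b # a # b # t" 
        using arg_cong[where f = "swp ?r", OF w] swp_append[of "l @ [b]" ?r b a t] w0(2) 4 by simp
      have "desc s (l @ b # a # b # t)" using w0(2) ab desc_append[of l s b a] by simp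
      hence "?V (l @ b # a # b # t) = T s (?V (swp s (l @ b # a # b # t)))" by (rule reduced_word_vec_desc)
      also have "swp s (l @ b # a # b # t) = l @ a # b # b # t" using w0(2) swp_append[of l s b a] by simp
      finally have V: "?V w = T ?r (T s (?V (l @ a # b # b # t)))" unfolding Vw sw by simp
      have "T ?r (?V (l @ a # b # b # t)) = E (?V (l @ a # b # b # t))"
      proof (rule IH)
        show "(l @ a # b # b # t, w) \<in> lex less_than" unfolding w lex_conv using ab by auto
        show "mset (l @ a # b # b # t) = L" using 1(2) w by auto
      qed (use w0(2) 4 in \<open>simp_all add: nth_append\<close>)
      thus ?thesis unfolding V using braid[of s] 4 by (simp add: TE)
    qed
  qed
qed

end

section \<open>Hecke relations of the operators over a commutative ring\<close>

lemma TX_append2: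
  "length s = i \<Longrightarrow> TX q chi (Suc i) x (s @ c # a # b # t) =
     (if a = b then chi a * x (s @ c # a # b # t) else if a < b then q * x (s @ c # b # a # t)
      else x (s @ c # b # a # t) + (q - 1) * x (s @ c # a # b # t))"
  using TX_append[of "s @ [c]" "Suc i" q chi x a b t] by simp

lemma TX_braid:
  fixes Q :: "'r::comm_ring_1"
  shows "TX Q (\<lambda>_. Q) i (TX Q (\<lambda>_. Q) (Suc i) (TX Q (\<lambda>_. Q) i x)) =
    TX Q (\<lambda>_. Q) (Suc i) (TX Q (\<lambda>_. Q) i (TX Q (\<lambda>_. Q) (Suc i) x))"
proof
  fix w
  show "TX Q (\<lambda>_. Q) i (TX Q (\<lambda>_. Q) (Suc i) (TX Q (\<lambda>_. Q) i x)) w =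
    TX Q (\<lambda>_. Q) (Suc i) (TX Q (\<lambda>_. Q) i (TX Q (\<lambda>_. Q) (Suc i) x)) w"
  proof (cases "Suc (Suc i) < length w")
    case True
    then obtain s a n where n: "w = s @ a # n" "length s = i"
      by (metis Suc_lessD id_take_nth_drop length_take min.absorb4)
    obtain b c t where "n = b # c # t" using n True by (cases n rule: remdups_adj.cases) auto
    hence w: "w = s @ a # b # c # t" using n by simp
    show ?thesis unfolding w using n(2)
      by (cases a b rule: linorder_cases; cases b c rule: linorder_cases; cases a c rule: linorder_cases)
        (simp_all add: TX_append TX_append2 algebra_simps)
  next
    case False
    thus ?thesis by (simp add: TX_def)
  qed
qed

lemma TX_comm:
  fixes Q :: "'r::comm_ring_1"
  assumes ij: "Suc i < j"
  shows "TX Q chi i (TX Q chi j x) = TX Q chi j (TX Q chi i x)"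
proof
  fix w
  show "TX Q chi i (TX Q chi j x) w = TX Q chi j (TX Q chi i x) w"
    using ij by (simp add: TX_def nth_swp_far swp_commute[OF ij] algebra_simps)
qed

lemma TX_quad:
  fixes Q :: "'r::comm_ring_1"
  assumes "Suc i < length w"
  shows "TX Q (\<lambda>_. Q) i (TX Q (\<lambda>_. Q) i x) w = (Q - 1) * TX Q (\<lambda>_. Q) i x w + Q * x w"
proof -
  obtain s a b t where w: "w = s @ a # b # t" "length s = i" using split_at_adjacent[OF assms] .
  show ?thesis unfolding w(1) using w(2)
    by (cases a b rule: linorder_cases) (simp_all add: TX_append algebra_simps)
qed

text \<open>The resulting symmetry under the swap is free of \<open>Q\<close>, so an eigenvector
  condition can be transferred from one parameter to another through it.\<close>

lemma TX_eq_imp_lrule: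
  fixes Q :: "'r::comm_ring_1"
  assumes "\<And>w. Suc i < length w \<Longrightarrow> TX Q (\<lambda>_. Q) i x w = Q * x w"
  shows "lrule 1 {} i x"
  unfolding lrule_iff
proof (intro allI impI)
  fix s t :: "nat list" and a b assume s: "length s = i"
  have "TX Q (\<lambda>_. Q) i x (s @ b # a # t) = Q * x (s @ b # a # t)" using s by (intro assms) simp
  thus "(a < b \<longrightarrow> x (s @ a # b # t) = 1 * x (s @ b # a # t)) \<and> (a = b \<and> a \<in> {} \<longrightarrow> x (s @ a # b # t) = 0)"
    using s by (auto simp: TX_append algebra_simps)
qed

lemma lrule_imp_TX_eq:
  fixes Q :: "'r::comm_ring_1"
  assumes R: "lrule 1 {} i x" and w: "Suc i < length w"
  shows "TX Q (\<lambda>_. Q) i x w = Q * x w"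
proof -
  obtain s a b t where w: "w = s @ a # b # t" "length s = i" using split_at_adjacent[OF w] .
  show ?thesis using w(2) R[unfolded lrule_iff, rule_format, of s a b t] R[unfolded lrule_iff, rule_format, of s b a t]
    unfolding w(1) by (cases a b rule: linorder_cases) (auto simp: TX_append algebra_simps)
qed

lemma kap_one: "kap 1 UNIV v = 1"
  by (induction v) (simp_all add: kc_def)

text \<open>\<open>kap\<close> is here a power of the parameter counting inversions; at
  \<open>0\<close> only the word without inversions remains.\<close>

lemma kap_zero: "kap (0 :: 'r::comm_ring_1) UNIV v = (if sorted v then 1 else 0)"
proof (cases "sorted v")
  case True
  thus ?thesis using kap_sorted[of v UNIV "0 :: 'r"] by (simp add: adm_def)
next
  case False
  then obtain i where i: "desc i v" using fdesc(1) by blast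
  then obtain s b a t where v: "v = s @ b # a # t" "length s = i"
    using split_at_adjacent unfolding desc_def by metis
  have "a < b" using i v desc_append by simp
  thus ?thesis unfolding v(1) using kap_swap[of a b "0 :: 'r" UNIV s t] False v by simp
qed

lemma poly_kap: "poly (kap [:0, 1:] UNIV v) c = kap c UNIV v"
  by (induction v) (simp_all add: kc_def poly_power)

lemma poly_TX: "poly (TX [:0, 1:] (\<lambda>_. [:0, 1:]) i x w) c = TX c (\<lambda>_. c) i (\<lambda>v. poly (x v) c) w"
  by (simp add: TX_def)

lemma TX_smult: "TX Q chi i (\<lambda>w. c * x w) = (\<lambda>w. c * TX Q chi i x w)"
  by (auto simp: TX_def fun_eq_iff algebra_simps)

text \<open>Spans the invariants of the weight \<open>L\<close> when all letters are even.\<close>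

definition all_ones :: "nat multiset \<Rightarrow> nat list \<Rightarrow> 'k::comm_ring_1" where
  "all_ones L = (\<Sum>w\<in>perms_ms L. dlt w)"

lemma all_ones_apply: "all_ones L w = (if mset w = L then 1 else 0)"
proof -
  have "all_ones L w = (\<Sum>v\<in>perms_ms L. if w = v then 1 else 0)" unfolding all_ones_def fun_sum_apply by (simp add: dlt_def)
  also have "\<dots> = (if w \<in> perms_ms L then 1 else 0)" by simp
  finally show ?thesis by (simp add: permutations_of_multiset_def)
qed

lemma all_ones_in_XL: "all_ones L \<in> XL L"
  by (simp add: XL_iff all_ones_apply)

lemma slm_in_perms: "slm L \<in> perms_ms L"
  by (simp add: permutations_of_multiset_def)

lemma sorted_perm_eq_slm: "mset w = L \<Longrightarrow> sorted w \<Longrightarrow> w = slm L"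
  by (metis sorted_list_of_multiset_mset sorted_sort_id)

text \<open>Two polynomials in an indeterminate \<open>Q\<close> are compared whose products with the Poincare polynomial
  \<open>\<Sum>w. Q^inv(w)\<close> agree; the latter takes the value 1 at \<open>Q = 0\<close>, so it can be cancelled before putting \<open>Q = q\<close>, where
  it may vanish.\<close>
lemma endo_inv_coinv_scalar:
  fixes q :: "'k::field"
  assumes e: "hhom N (TX q (\<lambda>_. q)) (XL L) (TX q (\<lambda>_. q)) (XL L) e" and N: "size L = N" and w: "mset w = L"
  shows "e (all_ones L) w = (\<Sum>v\<in>perms_ms L. kap q UNIV v * e (dlt (slm L)) v)"
proof -
  define Q :: "'k poly" where "Q = [:0, 1:]"
  let ?T = "TX q (\<lambda>_. q)" and ?TQ = "TX Q (\<lambda>_. Q)" and ?P = "perms_ms L"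
  define x0 where "x0 = e (dlt (slm L))"
  \<comment> \<open>Constant polynomials: the image of the generator is kept and only the operators
    are deformed.\<close>
  define x0Q where "x0Q = (\<lambda>w. [:x0 w:])"
  define V where "V = reduced_word_vec ?TQ x0Q"
  note eh = hhomD[OF e subspace_supp_in]
  have dX: "(dlt w :: nat list \<Rightarrow> 'k) \<in> XL L" if "mset w = L" for w
    using that by (intro dlt_in_supp_in) (simp add: permutations_of_multiset_def)
  have x0X: "x0 \<in> XL L" unfolding x0_def using eh(1) dX by simp
  have x0_supp: "x0Q v = 0" if "mset v \<noteq> L" for v using that x0X by (simp add: x0Q_def XL_iff)
  have TQ0: "?TQ i x v = 0" if "\<And>v. mset v \<noteq> L \<Longrightarrow> x v = 0" "mset v \<noteq> L" for i x v
    using that by (simp add: TX_def mset_swp)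
  interpret H: hecke_ops ?TQ x0Q "\<lambda>x w. Q * x w" L
  proof
    fix i assume i: "Suc i < size L" "slm L ! i = slm L ! Suc i"
    have len: "Suc i < length (slm L)" using i by (metis mset_sorted_list_of_multiset size_mset)
    have "?T i (dlt (slm L)) = (\<lambda>w. q * dlt (slm L) w)" using TX_dlt(1)[OF len _ i(2)] i(2) by simp
    hence "e (?T i (dlt (slm L))) = sc q x0" unfolding x0_def using eh(3)[OF dX, of "slm L" q] by (simp add: sc_def)
    hence "?T i x0 = sc q x0" unfolding x0_def using eh(4)[OF dX, of "slm L" i] i N by simp
    hence "lrule 1 {} i x0" by (intro TX_eq_imp_lrule[where Q = q]) (simp add: sc_def)
    \<comment> \<open>The condition found at \<open>q\<close> does not mention \<open>q\<close>, so
      the constant lift satisfies it and is an eigenvector for \<open>Q\<close>.\<close>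
    hence R: "lrule 1 {} i x0Q" by (auto simp: lrule_iff x0Q_def)
    show "?TQ i x0Q = (\<lambda>w. Q * x0Q w)"
    proof
      fix v
      show "?TQ i x0Q v = Q * x0Q v"
      proof (cases "mset v = L")
        case True
        hence "Suc i < length v" using i by auto
        thus ?thesis by (rule lrule_imp_TX_eq[OF R])
      qed (simp add: TQ0 x0_supp)
    qed
  qed (rule TX_comm, assumption, rule TX_braid, rule TX_smult)
  have V_supp: "V u v = 0" if "mset v \<noteq> L" for u v
    using that
  proof (induction u arbitrary: v rule: bubble_induct)
    case (sorted l)
    thus ?case by (simp add: V_def reduced_word_vec.simps x0_supp)
  next
    case (swap s a b t)
    have "V (s @ b # a # t) = ?TQ (length s) (V (s @ a # b # t))"
      unfolding V_def using H.reduced_word_vec_desc[of "length s" "s @ b # a # t"] swap(1) by (simp add: desc_append swp_append)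
    thus ?case using TQ0[OF swap(2) swap(3)] by simp
  qed
  have V_up: "V (swp i u) = ?TQ i (V u)" if "Suc i < length u" "u ! i < u ! Suc i" for i u
    unfolding V_def using H.reduced_word_vec_desc[of i "swp i u"] that by (simp add: desc_def nth_swp swp_swp)
  have V_eq: "?TQ i (V u) = (\<lambda>w. Q * V u w)" if "mset u = L" "Suc i < length u" "u ! i = u ! Suc i" for i u
    unfolding V_def using H.reduced_word_vec_equal[OF that] .
  have V_swap: "V (s @ b # a # t) = ?TQ (length s) (V (s @ a # b # t))" if "a < b" for s a b t
    using V_up[of "length s" "s @ a # b # t"] that by (simp add: swp_append nth_append)
  \<comment> \<open>Since \<open>e\<close> commutes with the operators, the deformed vectors
    specialise at \<open>Q = q\<close> to the images of the basis words.\<close>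
  have V_eval: "poly (V u v) q = e (dlt u) v" if "mset u = L" for u v
    using that
  proof (induction u arbitrary: v rule: bubble_induct)
    case (sorted l)
    thus ?case using sorted_perm_eq_slm[of l L] by (simp add: V_def reduced_word_vec.simps x0Q_def x0_def)
  next
    case (swap s a b t)
    let ?u = "s @ a # b # t"
    have u: "mset ?u = L" using swap(3) by (simp add: add_mset_commute)
    have i: "Suc (length s) < N" using u N by auto
    have "?T (length s) (dlt ?u) = dlt (s @ b # a # t)"
      using TX_dlt(2)[of "length s" ?u q "\<lambda>_. q"] swap(1) by (simp add: nth_append swp_append)
    hence "e (dlt (s @ b # a # t)) = ?T (length s) (e (dlt ?u))" using eh(4)[OF dX[OF u] i] by simp
    moreover have "(\<lambda>v. poly (V ?u v) q) = e (dlt ?u)" using swap(2)[OF u] by (simp add: fun_eq_iff)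
    ultimately show ?case unfolding V_swap[OF swap(1)] Q_def poly_TX by simp
  qed
  \<comment> \<open>The lift of the image of \<open>all_ones\<close>. Its invariance, proved next,
    makes it constant on the weight.\<close>
  define U where "U = (\<Sum>u\<in>?P. V u)"
  have U_supp: "U v = 0" if "mset v \<noteq> L" for v unfolding U_def fun_sum_apply by (simp add: V_supp that)
  have TU: "?TQ i U v = Q * U v" if i: "Suc i < N" and v: "Suc i < length v" for i v
  proof -
    have len: "Suc i < length u" "mset u = L" if "u \<in> ?P" for u
      using that i N by (auto simp: permutations_of_multiset_def)
    have "?TQ i U v = (\<Sum>u\<in>?P. ?TQ i (V u) v)" unfolding U_def TX_sum fun_sum_apply ..
    also have "\<dots> = (\<Sum>u | u \<in> ?P \<and> u ! i < u ! Suc i. ?TQ i (V u) v + ?TQ i (V (swp i u)) v)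
        + (\<Sum>u | u \<in> ?P \<and> u ! i = u ! Suc i. ?TQ i (V u) v)"
      using i N by (intro sum_swap_split) simp
    also have "\<dots> = (\<Sum>u | u \<in> ?P \<and> u ! i < u ! Suc i. Q * (V u v + V (swp i u) v))
        + (\<Sum>u | u \<in> ?P \<and> u ! i = u ! Suc i. Q * V u v)"
    proof (intro arg_cong2[where f = "(+)"] sum.cong refl)
      fix u assume "u \<in> {u. u \<in> ?P \<and> u ! i < u ! Suc i}"
      hence "V (swp i u) = ?TQ i (V u)" using V_up len by blast
      thus "?TQ i (V u) v + ?TQ i (V (swp i u)) v = Q * (V u v + V (swp i u) v)"
        using TX_quad[OF v, of Q "V u"] by (simp add: algebra_simps)
    next
      fix u assume "u \<in> {u. u \<in> ?P \<and> u ! i = u ! Suc i}"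
      thus "?TQ i (V u) v = Q * V u v" using V_eq len by simp
    qed
    also have "\<dots> = Q * ((\<Sum>u | u \<in> ?P \<and> u ! i < u ! Suc i. V u v + V (swp i u) v)
        + (\<Sum>u | u \<in> ?P \<and> u ! i = u ! Suc i. V u v))"
      by (simp add: sum_distrib_left distrib_left)
    also have "\<dots> = Q * (\<Sum>u\<in>?P. V u v)"
      using i N sum_swap_split[of i L "\<lambda>u. V u v"] by simp
    finally show ?thesis unfolding U_def fun_sum_apply .
  qed
  define u0 where "u0 = U (rev (slm L))"
  have Uc: "U v = u0" if v: "mset v = L" for v
  proof -
    have "lrule 1 {} i U" if "Suc i < N" for i using TU[OF that] by (rule TX_eq_imp_lrule)
    moreover have "length v = N" using v N by auto
    ultimately have "U v = kap 1 (- {}) (rev v) * U (rev (slm (mset v)))" by (rule lrule_sort)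
    thus ?thesis unfolding v u0_def by (simp add: kap_one)
  qed
  \<comment> \<open>\<open>om\<close> is the coinvariant functional over polynomials and
    \<open>D\<close> the Poincare polynomial.\<close>
  define om where "om x = (\<Sum>v\<in>?P. kap Q UNIV v * x v)" for x
  define D where "D = (\<Sum>v\<in>?P. kap Q UNIV v)"
  have om_T: "om (?TQ i x) = Q * om x" if i: "Suc i < N" for i x
  proof -
    have "(\<Sum>v\<in>?P. kap Q UNIV v * (?TQ i x v - Q * x v)) = 0"
      using lrule_TX_minus[of Q "\<lambda>_. Q" i x] i N by (intro sum_lrule[of Q UNIV i]) auto
    thus ?thesis unfolding om_def by (simp add: algebra_simps sum_subtractf sum_distrib_left)
  qed
  have om_V: "om (V u) = kap Q UNIV u * om x0Q" if "mset u = L" for u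
    using that
  proof (induction u rule: bubble_induct)
    case (sorted l)
    thus ?case using kap_sorted[OF sorted(1), of UNIV Q] by (simp add: V_def reduced_word_vec.simps adm_def)
  next
    case (swap s a b t)
    have u: "mset (s @ a # b # t) = L" using swap(3) by (simp add: add_mset_commute)
    have "Suc (length s) < N" using u N by auto
    thus ?case unfolding V_swap[OF swap(1)] kap_swap[OF swap(1)] using om_T swap(2)[OF u] by simp
  qed
  \<comment> \<open>\<open>om U\<close> is computed twice, summand by summand and from the constancy
    of \<open>U\<close>; both results carry the factor \<open>D\<close>.\<close>
  have "om U = (\<Sum>u\<in>?P. om (V u))"
    unfolding U_def om_def fun_sum_apply by (simp add: sum_distrib_left) (rule sum.swap)
  also have "\<dots> = D * om x0Q"
    unfolding D_def sum_distrib_right by (rule sum.cong) (simp_all add: om_V permutations_of_multiset_def)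
  finally have "om U = D * om x0Q" .
  moreover have "om U = D * u0"
    unfolding om_def D_def sum_distrib_right by (rule sum.cong) (simp_all add: Uc permutations_of_multiset_def)
  \<comment> \<open>The constant term of \<open>D\<close> is 1, contributed by the sorted word
    alone; polynomials over a field have no zero divisors.\<close>
  moreover have "D \<noteq> 0"
  proof
    assume "D = 0"
    hence "poly D 0 = 0" by simp
    moreover have "poly D 0 = (\<Sum>v\<in>?P. if v = slm L then 1 else 0)"
      unfolding D_def Q_def poly_sum poly_kap kap_zero
      by (rule sum.cong) (auto simp: permutations_of_multiset_def simp: sorted_sort_id dest: sorted_perm_eq_slm)
    ultimately show False using slm_in_perms[of L] by simp
  qed
  ultimately have u0: "u0 = om x0Q" by simp
  have "e (all_ones L) w = poly (U w) q"
  proof -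
    have "e (\<Sum>u\<in>A. dlt u) = (\<Sum>u\<in>A. e (dlt u)) \<and> (\<Sum>u\<in>A. dlt u :: nat list \<Rightarrow> 'k) \<in> XL L" if "finite A" "A \<subseteq> ?P" for A
      using that
    proof (induction A rule: finite_induct)
      case empty
      show ?case using eh(5) fs.subspace_0[OF subspace_supp_in] by (simp only: sum.empty simp_thms)
    next
      case (insert u A)
      have "(dlt u :: nat list \<Rightarrow> 'k) \<in> XL L" using insert(4) by (intro dX) (auto simp: permutations_of_multiset_def)
      moreover have IH: "e (\<Sum>u\<in>A. dlt u) = (\<Sum>u\<in>A. e (dlt u))" "(\<Sum>u\<in>A. dlt u :: nat list \<Rightarrow> 'k) \<in> XL L"
        using insert by blast+
      ultimately have "e (dlt u + (\<Sum>u\<in>A. dlt u)) = e (dlt u) + (\<Sum>u\<in>A. e (dlt u))"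
        and "dlt u + (\<Sum>u\<in>A. dlt u :: nat list \<Rightarrow> 'k) \<in> XL L"
        using eh(2) fs.subspace_add[OF subspace_supp_in] by (simp_all only:)
      thus ?case unfolding sum.insert[OF insert(1,2)] by (rule conjI)
    qed
    from this[of ?P] have "e (all_ones L) w = (\<Sum>u\<in>?P. e (dlt u)) w" by (simp add: all_ones_def)
    thus ?thesis unfolding U_def fun_sum_apply poly_sum
      by (simp add: permutations_of_multiset_def V_eval)
  qed
  also have "\<dots> = poly (om x0Q) q" using Uc[OF w] u0 by simp
  also have "\<dots> = (\<Sum>v\<in>?P. kap q UNIV v * x0 v)"
    unfolding om_def x0Q_def Q_def poly_sum poly_mult poly_kap by simp
  finally show ?thesis unfolding x0_def .
qed

section \<open>Dimensions for a retract of an induced module\<close>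

lemma hhom_TX_cong:
  assumes "\<And>i x. Suc i < N \<Longrightarrow> x \<in> X \<Longrightarrow> T1 i x = T2 i x"
  shows "hhom N T M T1 X f \<Longrightarrow> hhom N T M T2 X f" "hhom N T1 X T M g \<Longrightarrow> hhom N T2 X T M g"
  unfolding hhom_def using assms by (metis, metis)

text \<open>Invariants and coinvariants of the induced module are lines on which \<open>f\<close>
  after \<open>g\<close> acts by the same scalar \<open>A\<close>. Hence those of \<open>M\<close>
  are both zero (\<open>A = 0\<close>) or both lines.\<close>

lemma dim_inv_coinv_retract_even:
  fixes q :: "'k::field"
  assumes N: "size L = N" and M: "hmod N T M" "fin_dim M"
    and f: "hhom N T M (TX q (\<lambda>_. q)) (XL L) f" and g: "hhom N (TX q (\<lambda>_. q)) (XL L) T M g"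
    and gf: "\<And>m. m \<in> M \<Longrightarrow> g (f m) = m"
  shows "fs.dim (Fsp False T q M N) + fs.dim (Zsp True T q M N 0) = fs.dim M"
proof -
  let ?TX = "TX q (\<lambda>_. q)"
  let ?X = "XL L :: (nat list \<Rightarrow> 'k) set"
  let ?F = "Fsp False T q M N" and ?Z = "Zsp True T q M N 0"
  let ?one = "all_ones L :: nat list \<Rightarrow> 'k"
  define pi where "pi x = (\<Sum>v\<in>perms_ms L. kap q UNIV v * x v)" for x
  note Msub = hmodD(2)[OF M(1)]
  note fh = hhomD[OF f Msub] and gh = hhomD[OF g subspace_supp_in]
  have al: "- al_of True q = q" "Y_of True q (\<lambda>_. q) = UNIV" "al_of False q = 1" "Y_of False q (\<lambda>_. q) = {}"
    by (simp_all add: al_of_def Y_of_def)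
  have pi_pr: "pr (- al_of True q) (Y_of True q (\<lambda>_. q)) L x [] = pi x" for x
    by (simp add: pr_def pi_def al)
  have X0: "Fsp True ?TX q ?X 0 = ?X" by (auto simp: Fsp_def)
  have Zpi: "x \<in> Zsp True ?TX q ?X N 0 \<Longrightarrow> pi x = 0" for x
    using pr_Zsp[of x True q "\<lambda>_. q" L 0 "[]"] unfolding N pi_pr by simp
  have piZ: "x \<in> Zsp True ?TX q ?X N 0" if "x \<in> ?X" "pi x = 0" for x
  proof -
    have "x \<in> Zsp True ?TX q ?X (size L) 0"
      by (rule pr_zero_imp_Zsp) (use that X0 pi_pr in simp_all)
    thus ?thesis by (simp only: N)
  qed
  have oneF: "?one \<in> Fsp False ?TX q ?X N"
  proof -
    have "?one \<in> Fsp False ?TX q ?X (size L)"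
      unfolding Fsp_XL_iff[OF order_refl] al by (auto simp: all_ones_in_XL lrule_iff all_ones_apply)
    thus ?thesis by (simp only: N)
  qed
  have Fone: "x = sc (x (rev (slm L))) ?one" if x: "x \<in> Fsp False ?TX q ?X N" for x
  proof
    fix w
    have "x \<in> Fsp False ?TX q ?X (size L)" using x by (simp only: N)
    hence xX: "x \<in> ?X" and R: "\<And>i. Suc i < size L \<Longrightarrow> lrule 1 {} i x"
      unfolding Fsp_XL_iff[OF order_refl] al by blast+
    show "x w = sc (x (rev (slm L))) ?one w"
    proof (cases "mset w = L")
      case True
      have "length w = size L" using True by auto
      from lrule_sort[OF R this] show ?thesis using True by (auto simp: kap_one sc_def all_ones_apply)
    next
      case False
      thus ?thesis using xX by (auto simp: XL_iff sc_def all_ones_apply)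
    qed
  qed
  let ?v0 = "dlt (slm L) :: nat list \<Rightarrow> 'k"
  have v0: "?v0 \<in> ?X" by (rule dlt_in_supp_in[OF slm_in_perms])
  have pi_v0: "pi ?v0 = 1"
  proof -
    have "pi ?v0 = (\<Sum>v\<in>perms_ms L. if v = slm L then kap q UNIV v else 0)"
      unfolding pi_def by (rule sum.cong) (auto simp: dlt_def)
    also have "\<dots> = kap q UNIV (slm L)" using slm_in_perms[of L] by simp
    also have "\<dots> = 1" by (rule kap_sorted) (auto simp: adm_def)
    finally show ?thesis .
  qed
  have pi_lin: "pi (x - sc c y) = pi x - c * pi y" for x y c
    unfolding pi_def by (simp add: sc_def sum_subtractf sum_distrib_left algebra_simps)
  define e where "e x = f (g x)" for x
  have e: "hhom N ?TX ?X ?TX ?X e"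
    unfolding hhom_def e_def using fh gh by simp
  define A where "A = pi (e ?v0)"
  have eX: "e x \<in> ?X" if "x \<in> ?X" for x using e that unfolding hhom_def by blast
  have e_one: "e ?one = sc A ?one"
  proof
    fix w
    show "e ?one w = sc A ?one w"
    proof (cases "mset w = L")
      case True
      thus ?thesis using endo_inv_coinv_scalar[OF e N True] by (simp add: A_def pi_def sc_def all_ones_apply)
    next
      case False
      thus ?thesis using eX[OF all_ones_in_XL] by (simp add: XL_iff sc_def all_ones_apply)
    qed
  qed
  \<comment> \<open>\<open>e\<close> preserves the kernel of \<open>pi\<close>, so its action on the
    coinvariants is determined by the image of the generator \<open>?v0\<close>.\<close>
  have pi_e: "pi (e x) = pi x * A" if x: "x \<in> ?X" for x
  proof -
    have sX: "sc (pi x) ?v0 \<in> ?X" using v0 by (rule fs.subspace_scale[OF subspace_supp_in])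
    have "x - sc (pi x) ?v0 \<in> ?X" by (rule fs.subspace_diff[OF subspace_supp_in x sX])
    moreover have "pi (x - sc (pi x) ?v0) = 0" unfolding pi_lin pi_v0 by simp
    ultimately have "x - sc (pi x) ?v0 \<in> Zsp True ?TX q ?X N 0" by (rule piZ)
    hence "pi (e (x - sc (pi x) ?v0)) = 0" by (rule Zpi[OF hhom_Zsp[OF e hmod_XL]])
    also have "e (x - sc (pi x) ?v0) = e x - sc (pi x) (e ?v0)"
      using hhomD(6)[OF e subspace_supp_in x sX] hhomD(3)[OF e subspace_supp_in v0] by (simp only:)
    finally show ?thesis unfolding pi_lin A_def by simp
  qed
  have Fg: "?F = range (\<lambda>c. sc c (g ?one))"
  proof (intro equalityI subsetI)
    fix m assume m: "m \<in> ?F"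
    hence mM: "m \<in> M" using Fsp_subset by blast
    have "f m \<in> Fsp False ?TX q ?X N" by (rule hhom_Fsp[OF f M(1) order_refl m])
    from arg_cong[where f = g, OF Fone[OF this]]
    have "m = sc (f m (rev (slm L))) (g ?one)" using gf[OF mM] gh(3)[OF all_ones_in_XL] by (simp only:)
    thus "m \<in> range (\<lambda>c. sc c (g ?one))" by blast
  next
    fix m assume "m \<in> range (\<lambda>c. sc c (g ?one))"
    then obtain c where "m = sc c (g ?one)" by blast
    moreover have "g ?one \<in> ?F" by (rule hhom_Fsp[OF g hmod_XL order_refl oneF])
    ultimately show "m \<in> ?F" using fs.subspace_scale[OF subspace_Fsp[OF hmodD(1)[OF M(1)] Msub]] by blast
  qed
  have ZM: "?Z \<subseteq> M" by (rule Zsp_subset[OF M(1)])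
  have Z_iff: "m \<in> ?Z \<longleftrightarrow> pi (f m) = 0" if m: "m \<in> M" for m
  proof
    assume "m \<in> ?Z"
    thus "pi (f m) = 0" by (rule Zpi[OF hhom_Zsp[OF f M(1)]])
  next
    assume "pi (f m) = 0"
    hence "f m \<in> Zsp True ?TX q ?X N 0" using fh(1)[OF m] piZ by blast
    from hhom_Zsp[OF g hmod_XL this] show "m \<in> ?Z" by (simp only: gf[OF m])
  qed
  show ?thesis
  proof (cases "A = 0")
    case True
    have "g ?one = g (e ?one)" unfolding e_def using gf gh(1)[OF all_ones_in_XL] by simp
    also have "\<dots> = 0" unfolding e_one True fs.scale_zero_left by (rule gh(5))
    finally have "?F = {0}" unfolding Fg by auto
    moreover have "?Z = M"
    proof (intro equalityI subsetI)
      fix m assume m: "m \<in> M"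
      have "pi (f m) = pi (e (f m))" unfolding e_def by (simp only: gf[OF m])
      also have "\<dots> = 0" using pi_e[OF fh(1)[OF m]] True by simp
      finally show "m \<in> ?Z" using Z_iff[OF m] by blast
    qed (use ZM in blast)
    ultimately show ?thesis by simp
  next
    case False
    have g1: "g ?one \<noteq> 0"
    proof
      assume "g ?one = 0"
      hence "e ?one = 0" unfolding e_def using fh(5) by (simp only:)
      from fun_cong[OF this, of "slm L"] show False unfolding e_one using False by (simp add: sc_def all_ones_apply)
    qed
    have dF: "fs.dim ?F = 1" unfolding Fg by (rule dim_line[OF g1])
    \<comment> \<open>As \<open>pi (f ?m0)\<close> is \<open>A\<close>, the image of the generator
      spans a complement of \<open>?Z\<close> in \<open>M\<close>.\<close>
    let ?m0 = "g ?v0"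
    have m0: "?m0 \<in> M" by (rule gh(1)[OF v0])
    have pm0: "pi (f ?m0) = A" unfolding A_def e_def ..
    let ?K = "range (\<lambda>c. sc c ?m0)"
    have Ksp: "?K = fs.span {?m0}" by (rule fs.span_singleton[symmetric])
    have KM: "?K \<subseteq> M" using m0 fs.subspace_scale[OF Msub] by blast
    have pi_sc: "pi (f (sc c ?m0)) = c * A" for c
      using pi_lin[of 0 "- c" "f ?m0"] fh(3)[OF m0, of c] pm0 by (simp add: pi_def fs.scale_minus_left)
    have m0n: "?m0 \<noteq> 0"
    proof
      assume "?m0 = 0"
      hence "f ?m0 = 0" using fh(5) by (simp only:)
      thus False using pm0 False by (simp add: pi_def)
    qed
    have int: "?Z \<inter> ?K = {0}"
    proof (intro equalityI subsetI)
      fix m assume m: "m \<in> ?Z \<inter> ?K"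
      then obtain c where c: "m = sc c ?m0" by blast
      have "pi (f m) = 0" using m ZM Z_iff by blast
      hence "c = 0" using pi_sc[of c] c False by simp
      thus "m \<in> {0}" using c by simp
    qed (use fs.subspace_0[OF subspace_Zsp] fs.span_zero Ksp in auto)
    have "M = sum_sp ?Z ?K"
    proof (intro equalityI subsetI)
      fix m assume m: "m \<in> M"
      let ?c = "pi (f m) / A"
      have cM: "sc ?c ?m0 \<in> M" using KM by blast
      have "pi (f (m - sc ?c ?m0)) = 0"
        using fh(6)[OF m cM] fh(3)[OF m0] pi_lin[of "f m" ?c "f ?m0"] pm0 False by simp
      moreover have "m - sc ?c ?m0 \<in> M" by (rule fs.subspace_diff[OF Msub m cM])
      ultimately have "m - sc ?c ?m0 \<in> ?Z" using Z_iff by blast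
      moreover have "m = (m - sc ?c ?m0) + sc ?c ?m0" by (simp only: diff_add_cancel)
      ultimately show "m \<in> sum_sp ?Z ?K" unfolding sum_sp_def by blast
    next
      fix m assume "m \<in> sum_sp ?Z ?K"
      thus "m \<in> M" unfolding sum_sp_def using ZM KM fs.subspace_add[OF Msub] by blast
    qed
    hence "fs.dim M = fs.dim ?Z + fs.dim ?K"
      using dim_direct_sum[OF subspace_Zsp _ fin_dim_subset[OF M(2) ZM] fin_dim_subset[OF M(2) KM] int]
        fs.subspace_span[of "{?m0}"] unfolding Ksp by simp
    thus ?thesis using dF dim_line[OF m0n] by simp
  qed
qed

text \<open>The character value of a letter is seen only where the letter meets itself. If no odd
  letter is repeated, all letters may be declared even; otherwise invariants and coinvariants both
  vanish.\<close>

lemma dim_inv_coinv_retract: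
  fixes q :: "'k::field"
  assumes N: "size L = N" and M: "hmod N T M" "fin_dim M"
    and f: "hhom N T M (TX q chl) (XL L) f" and g: "hhom N (TX q chl) (XL L) T M g"
    and gf: "\<And>m. m \<in> M \<Longrightarrow> g (f m) = m"
  shows "fs.dim (Fsp False T q M N) + fs.dim (Zsp True T q M N 0) = fs.dim M"
proof (cases "adm {c. chl c = q} L")
  case True
  have "TX q chl i x = TX q (\<lambda>_. q) i x" if x: "x \<in> XL L" for i x
  proof
    fix w
    show "TX q chl i x w = TX q (\<lambda>_. q) i x w"
    proof (cases "Suc i < length w \<and> mset w = L")
      case w: True
      then obtain s a b t where s: "w = s @ a # b # t" "length s = i" using split_at_adjacent by metis
      have "chl a = q" if "a = b"
      proof (rule ccontr)
        assume "chl a \<noteq> q"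
        hence "count L a \<le> 1" using True unfolding adm_def by blast
        thus False using w s(1) that by auto
      qed
      thus ?thesis unfolding s(1) using s(2) by (simp add: TX_append)
    next
      case False
      thus ?thesis using x by (auto simp: TX_def XL_iff mset_swp)
    qed
  qed
  hence c: "\<And>i x. Suc i < N \<Longrightarrow> x \<in> XL L \<Longrightarrow> TX q chl i x = TX q (\<lambda>_. q) i x" by blast
  show ?thesis
    by (rule dim_inv_coinv_retract_even[OF N M hhom_TX_cong(1)[OF c f] hhom_TX_cong(2)[OF c g] gf])
next
  case False
  note Msub = hmodD(2)[OF M(1)]
  note fh = hhomD[OF f Msub] and gh = hhomD[OF g subspace_supp_in]
  have "m = 0" if m: "m \<in> Fsp False T q M N" for m
  proof -
    have mM: "m \<in> M" using m Fsp_subset by blast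
    have "f m \<in> Fsp False (TX q chl) q (XL L) (size L)" unfolding N by (rule hhom_Fsp[OF f M(1) order_refl m])
    hence xX: "f m \<in> XL L" and R: "\<And>i. Suc i < size L \<Longrightarrow> lrule 1 {c. chl c \<noteq> q} i (f m)"
      unfolding Fsp_XL_iff[OF order_refl] by (auto simp: al_of_def Y_of_def)
    have "f m w = 0" for w
    proof (cases "mset w = L")
      case True
      have l: "length w = size L" using True by auto
      have "- {c. chl c \<noteq> q} = {c. chl c = q}" by auto
      hence "kap 1 (- {c. chl c \<noteq> q}) (rev w) = (0 :: 'k)" using False True by (intro kap_not_adm) simp
      thus ?thesis using lrule_sort[OF R l] by simp
    qed (use xX in \<open>simp add: XL_iff\<close>)
    hence "f m = 0" by (simp add: fun_eq_iff)
    thus ?thesis using gf[OF mM] gh(5) by simp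
  qed
  hence "Fsp False T q M N = {0}"
    using fs.subspace_0[OF subspace_Fsp[OF hmodD(1)[OF M(1)] Msub]] by blast
  moreover have "Zsp True T q M N 0 = M"
  proof (intro equalityI subsetI)
    fix m assume m: "m \<in> M"
    have "f m \<in> Zsp True (TX q chl) q (XL L) (size L) 0"
    proof (rule pr_zero_imp_Zsp)
      show "f m \<in> Fsp True (TX q chl) q (XL L) 0" using fh(1)[OF m] by (simp add: Fsp_def)
      fix u :: "nat list" assume "length u = 0"
      thus "pr (- al_of True q) (Y_of True q chl) L (f m) u = 0"
        unfolding pr_def using False
        by (auto simp: Y_of_def permutations_of_multiset_def intro!: sum.neutral kap_not_adm)
    qed simp
    hence "f m \<in> Zsp True (TX q chl) q (XL L) N 0" by (simp only: N)
    from hhom_Zsp[OF g hmod_XL this] show "m \<in> Zsp True T q M N 0" by (simp only: gf[OF m])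
  qed (use Zsp_subset[OF M(1)] in blast)
  ultimately show ?thesis by simp
qed

section \<open>Decomposition of the tensor powers\<close>

text \<open>Unlike exactness, the equality of the dimensions of invariants and coinvariants is not induced by a natural
  isomorphism, so it has to be carried along the decomposition into indecomposables.\<close>
definition exact_balanced :: "nat \<Rightarrow> (nat \<Rightarrow> ('a \<Rightarrow> 'k::field) \<Rightarrow> 'a \<Rightarrow> 'k) \<Rightarrow> 'k \<Rightarrow> ('a \<Rightarrow> 'k) set \<Rightarrow> bool" where
  "exact_balanced N T q M \<longleftrightarrow> (\<forall>im. exact_cx im T q M N) \<and>
     fs.dim (Fsp False T q M N) + fs.dim (Zsp True T q M N 0) = fs.dim M"

lemma direct_sum_projections:
  fixes M1 M2 :: "('a \<Rightarrow> 'k::field) set"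
  assumes M: "hmod N T M1" "hmod N T M2" and int: "M1 \<inter> M2 = {0}"
  obtains p1 p2 where "hhom N T (sum_sp M1 M2) T M1 p1" "hhom N T (sum_sp M1 M2) T M2 p2"
    "\<And>m. m \<in> sum_sp M1 M2 \<Longrightarrow> p1 m + p2 m = m"
proof -
  note s1 = hmodD[OF M(1)] and s2 = hmodD[OF M(2)]
  note l = lin_opsD[OF s1(1)]
  define P where "P m z \<longleftrightarrow> fst z \<in> M1 \<and> snd z \<in> M2 \<and> m = fst z + snd z" for m z
  define p where "p m = (SOME z. P m z)" for m
  have pm: "P m (p m)" if m: "m \<in> sum_sp M1 M2" for m
  proof -
    obtain a b where "a \<in> M1" "b \<in> M2" "m = a + b" using m unfolding sum_sp_def by blast
    hence "P m (a, b)" unfolding P_def by simp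
    thus ?thesis unfolding p_def by (rule someI)
  qed
  have uniq: "a = a' \<and> b = b'" if "a \<in> M1" "b \<in> M2" "a' \<in> M1" "b' \<in> M2" "a + b = a' + b'" for a b a' b'
  proof -
    have e: "a - a' = b' - b" using that(5) by (simp add: algebra_simps)
    have "a - a' \<in> M1" "b' - b \<in> M2" using that s1(2) s2(2) fs.subspace_diff by blast+
    hence "a - a' \<in> M1 \<inter> M2" unfolding e using e by simp
    hence "a - a' = 0" using int by blast
    moreover from this have "b' - b = 0" using e by (simp only:)
    ultimately show ?thesis by (simp only: right_minus_eq)
  qed
  have pI: "fst (p m) = a" "snd (p m) = b" if "a \<in> M1" "b \<in> M2" "m = a + b" for m a b
  proof -
    have "m \<in> sum_sp M1 M2" using that unfolding sum_sp_def by blast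
    from pm[OF this] have "fst (p m) \<in> M1" "snd (p m) \<in> M2" "fst (p m) + snd (p m) = a + b"
      using that unfolding P_def by simp_all
    from uniq[OF this(1,2) that(1,2) this(3)] show "fst (p m) = a" "snd (p m) = b" by simp_all
  qed
  have in1: "fst (p m) \<in> M1" and in2: "snd (p m) \<in> M2" and sm: "m = fst (p m) + snd (p m)"
    if "m \<in> sum_sp M1 M2" for m
    using pm[OF that] unfolding P_def by blast+
  have add: "fst (p (m + m')) = fst (p m) + fst (p m')" "snd (p (m + m')) = snd (p m) + snd (p m')"
    if "m \<in> sum_sp M1 M2" "m' \<in> sum_sp M1 M2" for m m'
  proof -
    have "m + m' = (fst (p m) + fst (p m')) + (snd (p m) + snd (p m'))"
      using arg_cong2[where f = "(+)", OF sm[OF that(1)] sm[OF that(2)]] by (simp only: ac_simps)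
    moreover have "fst (p m) + fst (p m') \<in> M1" "snd (p m) + snd (p m') \<in> M2"
      using in1[OF that(1)] in1[OF that(2)] in2[OF that(1)] in2[OF that(2)] s1(2) s2(2) fs.subspace_add by blast+
    ultimately show "fst (p (m + m')) = fst (p m) + fst (p m')" "snd (p (m + m')) = snd (p m) + snd (p m')"
      using pI by blast+
  qed
  have scl: "fst (p (sc c m)) = sc c (fst (p m))" "snd (p (sc c m)) = sc c (snd (p m))" if "m \<in> sum_sp M1 M2" for m c
  proof -
    have "sc c m = sc c (fst (p m)) + sc c (snd (p m))"
      using arg_cong[where f = "sc c", OF sm[OF that]] by (simp only: fs.scale_right_distrib)
    moreover have "sc c (fst (p m)) \<in> M1" "sc c (snd (p m)) \<in> M2"
      using in1[OF that] in2[OF that] s1(2) s2(2) fs.subspace_scale by blast+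
    ultimately show "fst (p (sc c m)) = sc c (fst (p m))" "snd (p (sc c m)) = sc c (snd (p m))"
      using pI by blast+
  qed
  have eqv: "fst (p (T i m)) = T i (fst (p m))" "snd (p (T i m)) = T i (snd (p m))" if "m \<in> sum_sp M1 M2" "Suc i < N" for m i
  proof -
    have "T i m = T i (fst (p m)) + T i (snd (p m))"
      using arg_cong[where f = "T i", OF sm[OF that(1)]] by (simp only: l(1))
    moreover have "T i (fst (p m)) \<in> M1" "T i (snd (p m)) \<in> M2"
      using in1[OF that(1)] in2[OF that(1)] s1(3)[OF that(2)] s2(3)[OF that(2)] by blast+
    ultimately show "fst (p (T i m)) = T i (fst (p m))" "snd (p (T i m)) = T i (snd (p m))"
      using pI by blast+
  qed
  show ?thesis
  proof (rule that)
    show "hhom N T (sum_sp M1 M2) T M1 (\<lambda>m. fst (p m))"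
      unfolding hhom_def using in1 add(1) scl(1) eqv(1) by blast
    show "hhom N T (sum_sp M1 M2) T M2 (\<lambda>m. snd (p m))"
      unfolding hhom_def using in2 add(2) scl(2) eqv(2) by blast
    show "fst (p m) + snd (p m) = m" if "m \<in> sum_sp M1 M2" for m using sm[OF that] by (simp only:)
  qed
qed

text \<open>Inclusions and projections are module maps, so \<open>Fsp\<close> and \<open>Zsp\<close>
  of the sum split and all three dimensions add.\<close>

lemma exact_balanced_direct_sum:
  fixes M1 M2 :: "('a \<Rightarrow> 'k::field) set"
  assumes M: "hmod N T M1" "hmod N T M2" and int: "M1 \<inter> M2 = {0}" and fin: "fin_dim M1" "fin_dim M2"
    and g: "exact_balanced N T q M1" "exact_balanced N T q M2"
  shows "exact_balanced N T q (sum_sp M1 M2)"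
proof -
  let ?M = "sum_sp M1 M2"
  note s1 = hmodD[OF M(1)] and s2 = hmodD[OF M(2)]
  obtain p1 p2 where p: "hhom N T ?M T M1 p1" "hhom N T ?M T M2 p2" "\<And>m. m \<in> ?M \<Longrightarrow> p1 m + p2 m = m"
    by (rule direct_sum_projections[OF M int]) (rule that; blast)
  have sub: "M1 \<subseteq> ?M" "M2 \<subseteq> ?M"
  proof -
    have "x \<in> ?M" if "x \<in> M1" for x
      using that fs.subspace_0[OF s2(2)] unfolding sum_sp_def by (intro CollectI exI[of _ x] exI[of _ 0]) simp
    moreover have "x \<in> ?M" if "x \<in> M2" for x
      using that fs.subspace_0[OF s1(2)] unfolding sum_sp_def by (intro CollectI exI[of _ 0] exI[of _ x]) simp
    ultimately show "M1 \<subseteq> ?M" "M2 \<subseteq> ?M" by blast+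
  qed
  have Mh: "hmod N T ?M"
    unfolding hmod_def
  proof (intro conjI allI impI ballI)
    fix i m assume i: "Suc i < N" and m: "m \<in> ?M"
    then obtain a b where "a \<in> M1" "b \<in> M2" "m = a + b" unfolding sum_sp_def by blast
    thus "T i m \<in> ?M" using lin_opsD(1)[OF s1(1)] s1(3)[OF i] s2(3)[OF i] unfolding sum_sp_def by blast
  qed (use s1 s2 subspace_sum_sp in blast)+
  have inc: "hhom N T M1 T ?M (\<lambda>x. x)" "hhom N T M2 T ?M (\<lambda>x. x)"
    unfolding hhom_def using sub by (simp_all add: subset_iff)
  have ex: "exact_cx im T q ?M N" for im
    using g unfolding exact_balanced_def
    by (intro exact_cx_retract2[OF Mh M p(1) inc(1) p(2) inc(2) p(3)]) blast+
  have split: "S = sum_sp S1 S2" if "S \<subseteq> ?M" "fs.subspace S" "p1 ` S \<subseteq> S1" "p2 ` S \<subseteq> S2" "S1 \<subseteq> S" "S2 \<subseteq> S" for S S1 S2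
  proof (intro equalityI subsetI)
    fix x assume x: "x \<in> S"
    have "x = p1 x + p2 x" by (rule p(3)[OF subsetD[OF that(1) x], symmetric])
    moreover have "p1 x \<in> S1" "p2 x \<in> S2" using that(3,4) x by blast+
    ultimately show "x \<in> sum_sp S1 S2" unfolding sum_sp_def by (intro CollectI exI conjI)
  next
    fix x assume "x \<in> sum_sp S1 S2"
    then obtain a b where ab: "a \<in> S1" "b \<in> S2" "x = a + b" unfolding sum_sp_def by blast
    thus "x \<in> S" using fs.subspace_add[OF that(2) subsetD[OF that(5) ab(1)] subsetD[OF that(6) ab(2)]] by (simp only:)
  qed
  have dims: "fs.dim S = fs.dim S1 + fs.dim S2"
    if "S = sum_sp S1 S2" "fs.subspace S1" "fs.subspace S2" "S1 \<subseteq> M1" "S2 \<subseteq> M2" for S S1 S2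
  proof -
    have "S1 \<inter> S2 = {0}" using that int fs.subspace_0[of S1] fs.subspace_0[of S2] by blast
    thus ?thesis unfolding that(1)
      using dim_direct_sum[OF that(2,3) fin_dim_subset[OF fin(1) that(4)] fin_dim_subset[OF fin(2) that(5)]] by blast
  qed
  have F: "Fsp False T q ?M N = sum_sp (Fsp False T q M1 N) (Fsp False T q M2 N)"
    using hhom_Fsp[OF p(1) Mh order_refl] hhom_Fsp[OF p(2) Mh order_refl]
      hhom_Fsp[OF inc(1) M(1) order_refl] hhom_Fsp[OF inc(2) M(2) order_refl]
    by (intro split[OF Fsp_subset subspace_Fsp[OF s1(1) hmodD(2)[OF Mh]]]) blast+
  have Z: "Zsp True T q ?M N 0 = sum_sp (Zsp True T q M1 N 0) (Zsp True T q M2 N 0)"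
    using hhom_Zsp[OF p(1) Mh] hhom_Zsp[OF p(2) Mh] hhom_Zsp[OF inc(1) M(1)] hhom_Zsp[OF inc(2) M(2)]
    by (intro split[OF Zsp_subset[OF Mh] subspace_Zsp]) blast+
  have "fs.dim (Fsp False T q ?M N) = fs.dim (Fsp False T q M1 N) + fs.dim (Fsp False T q M2 N)"
    by (rule dims[OF F subspace_Fsp[OF s1(1,2)] subspace_Fsp[OF s1(1) s2(2)] Fsp_subset Fsp_subset])
  moreover have "fs.dim (Zsp True T q ?M N 0) = fs.dim (Zsp True T q M1 N 0) + fs.dim (Zsp True T q M2 N 0)"
    by (rule dims[OF Z subspace_Zsp subspace_Zsp Zsp_subset[OF M(1)] Zsp_subset[OF M(2)]])
  moreover have "fs.dim ?M = fs.dim M1 + fs.dim M2"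
    by (rule dims[OF refl s1(2) s2(2) order_refl order_refl])
  ultimately show ?thesis using ex g unfolding exact_balanced_def by simp
qed

lemma exact_balanced_zero:
  assumes "lin_ops T"
  shows "exact_balanced N T q {0}"
proof -
  have "Fsp False T q {0} N = {0}"
    using Fsp_subset[of False T q "{0}" N] fs.subspace_0[OF subspace_Fsp[OF assms fs.subspace_single_0]] by blast
  moreover have "Zsp True T q {0} N 0 = {0}"
    using Zsp_subset[OF hmod_zero[OF assms]] fs.subspace_0[OF subspace_Zsp] by blast
  ultimately show ?thesis using exact_cx_zero[OF assms] by (simp add: exact_balanced_def)
qed

section \<open>Tensor powers and their summands\<close>

lemma words_finite: "finite (words d n)"
proof -
  have "words d n = {xs. set xs \<subseteq> {..<d} \<and> length xs = n}" by (auto simp: words_def)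
  thus ?thesis using finite_lists_length_eq[of "{..<d}" n] by simp
qed

lemma tens_eq: "tens d n = supp_in (words d n)"
  by (simp add: tens_def supp_in_def)

lemma fin_dim_tens: "fin_dim (tens d n)"
  unfolding tens_eq by (rule fin_dim_supp_in[OF words_finite])

lemma subspace_tens: "fs.subspace (tens d n)"
  unfolding tens_eq by (rule subspace_supp_in)

lemma lin_ops_Rop: "lin_ops (Rop d R)"
  by (auto simp: lin_ops_def Rop_def sc_def fun_eq_iff sum.distrib sum_distrib_left algebra_simps)

lemma Rop_in_tens: "x \<in> tens d n \<Longrightarrow> Rop d R i x \<in> tens d n"
  by (auto simp: tens_def Rop_def words_def intro!: sum.neutral)

lemma inv_sub_hmod: "inv_sub d R n M \<Longrightarrow> hmod n (Rop d R) M"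
  by (simp add: inv_sub_def hmod_def lin_ops_Rop)

lemma inv_sub_sum:
  assumes "inv_sub d R n A" "inv_sub d R n B"
  shows "inv_sub d R n (sum_sp A B)"
proof -
  have AB: "fs.subspace A" "fs.subspace B" "A \<subseteq> tens d n" "B \<subseteq> tens d n"
    and st: "\<And>i a. Suc i < n \<Longrightarrow> a \<in> A \<Longrightarrow> Rop d R i a \<in> A" "\<And>i b. Suc i < n \<Longrightarrow> b \<in> B \<Longrightarrow> Rop d R i b \<in> B"
    using assms unfolding inv_sub_def by blast+
  show ?thesis unfolding inv_sub_def
  proof (intro conjI allI impI ballI)
    show "fs.subspace (sum_sp A B)" by (rule subspace_sum_sp[OF AB(1,2)])
    show "sum_sp A B \<subseteq> tens d n"
      unfolding sum_sp_def using AB fs.subspace_add[OF subspace_tens] by blast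
    fix i m assume i: "Suc i < n" and "m \<in> sum_sp A B"
    then obtain a b where "a \<in> A" "b \<in> B" "m = a + b" unfolding sum_sp_def by blast
    thus "Rop d R i m \<in> sum_sp A B"
      using lin_opsD(1)[OF lin_ops_Rop] st(1)[OF i] st(2)[OF i] unfolding sum_sp_def by blast
  qed
qed

lemma inv_sub_tens: "inv_sub d R n (tens d n)"
  by (auto simp: inv_sub_def subspace_tens Rop_in_tens)

lemma sum_sp_commute: "sum_sp A B = sum_sp B A"
proof -
  have "x \<in> sum_sp B A" if "x \<in> sum_sp A B" for x and A B :: "('a \<Rightarrow> 'b) set"
  proof -
    obtain a b where "x = a + b" "a \<in> A" "b \<in> B" using \<open>x \<in> sum_sp A B\<close> unfolding sum_sp_def by blast
    moreover have "a + b = b + a" by (rule add.commute)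
    ultimately show ?thesis unfolding sum_sp_def by blast
  qed
  thus ?thesis by blast
qed

lemma sum_sp_assoc: "sum_sp (sum_sp A B) C = sum_sp A (sum_sp B C)"
proof (intro equalityI subsetI)
  fix x assume "x \<in> sum_sp (sum_sp A B) C"
  then obtain a b c where "a \<in> A" "b \<in> B" "c \<in> C" "x = a + b + c" unfolding sum_sp_def by blast
  thus "x \<in> sum_sp A (sum_sp B C)" unfolding sum_sp_def add.assoc by blast
next
  fix x assume "x \<in> sum_sp A (sum_sp B C)"
  then obtain a b c where "a \<in> A" "b \<in> B" "c \<in> C" "x = a + (b + c)" unfolding sum_sp_def by blast
  thus "x \<in> sum_sp (sum_sp A B) C" unfolding sum_sp_def add.assoc[symmetric] by blast
qed

lemma summand_complement:
  fixes A B C :: "('a \<Rightarrow> 'k::field) set"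
  assumes s: "fs.subspace A" "fs.subspace B" "fs.subspace C"
    and i: "A \<inter> B = {0}" "sum_sp A B \<inter> C = {0}"
  shows "A \<inter> sum_sp B C = {0}"
proof -
  have "x = 0" if xA: "x \<in> A" and x: "x \<in> sum_sp B C" for x
  proof -
    obtain b c where bc: "b \<in> B" "c \<in> C" "x = b + c" using x unfolding sum_sp_def by blast
    have "c = x + (- b)" using bc by simp
    hence "c \<in> sum_sp A B" unfolding sum_sp_def using xA fs.subspace_neg[OF s(2) bc(1)] by blast
    hence "c = 0" using i(2) bc(2) by blast
    hence "x \<in> A \<inter> B" using xA bc by simp
    thus ?thesis using i(1) by blast
  qed
  moreover have "0 \<in> A" "0 \<in> sum_sp B C" using fs.subspace_0 s subspace_sum_sp by blast+
  ultimately show ?thesis by blast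
qed

text \<open>The source condition speaks of summands of the tensor power, so the induction on
  dimension carries a complement \<open>C\<close>; when \<open>M\<close> splits, each part takes the
  other part into its complement.\<close>

lemma exact_balanced_summand:
  fixes q :: "'k::field"
  assumes q: "q \<noteq> 0" and c: "one_dim_source_cond d q R" and N: "N > 0"
  shows "inv_sub d R N M \<Longrightarrow> inv_sub d R N C \<Longrightarrow> M \<inter> C = {0} \<Longrightarrow> tens d N = sum_sp M C \<Longrightarrow> exact_balanced N (Rop d R) q M"
proof (induction "fs.dim M" arbitrary: M C rule: less_induct)
  case less
  have M: "hmod N (Rop d R) M" by (rule inv_sub_hmod[OF less.prems(1)])
  have sub: "fs.subspace M" "M \<subseteq> tens d N" "fs.subspace C" using less.prems(1,2) unfolding inv_sub_def by blast+
  have fin: "fin_dim M" by (rule fin_dim_subset[OF fin_dim_tens sub(2)])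
  show ?case
  proof (cases "indec_summand d R N M")
    case True
    then obtain lam chi where l: "one_dim_rep q N lam chi" "summand_of_induced d q R N M lam chi"
      using c N unfolding one_dim_source_cond_def by blast
    obtain L chl f g where L: "size L = N"
      "hhom N (Rop d R) M (TX q chl) (XL L) f" "hhom N (TX q chl) (XL L) (Rop d R) M g"
      "\<And>m. m \<in> M \<Longrightarrow> g (f m) = m"
      using summand_of_induced_retract[OF q l sub(1)] by blast
    have "L \<noteq> {#}" using L(1) N by auto
    hence "exact_cx im (TX q chl) q (XL L) N" for im using exact_cx_XL[of L im q chl] L(1) by simp
    hence "exact_cx im (Rop d R) q M N" for im
      using exact_cx_retract[OF M hmod_XL L(2,3,4)] by blast
    thus ?thesis unfolding exact_balanced_def using dim_inv_coinv_retract[OF L(1) M fin L(2,3,4)] by blast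
  next
    case False
    have ex: "\<exists>C. inv_sub d R N C \<and> M \<inter> C = {0} \<and> tens d N = {m + x | m x. m \<in> M \<and> x \<in> C}"
      using less.prems unfolding sum_sp_def by blast
    show ?thesis
    proof (cases "M = {0}")
      case True
      thus ?thesis using exact_balanced_zero[OF lin_ops_Rop] by simp
    next
      case ne: False
      obtain M1 M2 where m: "inv_sub d R N M1" "inv_sub d R N M2" "M1 \<inter> M2 = {0}" "M = sum_sp M1 M2"
        and nz: "M1 \<noteq> {0}" "M2 \<noteq> {0}"
        using False ne less.prems(1) ex unfolding indec_summand_def sum_sp_def by blast
      have s: "fs.subspace M1" "fs.subspace M2" "M1 \<subseteq> tens d N" "M2 \<subseteq> tens d N"
        using m unfolding inv_sub_def by blast+
      note f1 = fin_dim_subset[OF fin_dim_tens s(3)] and f2 = fin_dim_subset[OF fin_dim_tens s(4)]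
      have d: "fs.dim M = fs.dim M1 + fs.dim M2" unfolding m(4) by (rule dim_direct_sum[OF s(1,2) f1 f2 m(3)])
      have pos: "fs.dim M1 > 0" "fs.dim M2 > 0" using dim_pos_fin s f1 f2 nz by blast+
      have g1: "exact_balanced N (Rop d R) q M1"
      proof (rule less.hyps[of M1 "sum_sp M2 C"])
        show "fs.dim M1 < fs.dim M" using d pos by simp
        show "M1 \<inter> sum_sp M2 C = {0}"
          by (rule summand_complement[OF s(1,2) sub(3) m(3)]) (use less.prems(3) m(4) in simp)
        show "tens d N = sum_sp M1 (sum_sp M2 C)" using less.prems(4) m(4) by (simp only: sum_sp_assoc)
      qed (use m inv_sub_sum less.prems in blast)+
      have g2: "exact_balanced N (Rop d R) q M2"
      proof (rule less.hyps[of M2 "sum_sp M1 C"])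
        show "fs.dim M2 < fs.dim M" using d pos by simp
        have m': "M2 \<inter> M1 = {0}" "M = sum_sp M2 M1" using m(3,4) sum_sp_commute by blast+
        show "M2 \<inter> sum_sp M1 C = {0}"
          by (rule summand_complement[OF s(2,1) sub(3) m'(1)]) (use less.prems(3) m'(2) in simp)
        show "tens d N = sum_sp M2 (sum_sp M1 C)" using less.prems(4) m'(2) by (simp only: sum_sp_assoc)
      qed (use m inv_sub_sum less.prems in blast)+
      show ?thesis unfolding m(4)
        by (rule exact_balanced_direct_sum[OF inv_sub_hmod[OF m(1)] inv_sub_hmod[OF m(2)] m(3) f1 f2 g1 g2])
    qed
  qed
qed

lemma exact_balanced_tens:
  fixes q :: "'k::field"
  assumes q: "q \<noteq> 0" and c: "one_dim_source_cond d q R" and N: "N > 0"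
  shows "exact_balanced N (Rop d R) q (tens d N)"
proof (rule exact_balanced_summand[OF assms inv_sub_tens])
  have z: "(0 :: nat list \<Rightarrow> 'k) \<in> tens d N" by (rule fs.subspace_0[OF subspace_tens])
  show "inv_sub d R N {0}"
    using hmod_zero[OF lin_ops_Rop, of N d R] z unfolding hmod_def inv_sub_def by blast
  show "tens d N \<inter> {0} = {0 :: nat list \<Rightarrow> 'k}" using z by blast
  show "tens d N = sum_sp (tens d N) {0 :: nat list \<Rightarrow> 'k}" unfolding sum_sp_def by simp
qed

section \<open>Tensor products in coordinates\<close>

lemma words_append: "length u = a \<Longrightarrow> length v = b \<Longrightarrow> u @ v \<in> words d (a + b) \<longleftrightarrow> u \<in> words d a \<and> v \<in> words d b"
  by (auto simp: words_def)

lemma words_take_drop: "w \<in> words d (a + b) \<longleftrightarrow> take a w \<in> words d a \<and> drop a w \<in> words d b"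
proof
  assume "w \<in> words d (a + b)"
  thus "take a w \<in> words d a \<and> drop a w \<in> words d b"
    by (auto simp: words_def dest: in_set_takeD in_set_dropD)
next
  assume t: "take a w \<in> words d a \<and> drop a w \<in> words d b"
  hence "length (take a w) = a" "length (drop a w) = b" by (auto simp: words_def)
  hence "take a w @ drop a w \<in> words d (a + b)" using words_append t by blast
  thus "w \<in> words d (a + b)" by simp
qed

lemma etens_in_tens: "u \<in> tens d a \<Longrightarrow> v \<in> tens d b \<Longrightarrow> etens a u v \<in> tens d (a + b)"
  by (auto simp: tens_def etens_def words_take_drop)

lemma etens_linear:
  "etens a (u + u') v = etens a u v + etens a u' v" "etens a u (v + v') = etens a u v + etens a u v'"
  "etens a (sc c u) v = sc c (etens a u v)" "etens a u (sc c v) = sc c (etens a u v)"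
  "etens a 0 v = 0" "etens a u 0 = 0"
  by (auto simp: etens_def sc_def fun_eq_iff algebra_simps)

lemma subspace_tensor_sp: "fs.subspace (tensor_sp a U U')"
  unfolding tensor_sp_def by (rule fs.subspace_span)

lemma etens_in_tensor_sp: "u \<in> U \<Longrightarrow> v \<in> U' \<Longrightarrow> etens a u v \<in> tensor_sp a U U'"
  unfolding tensor_sp_def by (intro fs.span_base) blast

lemma tensor_sp_minimal:
  assumes "fs.subspace S" "\<And>u v. u \<in> U \<Longrightarrow> v \<in> U' \<Longrightarrow> etens a u v \<in> S"
  shows "tensor_sp a U U' \<subseteq> S"
  unfolding tensor_sp_def using assms by (intro fs.span_minimal) blast+

lemma tensor_sp_mono: "U \<subseteq> U1 \<Longrightarrow> U' \<subseteq> U1' \<Longrightarrow> tensor_sp a U U' \<subseteq> tensor_sp a U1 U1'"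
  by (intro tensor_sp_minimal subspace_tensor_sp etens_in_tensor_sp) auto

lemma right_slice_etens:
  fixes u v :: "nat list \<Rightarrow> 'k::field"
  assumes "u \<in> tens d a" "v \<in> tens d b" "v' \<in> words d b"
  shows "(\<lambda>u'. etens a u v (u' @ v')) = sc (v v') u"
proof
  fix u'
  show "etens a u v (u' @ v') = sc (v v') u u'"
  proof (cases "length u' = a")
    case True
    thus ?thesis by (simp add: etens_def sc_def)
  next
    case False
    hence "u' @ v' \<notin> words d (a + b)" "u' \<notin> words d a" using assms(3) by (auto simp: words_def)
    thus ?thesis using etens_in_tens[OF assms(1,2)] assms(1) by (simp add: tens_def sc_def)
  qed
qed

lemma left_slice_etens:
  "length u' = a \<Longrightarrow> (\<lambda>v'. etens a u v (u' @ v')) = sc (u u') v"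
  by (simp add: etens_def sc_def fun_eq_iff)

lemma tens_slice_expand:
  fixes x :: "nat list \<Rightarrow> 'k::field"
  assumes "x \<in> tens d (a + b)"
  shows "x = (\<Sum>v\<in>words d b. etens a (\<lambda>u. x (u @ v)) (dlt v))"
proof
  fix w
  have "(\<Sum>v\<in>words d b. etens a (\<lambda>u. x (u @ v)) (dlt v)) w = (\<Sum>v\<in>words d b. if v = drop a w then x w else 0)"
    unfolding fun_sum_apply by (rule sum.cong) (auto simp: etens_def dlt_def)
  also have "\<dots> = (if drop a w \<in> words d b then x w else 0)" using words_finite by simp
  also have "\<dots> = x w" using assms by (auto simp: tens_def words_take_drop)
  finally show "x w = (\<Sum>v\<in>words d b. etens a (\<lambda>u. x (u @ v)) (dlt v)) w" by simp
qed

text \<open>Membership in a span becomes a condition on the slices obtained by fixing the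
  tail.\<close>

lemma tensor_sp_right_iff:
  fixes U :: "(nat list \<Rightarrow> 'k::field) set"
  assumes U: "fs.subspace U" "U \<subseteq> tens d a"
  shows "x \<in> tensor_sp a U (tens d b) \<longleftrightarrow> x \<in> tens d (a + b) \<and> (\<forall>v\<in>words d b. (\<lambda>u. x (u @ v)) \<in> U)"
proof
  let ?S = "{x \<in> tens d (a + b). \<forall>v\<in>words d b. (\<lambda>u. x (u @ v)) \<in> U}"
  have "fs.subspace ?S"
  proof (rule fs.subspaceI)
    have "(\<lambda>u. 0) \<in> U" using fs.subspace_0[OF U(1)] by (simp add: zero_fun_def)
    thus "0 \<in> ?S" using fs.subspace_0[OF subspace_tens] by auto
    fix x y c assume x: "x \<in> ?S"
    { assume y: "y \<in> ?S"
      have "(\<lambda>u. x (u @ v)) + (\<lambda>u. y (u @ v)) \<in> U" if "v \<in> words d b" for v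
        using fs.subspace_add[OF U(1)] x y that by blast
      hence "\<forall>v\<in>words d b. (\<lambda>u. (x + y) (u @ v)) \<in> U" by (simp add: plus_fun_def)
      thus "x + y \<in> ?S" using x y fs.subspace_add[OF subspace_tens] by blast }
    have "sc c (\<lambda>u. x (u @ v)) \<in> U" if "v \<in> words d b" for v
      using fs.subspace_scale[OF U(1)] x that by blast
    hence "\<forall>v\<in>words d b. (\<lambda>u. (sc c x) (u @ v)) \<in> U" by (simp add: sc_def)
    thus "sc c x \<in> ?S" using x fs.subspace_scale[OF subspace_tens] by blast
  qed
  hence "tensor_sp a U (tens d b) \<subseteq> ?S"
  proof (rule tensor_sp_minimal)
    fix u v :: "nat list \<Rightarrow> 'k" assume uv: "u \<in> U" "v \<in> tens d b"
    have u: "u \<in> tens d a" using uv U by blast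
    show "etens a u v \<in> ?S"
      using etens_in_tens[OF u uv(2)] right_slice_etens[OF u uv(2)] fs.subspace_scale[OF U(1) uv(1)] by simp
  qed
  thus "x \<in> tensor_sp a U (tens d b) \<Longrightarrow> x \<in> tens d (a + b) \<and> (\<forall>v\<in>words d b. (\<lambda>u. x (u @ v)) \<in> U)" by blast
next
  assume x: "x \<in> tens d (a + b) \<and> (\<forall>v\<in>words d b. (\<lambda>u. x (u @ v)) \<in> U)"
  have "(\<Sum>v\<in>words d b. etens a (\<lambda>u. x (u @ v)) (dlt v)) \<in> tensor_sp a U (tens d b)"
    using x by (intro fs.subspace_sum[OF subspace_tensor_sp] etens_in_tensor_sp) (auto simp: tens_eq dlt_in_supp_in)
  thus "x \<in> tensor_sp a U (tens d b)" using tens_slice_expand[of x d a b] x by simp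
qed

lemma tensor_sp_tens: "tensor_sp a (tens d a) (tens d b) = tens d (a + b)"
proof -
  have "(\<lambda>u. x (u @ v)) \<in> tens d a" if x: "x \<in> tens d (a + b)" and v: "v \<in> words d b" for x :: "nat list \<Rightarrow> 'a" and v
  proof -
    have "x (u @ v) = 0" if u: "u \<notin> words d a" for u
    proof (cases "length u = a")
      case True
      have "length v = b" using v by (simp add: words_def)
      thus ?thesis using x u words_append[OF True, of v b d] by (simp add: tens_def)
    next
      case False
      hence "u @ v \<notin> words d (a + b)" using v by (auto simp: words_def)
      thus ?thesis using x by (simp add: tens_def)
    qed
    thus ?thesis by (simp add: tens_def)
  qed
  thus ?thesis using tensor_sp_right_iff[OF subspace_tens order_refl] by blast
qed

text \<open>Expand the left slices in a basis of \<open>U'\<close>, extended to the whole tensor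
  power. The coordinates are combinations of right slices and therefore lie in \<open>U\<close>, and
  only the basis of \<open>U'\<close> occurs.\<close>

lemma tensor_sp_Int:
  fixes U U' :: "(nat list \<Rightarrow> 'k::field) set"
  assumes U: "fs.subspace U" "U \<subseteq> tens d a" and U': "fs.subspace U'" "U' \<subseteq> tens d b"
    and x: "x \<in> tensor_sp a U (tens d b)" and l: "\<And>u. u \<in> words d a \<Longrightarrow> (\<lambda>v. x (u @ v)) \<in> U'"
  shows "x \<in> tensor_sp a U U'"
proof -
  have "x \<in> tens d (a + b) \<and> (\<forall>v\<in>words d b. (\<lambda>u. x (u @ v)) \<in> U)"
    using x unfolding tensor_sp_right_iff[OF U] .
  hence xt: "x \<in> tens d (a + b)" and xr: "\<And>v. v \<in> words d b \<Longrightarrow> (\<lambda>u. x (u @ v)) \<in> U" by simp_all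
  obtain B where B: "finite B" "B \<subseteq> U'" "fs.independent B" "fs.span B = U'"
    using fin_dim_basis[OF U'(1) fin_dim_subset[OF fin_dim_tens U'(2)]] .
  obtain E where E: "B \<subseteq> E" "finite E" "E \<subseteq> tens d b" "fs.independent E" "fs.span E = tens d b"
    using fin_dim_basis_extend[OF subspace_tens fin_dim_tens subset_trans[OF B(2) U'(2)] B(3)] .
  \<comment> \<open>Coordinate \<open>e\<close> of the left slices as a function of the prefix,
    written through the right slices by expanding in the words \<open>v\<close>.\<close>
  define p where "p e = (\<Sum>v\<in>words d b. sc (fs.representation E (dlt v) e) (\<lambda>u. x (u @ v)))" for e
  have pU: "p e \<in> U" for e
    unfolding p_def using xr by (intro fs.subspace_sum[OF U(1)] fs.subspace_scale[OF U(1)])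
  have rep: "fs.representation E (\<lambda>v. x (u @ v)) e = p e u" if u: "u \<in> words d a" for u e
  proof -
    have y: "(\<lambda>v. x (u @ v)) \<in> supp_in (words d b)" using subsetD[OF U'(2) l[OF u]] unfolding tens_eq .
    have "fs.representation E (\<lambda>v. x (u @ v)) = fs.representation E (\<Sum>v\<in>words d b. sc (x (u @ v)) (dlt v))"
      by (rule arg_cong[where f = "fs.representation E", OF supp_in_expand[OF words_finite y]])
    also have "\<dots> = (\<lambda>e. \<Sum>v\<in>words d b. fs.representation E (sc (x (u @ v)) (dlt v)) e)"
      by (rule fs.representation_sum[OF E(4)], unfold E(5) tens_eq)
        (rule fs.subspace_scale[OF subspace_supp_in dlt_in_supp_in])
    also have "\<dots> = (\<lambda>e. \<Sum>v\<in>words d b. x (u @ v) * fs.representation E (dlt v) e)"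
      by (intro ext sum.cong refl)
        (simp add: fs.representation_scale[OF E(4)] E(5) tens_eq dlt_in_supp_in)
    finally show ?thesis by (simp add: p_def fun_sum_apply sc_def mult.commute)
  qed
  have "x = (\<Sum>e\<in>B. etens a (p e) e)"
  proof
    fix w
    show "x w = (\<Sum>e\<in>B. etens a (p e) e) w"
    proof (cases "take a w \<in> words d a")
      case True
      let ?y = "\<lambda>v. x (take a w @ v)"
      have "?y = (\<Sum>e\<in>B. sc (fs.representation B ?y e) e)"
        by (rule fs.sum_representation_eq[OF B(3) _ B(1) order_refl, symmetric]) (use l[OF True] B(4) in simp)
      also have "fs.representation B ?y = fs.representation E ?y"
        by (rule fs.representation_extend[symmetric, OF E(4) _ E(1)]) (use l[OF True] B(4) in simp)
      also have "(\<Sum>e\<in>B. sc (fs.representation E ?y e) e) = (\<Sum>e\<in>B. sc (p e (take a w)) e)"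
        by (simp only: rep[OF True])
      finally have y: "?y = (\<Sum>e\<in>B. sc (p e (take a w)) e)" .
      have "x w = ?y (drop a w)" by simp
      also have "\<dots> = (\<Sum>e\<in>B. sc (p e (take a w)) e) (drop a w)" by (rule fun_cong[OF y])
      also have "\<dots> = (\<Sum>e\<in>B. etens a (p e) e) w" by (simp add: fun_sum_apply sc_def etens_def)
      finally show ?thesis .
    next
      case False
      have "p e (take a w) = 0" for e using pU[of e] U(2) False by (auto simp: tens_def)
      moreover have "x w = 0" using xt False by (simp add: tens_def words_take_drop)
      ultimately show ?thesis by (simp add: fun_sum_apply etens_def)
    qed
  qed
  moreover have "(\<Sum>e\<in>B. etens a (p e) e) \<in> tensor_sp a U U'"
    using B(2) pU by (intro fs.subspace_sum[OF subspace_tensor_sp] etens_in_tensor_sp) auto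
  ultimately show ?thesis by simp
qed

lemma tensor_sp_span_UN:
  fixes U :: "(nat list \<Rightarrow> 'k::field) set"
  shows "tensor_sp a U (fs.span (\<Union>i\<in>K. S i)) = fs.span (\<Union>i\<in>K. tensor_sp a U (S i))"
proof
  show "tensor_sp a U (fs.span (\<Union>i\<in>K. S i)) \<subseteq> fs.span (\<Union>i\<in>K. tensor_sp a U (S i))"
  proof (rule tensor_sp_minimal[OF fs.subspace_span])
    fix u v assume u: "u \<in> U" and v: "v \<in> fs.span (\<Union>i\<in>K. S i)"
    from v show "etens a u v \<in> fs.span (\<Union>i\<in>K. tensor_sp a U (S i))"
    proof (induction rule: fs.span_induct_alt)
      case base
      show ?case unfolding etens_linear by (rule fs.span_zero)
    next
      case (step c s y)
      have "etens a u s \<in> (\<Union>i\<in>K. tensor_sp a U (S i))" using step(1) etens_in_tensor_sp[OF u] by blast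
      thus ?case unfolding etens_linear by (intro fs.span_add[OF fs.span_scale[OF fs.span_base] step(2)])
    qed
  qed
  show "fs.span (\<Union>i\<in>K. tensor_sp a U (S i)) \<subseteq> tensor_sp a U (fs.span (\<Union>i\<in>K. S i))"
  proof (rule fs.span_minimal[OF _ subspace_tensor_sp], rule UN_least)
    fix i assume "i \<in> K"
    hence "S i \<subseteq> fs.span (\<Union>i\<in>K. S i)" using fs.span_superset[of "\<Union>i\<in>K. S i"] by blast
    thus "tensor_sp a U (S i) \<subseteq> tensor_sp a U (fs.span (\<Union>i\<in>K. S i))" by (intro tensor_sp_mono order_refl)
  qed
qed

section \<open>Images and kernels of the operators under tensor products\<close>

lemma Rop_right_slice:
  assumes "Suc i < length u" "set v \<subseteq> {..<d}"
  shows "Rop d R i x (u @ v) = Rop d R i (\<lambda>u. x (u @ v)) u"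
  using assms by (simp add: Rop_def nth_append list_update_append)

lemma Rop_left_slice:
  assumes "set u \<subseteq> {..<d}"
  shows "Rop d R (length u + i) x (u @ v) = Rop d R i (\<lambda>v. x (u @ v)) v"
  using assms by (simp add: Rop_def nth_append list_update_append Suc_diff_le flip: add_Suc_right)

lemma Rop_etens_right:
  fixes u v :: "nat list \<Rightarrow> 'k::field"
  assumes "u \<in> tens d a" "v \<in> tens d b" "Suc i < a"
  shows "Rop d R i (etens a u v) = etens a (Rop d R i u) v"
proof
  fix w
  show "Rop d R i (etens a u v) w = etens a (Rop d R i u) v w"
  proof (cases "w \<in> words d (a + b)")
    case True
    hence t: "take a w \<in> words d a" "drop a w \<in> words d b" by (auto simp: words_take_drop)
    have "Rop d R i (etens a u v) (take a w @ drop a w) = Rop d R i (\<lambda>u'. etens a u v (u' @ drop a w)) (take a w)"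
      using t assms(3) by (intro Rop_right_slice) (auto simp: words_def)
    also have "\<dots> = sc (v (drop a w)) (Rop d R i u) (take a w)"
      unfolding right_slice_etens[OF assms(1,2) t(2)] lin_opsD(2)[OF lin_ops_Rop] ..
    finally show ?thesis by (simp add: etens_def sc_def)
  next
    case False
    thus ?thesis using Rop_in_tens[OF etens_in_tens[OF assms(1,2)], of R i] etens_in_tens[OF Rop_in_tens[OF assms(1)] assms(2), of R i]
      by (simp add: tens_def)
  qed
qed

lemma Rop_etens_left:
  fixes u v :: "nat list \<Rightarrow> 'k::field"
  assumes "u \<in> tens d a" "v \<in> tens d b"
  shows "Rop d R (a + i) (etens a u v) = etens a u (Rop d R i v)"
proof
  fix w
  show "Rop d R (a + i) (etens a u v) w = etens a u (Rop d R i v) w"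
  proof (cases "w \<in> words d (a + b)")
    case True
    hence t: "take a w \<in> words d a" by (auto simp: words_take_drop)
    hence l: "length (take a w) = a" by (simp add: words_def)
    have "Rop d R (length (take a w) + i) (etens a u v) (take a w @ drop a w) = Rop d R i (\<lambda>v'. etens a u v (take a w @ v')) (drop a w)"
      using t by (intro Rop_left_slice) (simp add: words_def)
    also have "\<dots> = sc (u (take a w)) (Rop d R i v) (drop a w)"
      unfolding left_slice_etens[OF l] lin_opsD(2)[OF lin_ops_Rop] ..
    finally show ?thesis unfolding l by (simp add: etens_def sc_def)
  next
    case False
    thus ?thesis using Rop_in_tens[OF etens_in_tens[OF assms(1,2)], of R "a + i"] etens_in_tens[OF assms(1) Rop_in_tens[OF assms(2)], of R i]
      by (simp add: tens_def)
  qed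
qed

lemma image_span_minus:
  assumes T: "lin_ops T"
  shows "(\<lambda>x. T i x - sc q x) ` fs.span S = fs.span ((\<lambda>x. T i x - sc q x) ` S)"
proof -
  note l = lin_opsD[OF T]
  have "Vector_Spaces.linear sc sc (\<lambda>x. T i x - sc q x)"
    unfolding Vector_Spaces.linear_iff
    using fs.vector_space_axioms
    by (auto simp: l fs.scale_right_distrib fs.scale_right_diff_distrib mult.commute)
  thus ?thesis using module_hom.span_image[of sc sc "\<lambda>x. T i x - sc q x" S]
    by (simp add: module_hom_iff_linear)
qed

text \<open>For images a comparison of generators suffices. For kernels the left slices of a kernel
  element lie in the kernel, and \<open>tensor_sp_Int\<close> assembles them.\<close>

lemma tensor_sp_bop_left:
  fixes W :: "(nat list \<Rightarrow> 'k::field) set"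
  assumes W: "fs.subspace W" "W \<subseteq> tens d a" and i: "Suc i < b"
  shows "tensor_sp a W (bop im (Rop d R) q i (tens d b)) = bop im (Rop d R) q (a + i) (tensor_sp a W (tens d b))"
proof (cases im)
  case True
  let ?G = "{etens a u v | u v. u \<in> W \<and> v \<in> tens d b}"
  have e: "etens a u (Rop d R i v - sc q v) = Rop d R (a + i) (etens a u v) - sc q (etens a u v)"
    if "u \<in> W" "v \<in> tens d b" for u v
  proof -
    have "etens a u (Rop d R i v - sc q v) = etens a u (Rop d R i v) - sc q (etens a u v)"
      by (simp add: etens_def sc_def fun_eq_iff algebra_simps)
    thus ?thesis using Rop_etens_left[of u d a v b R i] that W(2) by auto
  qed
  have "{etens a u v | u v. u \<in> W \<and> v \<in> bop True (Rop d R) q i (tens d b)} =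
      (\<lambda>x. Rop d R (a + i) x - sc q x) ` ?G" (is "?A = ?B")
  proof (intro equalityI subsetI)
    fix x assume "x \<in> ?A"
    then obtain u v where "u \<in> W" "v \<in> tens d b" "x = etens a u (Rop d R i v - sc q v)"
      by (auto simp: bop_def)
    thus "x \<in> ?B" using e by blast
  next
    fix x assume "x \<in> ?B"
    then obtain u v where uv: "u \<in> W" "v \<in> tens d b" "x = Rop d R (a + i) (etens a u v) - sc q (etens a u v)"
      by blast
    hence "x = etens a u (Rop d R i v - sc q v)" using e by simp
    moreover have "Rop d R i v - sc q v \<in> bop True (Rop d R) q i (tens d b)" using uv by (auto simp: bop_def)
    ultimately show "x \<in> ?A" using uv(1) by blast
  qed
  hence "tensor_sp a W (bop im (Rop d R) q i (tens d b)) = (\<lambda>x. Rop d R (a + i) x - sc q x) ` fs.span ?G"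
    unfolding tensor_sp_def image_span_minus[OF lin_ops_Rop] using True by simp
  thus ?thesis using True by (simp add: bop_def tensor_sp_def)
next
  case False
  let ?K = "bop False (Rop d R) q i (tens d b)"
  have K: "fs.subspace ?K" "?K \<subseteq> tens d b"
    by (rule subspace_bop[OF lin_ops_Rop subspace_tens]) (auto simp: bop_def)
  have "tensor_sp a W ?K = bop False (Rop d R) q (a + i) (tensor_sp a W (tens d b))"
  proof
    show "tensor_sp a W ?K \<subseteq> bop False (Rop d R) q (a + i) (tensor_sp a W (tens d b))"
    proof (rule tensor_sp_minimal[OF subspace_bop[OF lin_ops_Rop subspace_tensor_sp]])
      fix u v assume uv: "u \<in> W" "v \<in> ?K"
      hence v: "v \<in> tens d b" "Rop d R i v = sc q v" by (auto simp: bop_def)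
      have "Rop d R (a + i) (etens a u v) = sc q (etens a u v)"
        using Rop_etens_left[of u d a v b R i] uv(1) W(2) v etens_linear(4)[of a u q v] by auto
      thus "etens a u v \<in> bop False (Rop d R) q (a + i) (tensor_sp a W (tens d b))"
        using etens_in_tensor_sp[OF uv(1) v(1)] by (simp add: bop_def)
    qed
    show "bop False (Rop d R) q (a + i) (tensor_sp a W (tens d b)) \<subseteq> tensor_sp a W ?K"
    proof
      fix x assume "x \<in> bop False (Rop d R) q (a + i) (tensor_sp a W (tens d b))"
      hence x: "x \<in> tensor_sp a W (tens d b)" "Rop d R (a + i) x = sc q x" by (auto simp: bop_def)
      have xt: "x \<in> tens d (a + b)" using x(1) unfolding tensor_sp_right_iff[OF W] by blast
      show "x \<in> tensor_sp a W ?K"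
      proof (rule tensor_sp_Int[OF W K x(1)])
        fix u assume u: "u \<in> words d a"
        hence ul: "length u = a" "set u \<subseteq> {..<d}" by (auto simp: words_def)
        have "(\<lambda>v. x (u @ v)) \<in> tens d b"
        proof -
          have "x (u @ v) = 0" if v: "v \<notin> words d b" for v
          proof -
            have "u @ v \<notin> words d (a + b)" using v u by (auto simp: words_def)
            thus ?thesis using xt by (simp add: tens_def)
          qed
          thus ?thesis by (simp add: tens_def)
        qed
        moreover have "Rop d R i (\<lambda>v. x (u @ v)) = sc q (\<lambda>v. x (u @ v))"
        proof
          fix v
          have "Rop d R i (\<lambda>v. x (u @ v)) v = Rop d R (a + i) x (u @ v)"
            using Rop_left_slice[OF ul(2), of R i x v] ul(1) by simp
          thus "Rop d R i (\<lambda>v. x (u @ v)) v = sc q (\<lambda>v. x (u @ v)) v" unfolding x(2) by (simp add: sc_def)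
        qed
        ultimately show "(\<lambda>v. x (u @ v)) \<in> ?K" by (simp add: bop_def)
      qed
    qed
  qed
  thus ?thesis using False by simp
qed

lemma hmod_tens: "hmod n (Rop d R) (tens d n)"
  by (simp add: hmod_def lin_ops_Rop subspace_tens Rop_in_tens)

lemma tensor_sp_bop_right:
  assumes i: "Suc i < a"
  shows "tensor_sp a (bop im (Rop d R) q i (tens d a)) (tens d b) = bop im (Rop d R) q i (tens d (a + b))"
proof (cases im)
  case True
  let ?G = "{etens a u v | u v. u \<in> tens d a \<and> v \<in> tens d b} :: (nat list \<Rightarrow> 'a) set"
  have e: "etens a (Rop d R i u - sc q u) v = Rop d R i (etens a u v) - sc q (etens a u v)"
    if "u \<in> tens d a" "v \<in> tens d b" for u v
  proof -
    have "etens a (Rop d R i u - sc q u) v = etens a (Rop d R i u) v - sc q (etens a u v)"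
      by (simp add: etens_def sc_def fun_eq_iff algebra_simps)
    thus ?thesis using Rop_etens_right[OF that i] by simp
  qed
  have "{etens a u v | u v. u \<in> bop True (Rop d R) q i (tens d a) \<and> v \<in> tens d b} =
      (\<lambda>x. Rop d R i x - sc q x) ` ?G" (is "?A = ?B")
  proof (intro equalityI subsetI)
    fix x assume "x \<in> ?A"
    then obtain u v where "u \<in> tens d a" "v \<in> tens d b" "x = etens a (Rop d R i u - sc q u) v"
      by (auto simp: bop_def)
    thus "x \<in> ?B" using e by blast
  next
    fix x assume "x \<in> ?B"
    then obtain u v where uv: "u \<in> tens d a" "v \<in> tens d b" "x = Rop d R i (etens a u v) - sc q (etens a u v)"
      by blast
    hence "x = etens a (Rop d R i u - sc q u) v" using e by simp
    moreover have "Rop d R i u - sc q u \<in> bop True (Rop d R) q i (tens d a)" using uv by (auto simp: bop_def)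
    ultimately show "x \<in> ?A" using uv(2) by blast
  qed
  hence "tensor_sp a (bop im (Rop d R) q i (tens d a)) (tens d b) = (\<lambda>x. Rop d R i x - sc q x) ` fs.span ?G"
    unfolding tensor_sp_def image_span_minus[OF lin_ops_Rop] using True by simp
  also have "fs.span ?G = tens d (a + b)" unfolding tensor_sp_tens[symmetric] tensor_sp_def ..
  finally show ?thesis by (simp only: bop_def True if_True)
next
  case False
  let ?K = "bop False (Rop d R) q i (tens d a)"
  have K: "fs.subspace ?K" "?K \<subseteq> tens d a"
    by (rule subspace_bop[OF lin_ops_Rop subspace_tens]) (auto simp: bop_def)
  have "x \<in> tensor_sp a ?K (tens d b) \<longleftrightarrow> x \<in> bop False (Rop d R) q i (tens d (a + b))" for x
  proof (cases "x \<in> tens d (a + b)")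
    case xt: True
    have sl: "(\<lambda>u. x (u @ v)) \<in> tens d a" if "v \<in> words d b" for v
      using xt that tensor_sp_right_iff[OF subspace_tens order_refl, of x a d b] tensor_sp_tens[of a d b] by blast
    have "(\<forall>v\<in>words d b. (\<lambda>u. x (u @ v)) \<in> ?K) \<longleftrightarrow> Rop d R i x = sc q x"
    proof
      assume k: "\<forall>v\<in>words d b. (\<lambda>u. x (u @ v)) \<in> ?K"
      show "Rop d R i x = sc q x"
      proof
        fix w
        show "Rop d R i x w = sc q x w"
        proof (cases "w \<in> words d (a + b)")
          case True
          hence t: "take a w \<in> words d a" "drop a w \<in> words d b" by (auto simp: words_take_drop)
          have "Rop d R i x (take a w @ drop a w) = Rop d R i (\<lambda>u. x (u @ drop a w)) (take a w)"
            using t i by (intro Rop_right_slice) (auto simp: words_def)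
          also have "\<dots> = sc q (\<lambda>u. x (u @ drop a w)) (take a w)" using k t(2) by (simp add: bop_def)
          finally show ?thesis by (simp add: sc_def)
        next
          case False
          thus ?thesis using xt Rop_in_tens[OF xt, of R i] by (simp add: tens_def sc_def)
        qed
      qed
    next
      assume r: "Rop d R i x = sc q x"
      show "\<forall>v\<in>words d b. (\<lambda>u. x (u @ v)) \<in> ?K"
      proof
        fix v assume v: "v \<in> words d b"
        have "Rop d R i (\<lambda>u. x (u @ v)) = sc q (\<lambda>u. x (u @ v))"
        proof
          fix u
          show "Rop d R i (\<lambda>u. x (u @ v)) u = sc q (\<lambda>u. x (u @ v)) u"
          proof (cases "Suc i < length u")
            case True
            have "Rop d R i (\<lambda>u. x (u @ v)) u = Rop d R i x (u @ v)"
              using Rop_right_slice[OF True, of v d R x] v by (simp add: words_def)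
            thus ?thesis unfolding r by (simp add: sc_def)
          next
            case False
            hence "u \<notin> words d a" using i by (auto simp: words_def)
            thus ?thesis using False sl[OF v] by (simp add: Rop_def sc_def tens_def)
          qed
        qed
        thus "(\<lambda>u. x (u @ v)) \<in> ?K" using sl[OF v] by (simp add: bop_def)
      qed
    qed
    thus ?thesis unfolding tensor_sp_right_iff[OF K] using xt by (simp add: bop_def)
  next
    case False
    thus ?thesis unfolding tensor_sp_right_iff[OF K] by (simp add: bop_def)
  qed
  thus ?thesis using False by auto
qed

section \<open>The Koszul data in functorial form\<close>

definition rel_of :: "bool \<Rightarrow> nat \<Rightarrow> 'k::field \<Rightarrow> (nat \<Rightarrow> nat \<Rightarrow> nat \<Rightarrow> nat \<Rightarrow> 'k) \<Rightarrow> (nat list \<Rightarrow> 'k) set" where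
  "rel_of im d q R = (if im then IS d q R else IL d q R)"

lemma rel_of_eq: "rel_of im d q R = bop im (Rop d R) q 0 (tens d 2)"
proof -
  have "(\<lambda>w. Rop d R 0 f w - q * f w) = Rop d R 0 f - sc q f" for f by (simp add: fun_eq_iff sc_def)
  thus ?thesis unfolding rel_of_def IS_def IL_def bop_def by auto
qed

lemma emb_eq: "emb d (rel_of im d q R) i j = bop im (Rop d R) q i (tens d (i + (2 + j)))"
proof -
  have "emb d (rel_of im d q R) i j = tensor_sp i (tens d i) (bop im (Rop d R) q 0 (tens d (2 + j)))"
    unfolding emb_def rel_of_eq by (subst tensor_sp_bop_right) simp_all
  also have "\<dots> = bop im (Rop d R) q (i + 0) (tensor_sp i (tens d i) (tens d (2 + j)))"
    by (rule tensor_sp_bop_left[OF subspace_tens order_refl]) simp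
  finally show ?thesis unfolding tensor_sp_tens by (simp only: add_0_right)
qed

lemma Jsp_eq: "Jsp d (rel_of im d q R) m = Zsp im (Rop d R) q (tens d m) m 0"
proof -
  have F: "Fsp im (Rop d R) q (tens d m) 0 = tens d m" by (auto simp: Fsp_def)
  show ?thesis
  proof (cases "m < 2")
    case True
    hence "{i. 0 \<le> i \<and> Suc i < m} = {}" by auto
    thus ?thesis using True by (simp add: Jsp_def Zsp_def)
  next
    case False
    have "(\<Union>i\<in>{..m - 2}. emb d (rel_of im d q R) i (m - 2 - i)) = (\<Union>i\<in>{i. 0 \<le> i \<and> Suc i < m}. bop im (Rop d R) q i (tens d m))"
    proof (rule SUP_cong)
      show "{..m - 2} = {i. 0 \<le> i \<and> Suc i < m}" using False by auto
      fix i assume "i \<in> {i. 0 \<le> i \<and> Suc i < m}"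
      hence "i + (2 + (m - 2 - i)) = m" by auto
      thus "emb d (rel_of im d q R) i (m - 2 - i) = bop im (Rop d R) q i (tens d m)" unfolding emb_eq by (simp only:)
    qed
    thus ?thesis using False by (simp add: Jsp_def Zsp_def F)
  qed
qed

lemma Wsp_eq: "Wsp d (rel_of im d q R) n = Fsp im (Rop d R) q (tens d n) n"
proof (cases "n < 2")
  case True
  thus ?thesis by (auto simp: Wsp_def Fsp_def)
next
  case False
  have "(\<Inter>i\<in>{..n - 2}. emb d (rel_of im d q R) i (n - 2 - i)) = (\<Inter>i\<in>{i. Suc i < n}. bop im (Rop d R) q i (tens d n))"
  proof (rule INF_cong)
    show "{..n - 2} = {i. Suc i < n}" using False by auto
    fix i assume "i \<in> {i. Suc i < n}"
    hence "i + (2 + (n - 2 - i)) = n" by auto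
    thus "emb d (rel_of im d q R) i (n - 2 - i) = bop im (Rop d R) q i (tens d n)" unfolding emb_eq by (simp only:)
  qed
  moreover have "bop im (Rop d R) q 0 (tens d n) \<subseteq> tens d n" by (rule bop_subset[OF hmod_tens]) (use False in simp)
  moreover have "(0::nat) \<in> {i. Suc i < n}" using False by simp
  ultimately show ?thesis using False unfolding Wsp_def Fsp_def by auto
qed

lemma subspace_Wsp: "fs.subspace (Wsp d (rel_of im d q R) n)" "Wsp d (rel_of im d q R) n \<subseteq> tens d n"
  unfolding Wsp_eq by (rule subspace_Fsp[OF lin_ops_Rop subspace_tens], rule Fsp_subset)

lemma Ccx_eq: "Ccx d (rel_of im d q R) n m = Fsp im (Rop d R) q (tens d (n + m)) n"
proof -
  have "x \<in> tensor_sp n (Wsp d (rel_of im d q R) n) (tens d m) \<longleftrightarrow> x \<in> Fsp im (Rop d R) q (tens d (n + m)) n" for x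
  proof (cases "x \<in> tens d (n + m)")
    case True
    have sl: "(\<lambda>u. x (u @ v)) \<in> tens d n" if "v \<in> words d m" for v
      using True that tensor_sp_right_iff[OF subspace_tens order_refl, of x n d m] tensor_sp_tens[of n d m] by blast
    have b: "x \<in> bop im (Rop d R) q i (tens d (n + m)) \<longleftrightarrow> (\<forall>v\<in>words d m. (\<lambda>u. x (u @ v)) \<in> bop im (Rop d R) q i (tens d n))"
      if "Suc i < n" for i
      unfolding tensor_sp_bop_right[OF that, symmetric]
      using tensor_sp_right_iff[OF subspace_bop[OF lin_ops_Rop subspace_tens] bop_subset[OF hmod_tens that]] True by blast
    show ?thesis
      unfolding tensor_sp_right_iff[OF subspace_Wsp] unfolding Wsp_eq Fsp_def using True sl b by blast
  next
    case False
    thus ?thesis unfolding tensor_sp_right_iff[OF subspace_Wsp] by (simp add: Fsp_def)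
  qed
  thus ?thesis unfolding Ccx_def by blast
qed

lemma Zcx_eq: "Zcx d (rel_of im d q R) n m = Zsp im (Rop d R) q (tens d (n + m)) (n + m) n"
proof -
  let ?W = "Wsp d (rel_of im d q R) n"
  have F: "Fsp im (Rop d R) q (tens d m) 0 = tens d m" by (auto simp: Fsp_def)
  have "Zcx d (rel_of im d q R) n m = fs.span (\<Union>i\<in>{i. 0 \<le> i \<and> Suc i < m}. tensor_sp n ?W (bop im (Rop d R) q i (tens d m)))"
    unfolding Zcx_def Jsp_eq Zsp_def F by (rule tensor_sp_span_UN)
  also have "(\<Union>i\<in>{i. 0 \<le> i \<and> Suc i < m}. tensor_sp n ?W (bop im (Rop d R) q i (tens d m))) =
      (\<Union>i\<in>{i. 0 \<le> i \<and> Suc i < m}. bop im (Rop d R) q (n + i) (Ccx d (rel_of im d q R) n m))"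
    by (rule SUP_cong[OF refl]) (simp add: tensor_sp_bop_left[OF subspace_Wsp] Ccx_def)
  \<comment> \<open>Position \<open>i\<close> of the algebra part is position \<open>n + i\<close>
    of the whole word.\<close>
  also have "\<dots> = (\<Union>i\<in>{i. n \<le> i \<and> Suc i < n + m}. bop im (Rop d R) q i (Ccx d (rel_of im d q R) n m))"
  proof -
    have "{i. n \<le> i \<and> Suc i < n + m} = (\<lambda>i. n + i) ` {i. 0 \<le> i \<and> Suc i < m}"
    proof (intro equalityI subsetI)
      fix i assume "i \<in> {i. n \<le> i \<and> Suc i < n + m}"
      thus "i \<in> (\<lambda>i. n + i) ` {i. 0 \<le> i \<and> Suc i < m}" by (intro image_eqI[of _ _ "i - n"]) auto
    qed auto
    thus ?thesis by simp
  qed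
  finally show ?thesis unfolding Ccx_eq Zsp_def .
qed

text \<open>The differential preserves \<open>n + m\<close>, so the complex decomposes into the
  pieces living on a single tensor power \<open>V^N\<close>.\<close>

lemma koszul_rel_of:
  assumes ex: "\<And>N. N > 0 \<Longrightarrow> exact_cx im (Rop d R) q (tens d N) N"
  shows "koszul d (rel_of im d q R)"
  unfolding koszul_def Ccx_eq Zcx_eq
proof (intro conjI allI impI ballI)
  let ?T = "Rop d R"
  fix n m x assume n: "1 \<le> n" and x: "x \<in> Fsp im ?T q (tens d (n + m)) n"
    "x \<in> Zsp im ?T q (tens d (n - 1 + Suc m)) (n - 1 + Suc m) (n - 1)"
  have e: "n - 1 + Suc m = n + m" using n by simp
  have N: "n + m > 0" using n by simp
  note E = ex[OF N, unfolded exact_cx_def, rule_format, of n x]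
  show "if m = 0 then x \<in> Zsp im ?T q (tens d (n + 0)) (n + 0) n
       else \<exists>y\<in>Fsp im ?T q (tens d (Suc n + (m - 1))) (Suc n). x - y \<in> Zsp im ?T q (tens d (n + m)) (n + m) n"
  proof (cases "m = 0")
    case True
    have "x = 0" using E n x True unfolding e by simp
    thus ?thesis using True fs.subspace_0[OF subspace_Zsp] by simp
  next
    case False
    have "Suc n + (m - 1) = n + m" using False by simp
    thus ?thesis using E n x False unfolding e by simp
  qed
next
  let ?T = "Rop d R"
  fix m x assume m: "1 \<le> m" and x: "x \<in> Fsp im ?T q (tens d (0 + m)) 0"
  \<comment> \<open>No relation constrains \<open>W_1\<close>, so every element of positive degree
    bounds itself.\<close>
  have "x \<in> Fsp im ?T q (tens d (1 + (m - 1))) 1" using x m by (simp add: Fsp_def)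
  moreover have "x - x \<in> Zsp im ?T q (tens d (0 + m)) (0 + m) 0"
    using fs.subspace_0[OF subspace_Zsp] by (simp only: diff_self)
  ultimately show "\<exists>y\<in>Fsp im ?T q (tens d (1 + (m - 1))) 1. x - y \<in> Zsp im ?T q (tens d (0 + m)) (0 + m) 0" by blast
qed

section \<open>Hilbert series\<close>

lemma dim_tensor_sp:
  fixes U U' :: "(nat list \<Rightarrow> 'k::field) set"
  assumes U: "fs.subspace U" "U \<subseteq> tens d a" and U': "fs.subspace U'" "U' \<subseteq> tens d b"
  shows "fs.dim (tensor_sp a U U') = fs.dim U * fs.dim U'"
proof -
  obtain B where B: "finite B" "B \<subseteq> U" "fs.independent B" "fs.span B = U" "card B = fs.dim U"
    using fin_dim_basis[OF U(1) fin_dim_subset[OF fin_dim_tens U(2)]] .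
  obtain B' where B': "finite B'" "B' \<subseteq> U'" "fs.independent B'" "fs.span B' = U'" "card B' = fs.dim U'"
    using fin_dim_basis[OF U'(1) fin_dim_subset[OF fin_dim_tens U'(2)]] .
  let ?e = "\<lambda>p. etens a (fst p) (snd p)"
  have zero: "c p = 0" if s: "(\<Sum>p\<in>B \<times> B'. sc (c p) (?e p)) = 0" and p: "p \<in> B \<times> B'" for c p
  proof -
    obtain u v where uv: "p = (u, v)" "u \<in> B" "v \<in> B'" using p by auto
    \<comment> \<open>Fixing the prefix \<open>u0\<close> leaves a relation on \<open>B'\<close>;
      letting \<open>u0\<close> vary in its coefficients then gives a relation on
      \<open>B\<close>.\<close>
    have s2: "(\<Sum>v\<in>B'. sc (\<Sum>u\<in>B. c (u, v) * u u0) v) = 0" if u0: "length u0 = a" for u0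
    proof
      fix v0
      have "(\<Sum>v\<in>B'. sc (\<Sum>u\<in>B. c (u, v) * u u0) v) v0 = (\<Sum>v\<in>B'. \<Sum>u\<in>B. c (u, v) * u u0 * v v0)"
        by (simp add: fun_sum_apply sc_def sum_distrib_right)
      also have "\<dots> = (\<Sum>u\<in>B. \<Sum>v\<in>B'. c (u, v) * u u0 * v v0)" by (rule sum.swap)
      also have "\<dots> = (\<Sum>p\<in>B \<times> B'. c p * fst p u0 * snd p v0)"
        by (simp add: sum.cartesian_product case_prod_beta)
      also have "\<dots> = (\<Sum>p\<in>B \<times> B'. sc (c p) (?e p)) (u0 @ v0)"
        using u0 by (simp add: fun_sum_apply sc_def etens_def mult.assoc)
      finally show "(\<Sum>v\<in>B'. sc (\<Sum>u\<in>B. c (u, v) * u u0) v) v0 = 0 v0" unfolding s by simp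
    qed
    have "(\<Sum>u\<in>B. sc (c (u, v)) u) = 0"
    proof
      fix u0
      show "(\<Sum>u\<in>B. sc (c (u, v)) u) u0 = 0 u0"
      proof (cases "length u0 = a")
        case True
        have "(\<Sum>u\<in>B. c (u, v) * u u0) = 0"
          by (rule fs.independentD[OF B'(3) B'(1) order_refl s2[OF True] uv(3)])
        thus ?thesis by (simp add: fun_sum_apply sc_def)
      next
        case False
        have "u u0 = 0" if "u \<in> B" for u
        proof -
          have "u \<in> tens d a" using that B(2) U(2) by blast
          moreover have "u0 \<notin> words d a" using False by (simp add: words_def)
          ultimately show ?thesis by (simp add: tens_def)
        qed
        hence "(\<Sum>u\<in>B. c (u, v) * u u0) = 0" by (intro sum.neutral) auto
        thus ?thesis by (simp add: fun_sum_apply sc_def)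
      qed
    qed
    from fs.independentD[OF B(3) B(1) order_refl this uv(2)] show ?thesis by (simp add: uv)
  qed
  have fin: "finite (B \<times> B')" using B(1) B'(1) by simp
  have inj: "inj_on ?e (B \<times> B')"
  proof (rule inj_onI, rule ccontr)
    fix p p' assume p: "p \<in> B \<times> B'" "p' \<in> B \<times> B'" "?e p = ?e p'" and ne: "p \<noteq> p'"
    \<comment> \<open>Two pairs with equal product would give a relation with coefficients 1 and
      -1.\<close>
    define c where "c r = (if r = p then 1 else if r = p' then - 1 else (0::'k))" for r
    have "(\<Sum>r\<in>B \<times> B'. sc (c r) (?e r)) = (\<Sum>r\<in>{p, p'}. sc (c r) (?e r))"
      by (rule sum.mono_neutral_right[OF fin]) (use p in \<open>auto simp: c_def\<close>)
    also have "\<dots> = sc 1 (?e p) + sc (- 1) (?e p')" using ne by (simp add: c_def)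
    also have "\<dots> = 0" unfolding p(3) by (simp add: fun_eq_iff sc_def)
    finally have "c p = 0" by (rule zero[OF _ p(1)])
    thus False by (simp add: c_def)
  qed
  have ind: "fs.independent (?e ` (B \<times> B'))"
  proof
    assume "fs.dependent (?e ` (B \<times> B'))"
    from iffD1[OF fs.dependent_finite[OF finite_imageI[OF fin]] this]
    obtain f where "\<exists>v\<in>?e ` (B \<times> B'). f v \<noteq> 0" "(\<Sum>v\<in>?e ` (B \<times> B'). sc (f v) v) = 0" by (elim exE conjE)
    then obtain p where f: "(\<Sum>v\<in>?e ` (B \<times> B'). sc (f v) v) = 0" "p \<in> B \<times> B'" "f (?e p) \<noteq> 0" by blast
    have "(\<Sum>p\<in>B \<times> B'. sc (f (?e p)) (?e p)) = 0" using f(1) unfolding sum.reindex[OF inj] comp_def .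
    thus False using zero[of "\<lambda>p. f (?e p)", OF _ f(2)] f(3) by blast
  qed
  have sub: "?e ` (B \<times> B') \<subseteq> tensor_sp a U U'"
    using B(2) B'(2) by (auto intro!: etens_in_tensor_sp)
  have gen: "tensor_sp a U U' \<subseteq> fs.span (?e ` (B \<times> B'))"
  proof (rule tensor_sp_minimal[OF fs.subspace_span])
    fix u v assume u: "u \<in> U" and v: "v \<in> U'"
    have b: "etens a u' v' \<in> fs.span (?e ` (B \<times> B'))" if "u' \<in> B" "v' \<in> B'" for u' v'
      by (rule fs.span_base) (use that in force)
    have c: "etens a u' v \<in> fs.span (?e ` (B \<times> B'))" if "u' \<in> B" for u'
    proof -
      from v have "v \<in> fs.span B'" by (simp add: B'(4))
      thus ?thesis
      proof (induction rule: fs.span_induct_alt)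
        case base
        show ?case unfolding etens_linear by (rule fs.span_zero)
      next
        case (step c x y)
        show ?case unfolding etens_linear by (rule fs.span_add[OF fs.span_scale[OF b[OF that step(1)]] step(2)])
      qed
    qed
    from u have "u \<in> fs.span B" by (simp add: B(4))
    thus "etens a u v \<in> fs.span (?e ` (B \<times> B'))"
    proof (induction rule: fs.span_induct_alt)
      case base
      show ?case unfolding etens_linear by (rule fs.span_zero)
    next
      case (step k x y)
      show ?case unfolding etens_linear by (rule fs.span_add[OF fs.span_scale[OF c[OF step(1)]] step(2)])
    qed
  qed
  have "fs.dim (tensor_sp a U U') = card (?e ` (B \<times> B'))" using fs.basis_card_eq_dim[OF sub gen ind] by simp
  also have "\<dots> = card B * card B'" by (simp add: card_image[OF inj] card_cartesian_product)
  finally show ?thesis using B(5) B'(5) by simp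
qed

lemma subspace_Jsp: "fs.subspace (Jsp d (rel_of im d q R) m)" "Jsp d (rel_of im d q R) m \<subseteq> tens d m"
  unfolding Jsp_eq by (rule subspace_Zsp, rule Zsp_subset[OF hmod_tens])

text \<open>In use \<open>f\<close>, \<open>z\<close> and \<open>k\<close> are the dimensions of the
  chains before division, of the subspaces divided out and of the preimages of the cycles. The
  partial sums telescope to a boundary term.\<close>

lemma alternating_sum_zero:
  fixes f z k :: "nat \<Rightarrow> int"
  assumes s: "\<And>n. n < N \<Longrightarrow> k n + k (Suc n) = f (Suc n) + z n" and "k 0 = f 0" "k N = 0" "z N = 0"
  shows "(\<Sum>n\<le>N. (-1) ^ n * (f n - z n)) = 0"
proof -
  have "(\<Sum>n\<le>j. (-1) ^ n * (f n - z n)) = (-1) ^ j * (k j - z j)" if "j \<le> N" for j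
    using that
  proof (induction j)
    case (Suc j)
    have f: "f (Suc j) = k j + k (Suc j) - z j" using s[of j] Suc.prems by simp
    have "(\<Sum>n\<le>Suc j. (-1) ^ n * (f n - z n)) = (-1) ^ j * (k j - z j) + (-1) ^ Suc j * (f (Suc j) - z (Suc j))"
      using Suc by simp
    also have "\<dots> = (-1) ^ Suc j * (k (Suc j) - z (Suc j))" unfolding f by (simp add: algebra_simps)
    finally show ?case .
  qed (use assms in simp)
  thus ?thesis using assms by simp
qed

lemma euler_characteristic:
  assumes N: "N > 0" and ex: "exact_cx False (Rop d R) q (tens d N) N"
  shows "(\<Sum>n\<le>N. (-1) ^ n * (int (fs.dim (Fsp False (Rop d R) q (tens d N) n)) - int (fs.dim (Zsp False (Rop d R) q (tens d N) N n)))) = 0"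
proof -
  let ?F = "Fsp False (Rop d R) q (tens d N)" and ?Z = "Zsp False (Rop d R) q (tens d N) N"
  \<comment> \<open>The preimage of the cycles. Exactness makes it the sum of
    \<open>?F (Suc n)\<close> and \<open>?Z n\<close>, whose intersection is the next
    \<open>K\<close>; so no dimension of a quotient is involved.\<close>
  define K where "K n = (if n = 0 then tens d N else ?F n \<inter> ?Z (n - 1))" for n
  have sF: "fs.subspace (?F n)" and sZ: "fs.subspace (?Z n)" for n
    by (rule subspace_Fsp[OF lin_ops_Rop subspace_tens], rule subspace_Zsp)
  have fF: "fin_dim (?F n)" and fZ: "fin_dim (?Z n)" for n
    by (rule fin_dim_subset[OF fin_dim_tens Fsp_subset], rule fin_dim_subset[OF fin_dim_tens Zsp_subset[OF hmod_tens]])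
  have F01: "?F 0 = tens d N" "?F 1 = tens d N" by (auto simp: Fsp_def)
  \<comment> \<open>For \<open>im\<close> false the relations are kernels, hence subspaces of the
    space they are imposed on.\<close>
  have ZF: "?Z n \<subseteq> ?F n" for n
    unfolding Zsp_def by (rule fs.span_minimal[OF _ sF]) (auto simp: bop_def)
  have KS: "sum_sp (?F (Suc n)) (?Z n) = K n" if n: "n < N" for n
  proof (cases "n = 0")
    case True
    show ?thesis
    proof (intro equalityI subsetI)
      fix x assume "x \<in> sum_sp (?F (Suc n)) (?Z n)"
      then obtain a b where "a \<in> ?F (Suc n)" "b \<in> ?Z n" "x = a + b" unfolding sum_sp_def by blast
      moreover have "?F (Suc n) \<subseteq> tens d N" "?Z n \<subseteq> tens d N" by (rule Fsp_subset, rule Zsp_subset[OF hmod_tens])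
      ultimately have "x \<in> tens d N" using fs.subspace_add[OF subspace_tens] by blast
      thus "x \<in> K n" using True by (simp add: K_def)
    next
      fix x assume "x \<in> K n"
      hence "x \<in> ?F (Suc n)" using True F01 by (simp add: K_def)
      moreover have "x = x + 0" by simp
      ultimately show "x \<in> sum_sp (?F (Suc n)) (?Z n)" unfolding sum_sp_def using fs.subspace_0[OF sZ] by blast
    qed
  next
    case False
    \<comment> \<open>Two consecutive differentials compose to zero: elements of
      \<open>?F (Suc n)\<close> already satisfy the relation in position
      \<open>n - 1\<close>.\<close>
    have FZ: "?F (Suc n) \<subseteq> ?Z (n - 1)"
    proof
      fix x assume x: "x \<in> ?F (Suc n)"
      have "x \<in> ?F (n - 1)" by (rule subsetD[OF Fsp_antimono x]) simp
      moreover have "x \<in> bop False (Rop d R) q (n - 1) (tens d N)" using x False by (simp add: Fsp_def)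
      ultimately have "x \<in> bop False (Rop d R) q (n - 1) (?F (n - 1))" by (simp add: bop_def)
      thus "x \<in> ?Z (n - 1)" by (rule bop_Zsp[rotated 2]) (use n False in simp_all)
    qed
    show ?thesis
    proof (intro equalityI subsetI)
      fix x assume "x \<in> sum_sp (?F (Suc n)) (?Z n)"
      then obtain a b where ab: "a \<in> ?F (Suc n)" "b \<in> ?Z n" "x = a + b" unfolding sum_sp_def by blast
      have "a \<in> ?F n" by (rule subsetD[OF Fsp_antimono ab(1)]) simp
      moreover have "b \<in> ?Z (n - 1)" by (rule subsetD[OF Zsp_antimono ab(2)]) simp
      ultimately have "x \<in> ?F n" "x \<in> ?Z (n - 1)"
        unfolding ab(3) using ab(1,2) FZ ZF[of n] fs.subspace_add[OF sF] fs.subspace_add[OF sZ] by blast+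
      thus "x \<in> K n" using False by (simp add: K_def)
    next
      fix x assume "x \<in> K n"
      hence x: "x \<in> ?F n" "x \<in> ?Z (n - 1)" using False by (auto simp: K_def)
      obtain y where y: "y \<in> ?F (Suc n)" "x - y \<in> ?Z n"
        using ex[unfolded exact_cx_def, rule_format, of n x] x n False by auto
      moreover have "x = y + (x - y)" by simp
      ultimately show "x \<in> sum_sp (?F (Suc n)) (?Z n)" unfolding sum_sp_def by blast
    qed
  qed
  have KN: "K N = {0}"
  proof -
    have "x = 0" if "x \<in> K N" for x
      using ex[unfolded exact_cx_def, rule_format, of N x] that N by (simp add: K_def)
    moreover have "0 \<in> K N" using N fs.subspace_0[OF sF] fs.subspace_0[OF sZ] by (simp add: K_def)
    ultimately show ?thesis by blast
  qed
  have ZN: "?Z N = {0}"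
  proof -
    have "{i. N \<le> i \<and> Suc i < N} = {}" by auto
    thus ?thesis unfolding Zsp_def by (simp only: UN_empty fs.span_empty)
  qed
  show ?thesis
  proof (rule alternating_sum_zero[where k = "\<lambda>n. int (fs.dim (K n))"])
    fix n assume n: "n < N"
    have "fs.dim (sum_sp (?F (Suc n)) (?Z n)) + fs.dim (?F (Suc n) \<inter> ?Z n) = fs.dim (?F (Suc n)) + fs.dim (?Z n)"
      by (rule dim_sum_Int[OF sF fF sZ fZ])
    moreover have "?F (Suc n) \<inter> ?Z n = K (Suc n)" by (simp add: K_def)
    ultimately show "int (fs.dim (K n)) + int (fs.dim (K (Suc n))) = int (fs.dim (?F (Suc n))) + int (fs.dim (?Z n))"
      unfolding KS[OF n] by (simp flip: of_nat_add)
  next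
    show "int (fs.dim (K 0)) = int (fs.dim (?F 0))" unfolding F01 by (simp add: K_def)
    show "int (fs.dim (K N)) = 0" unfolding KN by simp
    show "int (fs.dim (?Z N)) = 0" unfolding ZN by simp
  qed
qed

lemma dim_tens_0: "fs.dim (tens d 0 :: (nat list \<Rightarrow> 'k::field) set) = 1"
proof -
  have "words d 0 = {[]}" by (auto simp: words_def)
  moreover have "fs.span (dlt ` {[]}) = (supp_in {[]} :: (nat list \<Rightarrow> 'k) set)" by (rule span_dlt) simp
  ultimately have "(tens d 0 :: (nat list \<Rightarrow> 'k) set) = fs.span {dlt []}" by (simp add: tens_eq)
  moreover have "dlt [] \<noteq> (0 :: nat list \<Rightarrow> 'k)"
  proof
    assume "dlt [] = (0 :: nat list \<Rightarrow> 'k)"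
    from fun_cong[OF this, of "[]"] show False by (simp add: dlt_def)
  qed
  ultimately show ?thesis using dim_line[of "dlt [] :: nat list \<Rightarrow> 'k"] by (simp add: fs.span_singleton)
qed

text \<open>The subtraction in \<open>hdim\<close> is truncated; it is a true difference because the
  ideal lies in the tensor power.\<close>

lemma hdim_int: "int (hdim d (rel_of im d q R) n) = int (fs.dim (tens d n :: (nat list \<Rightarrow> 'k::field) set)) - int (fs.dim (Jsp d (rel_of im d (q :: 'k) R) n))"
  unfolding hdim_def using dim_mono_fin[OF subspace_Jsp(2) subspace_tens fin_dim_tens, of d im q R n] by (simp add: of_nat_diff)

theorem theorem3p1:
  fixes d :: nat and q :: "'k::field" and R :: "nat \<Rightarrow> nat \<Rightarrow> nat \<Rightarrow> nat \<Rightarrow> 'k"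
  assumes "hecke_symmetry d q R"
    and "one_dim_source_cond d q R"
  shows "koszul d (IS d q R) \<and> koszul d (IL d q R)
    \<and> (Abs_fps (\<lambda>n. of_nat (hdim d (IS d q R) n))
        * Abs_fps (\<lambda>n. (-1) ^ n * of_nat (hdim d (IL d q R) n)) :: int fps) = 1"
proof -
  have q: "q \<noteq> 0" using assms(1) by (simp add: hecke_symmetry_def)
  have rel: "rel_of True d q R = IS d q R" "rel_of False d q R = IL d q R" by (simp_all add: rel_of_def)
  note eb = exact_balanced_tens[OF q assms(2), unfolded exact_balanced_def]
  have ex: "exact_cx im (Rop d R) q (tens d N) N" if "N > 0" for im N using eb[OF that] by blast
  let ?a = "\<lambda>n. int (hdim d (IS d q R) n)" and ?b = "\<lambda>n. int (hdim d (IL d q R) n)"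
  let ?W = "\<lambda>n. Wsp d (IL d q R) n"
  \<comment> \<open>Coinvariants give \<open>S_n\<close>, invariants give the \<open>W_n\<close> of
    the complex of \<Lambda>. Degree 0 is separate because \<open>exact_balanced\<close> is
    available in positive degrees only.\<close>
  have aW: "?a n = int (fs.dim (?W n))" for n
  proof (cases "n = 0")
    case True
    have "Jsp d (IS d q R) 0 = {0}" "?W 0 = tens d 0" by (simp_all add: Jsp_def Wsp_def)
    thus ?thesis using True by (simp add: hdim_def)
  next
    case False
    hence "fs.dim (Fsp False (Rop d R) q (tens d n) n) + fs.dim (Zsp True (Rop d R) q (tens d n) n 0) = fs.dim (tens d n :: (nat list \<Rightarrow> 'k) set)"
      using eb by blast
    hence "fs.dim (?W n) + fs.dim (Jsp d (IS d q R) n) = fs.dim (tens d n :: (nat list \<Rightarrow> 'k) set)"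
      using Wsp_eq[of d False q R n] Jsp_eq[of d True q R n] rel by simp
    thus ?thesis using hdim_int[of d True q R n] rel by simp
  qed
  \<comment> \<open>The product of dimensions is that of \<open>W_n\<close> tensored with degree
    \<open>N - n\<close> of \<Lambda>, so the sum is the Euler characteristic of an exact
    complex.\<close>
  have conv: "(\<Sum>n\<le>N. (-1) ^ n * (?a n * ?b (N - n))) = 0" if N: "N > 0" for N
  proof -
    have "(\<Sum>n\<le>N. (-1) ^ n * (?a n * ?b (N - n))) = (\<Sum>n\<le>N. (-1) ^ n * (int (fs.dim (Fsp False (Rop d R) q (tens d N) n)) - int (fs.dim (Zsp False (Rop d R) q (tens d N) N n))))"
    proof (rule sum.cong[OF refl])
      fix n assume "n \<in> {..N}"
      hence nN: "n + (N - n) = N" by simp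
      have W: "fs.subspace (?W n)" "?W n \<subseteq> tens d n" using subspace_Wsp[of d False q R n] rel by simp_all
      have J: "fs.subspace (Jsp d (IL d q R) (N - n))" "Jsp d (IL d q R) (N - n) \<subseteq> tens d (N - n)"
        using subspace_Jsp[of d False q R "N - n"] rel by simp_all
      have "fs.dim (Fsp False (Rop d R) q (tens d N) n) = fs.dim (?W n) * fs.dim (tens d (N - n) :: (nat list \<Rightarrow> 'k) set)"
        using Ccx_eq[of d False q R n "N - n"] dim_tensor_sp[OF W subspace_tens order_refl, of "N - n"]
        unfolding Ccx_def rel nN by simp
      moreover have "fs.dim (Zsp False (Rop d R) q (tens d N) N n) = fs.dim (?W n) * fs.dim (Jsp d (IL d q R) (N - n))"
        using Zcx_eq[of d False q R n "N - n"] dim_tensor_sp[OF W J]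
        unfolding Zcx_def rel nN by simp
      moreover have "?b (N - n) = int (fs.dim (tens d (N - n) :: (nat list \<Rightarrow> 'k) set)) - int (fs.dim (Jsp d (IL d q R) (N - n)))"
        using hdim_int[of d False q R "N - n"] unfolding rel .
      ultimately show "(-1) ^ n * (?a n * ?b (N - n)) = (-1) ^ n * (int (fs.dim (Fsp False (Rop d R) q (tens d N) n)) - int (fs.dim (Zsp False (Rop d R) q (tens d N) N n)))"
        unfolding aW by (simp add: right_diff_distrib)
    qed
    also have "\<dots> = 0" by (rule euler_characteristic[OF N ex[OF N]])
    finally show ?thesis .
  qed
  have "fps_nth (Abs_fps ?a * Abs_fps (\<lambda>n. (-1) ^ n * ?b n)) N = fps_nth 1 N" for N
  proof (cases "N = 0")
    case True
    have "?a 0 = 1" "?b 0 = 1" by (simp_all add: hdim_def Jsp_def dim_tens_0)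
    thus ?thesis using True by (simp add: fps_mult_nth)
  next
    case False
    have "fps_nth (Abs_fps ?a * Abs_fps (\<lambda>n. (-1) ^ n * ?b n)) N = (\<Sum>n\<le>N. ?a n * ((-1) ^ (N - n) * ?b (N - n)))"
      by (simp add: fps_mult_nth atLeast0AtMost)
    \<comment> \<open>The series has the sign on the factor of \<Lambda>, whereas the Euler
      characteristic has it on \<open>n\<close>; the two differ by the overall sign
      \<open>(-1) ^ N\<close>.\<close>
    also have "\<dots> = (\<Sum>n\<le>N. (-1) ^ N * ((-1) ^ n * (?a n * ?b (N - n))))"
    proof (rule sum.cong[OF refl])
      fix n assume "n \<in> {..N}"
      hence "(-1 :: int) ^ N = (-1) ^ (N - n) * (-1) ^ n" by (simp flip: power_add)
      thus "?a n * ((-1) ^ (N - n) * ?b (N - n)) = (-1) ^ N * ((-1) ^ n * (?a n * ?b (N - n)))"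
        by (simp add: algebra_simps flip: power_mult_distrib)
    qed
    also have "\<dots> = 0" using conv[of N] False by (simp flip: sum_distrib_left)
    finally show ?thesis using False by simp
  qed
  hence "Abs_fps ?a * Abs_fps (\<lambda>n. (-1) ^ n * ?b n) = 1" by (intro fps_ext)
  moreover have "koszul d (IS d q R)" "koszul d (IL d q R)"
    using koszul_rel_of[OF ex, of True] koszul_rel_of[OF ex, of False] unfolding rel by blast+
  ultimately show ?thesis by blast
qed

end
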